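(* For every integer $d \geq 3$ and every integer $s$ with $1 \leq s \leq g+1$, where $g=\frac{(d-1)(d-2)}{2}$, there exists a real plane curve $X \subset \mathbb{P}^2$ of degree $d$, genus $g$ and having exactly $s$ branches such that the linear series of lines $|L|$ on $X$ is totally real.
   Context: A real (algebraic) curve $X$ is an integral, smooth (no real or complex singularities) and projective variety of dimension $1$ defined over $\mathbb{R}$ such that the set $X(\mathbb{R})$ of real points is non-empty. A real plane curve is a real curve embedded (over $\mathbb{R}$) in $\mathbb{P}^2$. The branches of $X$ are the connected components of the real analytic manifold $X(\mathbb{R})$. Divisors on $X$ are formal $\mathbb{Z}$-linear combinations of (real or complex) points of $X$, and only divisors defined over $\mathbb{R}$ are considered, i.e. conjugation-invariant ones: for any point in the support, its complex conjugate appears with equal multiplicity. A divisor is effective if all its multiplicities are nonnegative. An effective divisor is called totally real if its support consists of real points only. A linear series is called totally real if it contains a totally real effective divisor. The linear series of lines $|L|$ on a plane curve $X\subset\mathbb{P}^2$ of degree $d$ is the set of intersection divisors $X\cdot \ell$ (of degree $d$, points counted with intersection multiplicity), where $\ell$ runs over the real lines $\ell \subset \mathbb{P}^2$. Thus $|L|$ is totally real if and only if there is a real line meeting $X$ in real points only. *)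

theory Defs
  imports "HOL-Analysis.Analysis" "HOL-Library.Poly_Mapping" "HOL-Library.Numeral_Type"
    "HOL-Computational_Algebra.Computational_Algebra"
begin

section \<open>Ternary forms\<close>

text \<open>\<open>poly3\<close> is the ring \<open>\<real>[x, y, z]\<close>: a monomial is an exponent vector indexed by the
  three-element type \<open>3\<close>, and a polynomial is a finitely supported family of coefficients.\<close>

type_synonym poly3 = "(3 \<Rightarrow>\<^sub>0 nat) \<Rightarrow>\<^sub>0 real"

definition homogeneous :: "nat \<Rightarrow> poly3 \<Rightarrow> bool" where
  "homogeneous d F \<longleftrightarrow> (\<forall>m \<in> Poly_Mapping.keys F. (\<Sum>i\<in>UNIV. Poly_Mapping.lookup m i) = d)"

text \<open>Substitution into an arbitrary commutative algebra, with structure map \<open>h\<close>.\<close>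

definition subst :: "(real \<Rightarrow> 'a::comm_semiring_1) \<Rightarrow> poly3 \<Rightarrow> 'a ^ 3 \<Rightarrow> 'a" where
  "subst h F v =
     (\<Sum>m \<in> Poly_Mapping.keys F.
       h (Poly_Mapping.lookup F m) * (\<Prod>i\<in>UNIV. (v $ i) ^ Poly_Mapping.lookup m i))"

definition eval :: "poly3 \<Rightarrow> 'a::real_field ^ 3 \<Rightarrow> 'a" where
  "eval F v = subst of_real F v"

text \<open>If \<open>x\<^sub>i\<close> does not occur in the monomial \<open>m\<close>, the subtraction of exponents truncates, but the
  coefficient is then zero.\<close>

definition partial :: "3 \<Rightarrow> poly3 \<Rightarrow> poly3" where
  "partial i F = (\<Sum>m \<in> Poly_Mapping.keys F.
     Poly_Mapping.single (m - Poly_Mapping.single i 1)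
       (Poly_Mapping.lookup F m * of_nat (Poly_Mapping.lookup m i)))"


section \<open>The projective plane\<close>

text \<open>The points of the projective plane over a field are the lines through the origin.\<close>

definition proj_plane :: "('a::field ^ 3) set set" where
  "proj_plane = {vec.span {v} | v. v \<noteq> 0}"

definition zero_locus :: "poly3 \<Rightarrow> ('a::real_field ^ 3) set set" where
  "zero_locus F = {P \<in> proj_plane. \<forall>v\<in>P. eval F v = 0}"

text \<open>The real projective plane with its quotient topology.\<close>

definition RP2 :: "(real ^ 3) set topology" where
  "RP2 = topology (\<lambda>U. U \<subseteq> proj_plane \<and> open {v. v \<noteq> 0 \<and> vec.span {v} \<in> U})"

lemma openin_RP2:
  "openin RP2 U \<longleftrightarrow> U \<subseteq> proj_plane \<and> open {v. v \<noteq> 0 \<and> vec.span {v} \<in> U}"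
proof -
  have "istopology (\<lambda>U. U \<subseteq> proj_plane \<and> open {v :: real ^ 3. v \<noteq> 0 \<and> vec.span {v} \<in> U})"
    unfolding istopology_def
  proof (intro conjI allI impI)
    fix S T :: "(real ^ 3) set set"
    assume S: "S \<subseteq> proj_plane \<and> open {v. v \<noteq> 0 \<and> vec.span {v} \<in> S}"
      and T: "T \<subseteq> proj_plane \<and> open {v. v \<noteq> 0 \<and> vec.span {v} \<in> T}"
    have "{v. v \<noteq> 0 \<and> vec.span {v} \<in> S \<inter> T} =
        {v. v \<noteq> 0 \<and> vec.span {v} \<in> S} \<inter> {v. v \<noteq> 0 \<and> vec.span {v} \<in> T}"
      by auto
    then show "open {v. v \<noteq> 0 \<and> vec.span {v} \<in> S \<inter> T}"
      using S T by (simp add: open_Int)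
    show "S \<inter> T \<subseteq> proj_plane" using S by blast
  next
    fix K :: "(real ^ 3) set set set"
    assume K: "\<forall>S\<in>K. S \<subseteq> proj_plane \<and> open {v. v \<noteq> 0 \<and> vec.span {v} \<in> S}"
    have "{v. v \<noteq> 0 \<and> vec.span {v} \<in> \<Union>K} = (\<Union>S\<in>K. {v. v \<noteq> 0 \<and> vec.span {v} \<in> S})"
      by auto
    then show "open {v. v \<noteq> 0 \<and> vec.span {v} \<in> \<Union>K}"
      using K by (simp add: open_UN)
    show "\<Union>K \<subseteq> proj_plane" using K by blast
  qed
  then show ?thesis
    unfolding RP2_def by (simp add: topology_inverse')
qed

lemma topspace_RP2: "topspace RP2 = proj_plane"
proof -
  have "{v :: real ^ 3. v \<noteq> 0 \<and> vec.span {v} \<in> proj_plane} = - {0}"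
    by (auto simp: proj_plane_def)
  then have "openin RP2 proj_plane"
    by (simp add: openin_RP2 open_Compl)
  then show ?thesis
    by (metis openin_RP2 openin_subset openin_topspace subset_antisym)
qed

lemma quotient_map_RP2:
  "quotient_map (top_of_set (- {0})) RP2 (\<lambda>v :: real ^ 3. vec.span {v})"
proof -
  have "openin (top_of_set (- {0 :: real ^ 3})) W \<longleftrightarrow> open W" if "W \<subseteq> - {0}" for W
    using that by (simp add: openin_open_eq open_Compl)
  moreover have "{v \<in> - {0 :: real ^ 3}. vec.span {v} \<in> U} = {v. v \<noteq> 0 \<and> vec.span {v} \<in> U}" for U
    by auto
  ultimately show ?thesis
    unfolding quotient_map_def topspace_RP2 openin_RP2
    by (force simp: proj_plane_def)
qed


section \<open>Real plane curves\<close>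

text \<open>A curve is given by an irreducible real form; smoothness is required at all complex points,
  by the Jacobian criterion.\<close>

definition smooth :: "poly3 \<Rightarrow> bool" where
  "smooth F \<longleftrightarrow>
     (\<forall>v :: complex ^ 3. v \<noteq> 0 \<and> eval F v = 0 \<longrightarrow> (\<exists>i. eval (partial i F) v \<noteq> 0))"

definition real_plane_curve :: "nat \<Rightarrow> poly3 \<Rightarrow> bool" where
  "real_plane_curve d F \<longleftrightarrow>
     homogeneous d F \<and> irreducible F \<and> smooth F \<and>
     (zero_locus F :: (real ^ 3) set set) \<noteq> {}"

definition branches :: "poly3 \<Rightarrow> (real ^ 3) set set set" where
  "branches F = connected_components_of (subtopology RP2 (zero_locus F))"

abbreviation scale3 :: "real \<Rightarrow> poly3 \<Rightarrow> poly3" where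
  "scale3 c F \<equiv> Poly_Mapping.single 0 c * F"

lemma vector_space_scale3: "vector_space scale3"
  by unfold_locales
     (simp_all add: algebra_simps single_add mult_single flip: mult.assoc single_one)

text \<open>The Hilbert function of the homogeneous coordinate ring \<open>\<real>[x, y, z] / (F)\<close>.\<close>

definition hilbert_function :: "poly3 \<Rightarrow> nat \<Rightarrow> int" where
  "hilbert_function F n =
     int (vector_space.dim scale3 {G. homogeneous n G}) -
     int (vector_space.dim scale3 {G. homogeneous n G \<and> F dvd G})"

text \<open>The arithmetic genus \<open>1 - P(0)\<close>, where \<open>P\<close> is the Hilbert polynomial; for a smooth,
  geometrically integral projective curve this is the genus.\<close>

definition has_genus :: "poly3 \<Rightarrow> nat \<Rightarrow> bool" where
  "has_genus F g \<longleftrightarrow> (\<exists>P :: real poly.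
     (\<forall>\<^sub>F n in sequentially. of_int (hilbert_function F n) = poly P (of_nat n)) \<and>
     poly P 0 = 1 - of_nat g)"


section \<open>Divisors and the linear series of lines\<close>

type_synonym divisor = "(complex ^ 3) set \<Rightarrow>\<^sub>0 int"

definition conj_point :: "(complex ^ 3) set \<Rightarrow> (complex ^ 3) set" where
  "conj_point P = (\<lambda>v. \<chi> i. cnj (v $ i)) ` P"

definition real_point :: "(complex ^ 3) set \<Rightarrow> bool" where
  "real_point P \<longleftrightarrow> (\<exists>v :: real ^ 3. v \<noteq> 0 \<and> P = vec.span {\<chi> i. of_real (v $ i)})"

text \<open>Only divisors defined over \<open>\<real>\<close> are considered.\<close>

definition divisors :: "poly3 \<Rightarrow> divisor set" where
  "divisors F = {D. Poly_Mapping.keys D \<subseteq> zero_locus F \<and>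
     (\<forall>P. Poly_Mapping.lookup D (conj_point P) = Poly_Mapping.lookup D P)}"

definition effective :: "divisor \<Rightarrow> bool" where
  "effective D \<longleftrightarrow> (\<forall>P. Poly_Mapping.lookup D P \<ge> 0)"

definition totally_real_divisor :: "divisor \<Rightarrow> bool" where
  "totally_real_divisor D \<longleftrightarrow> (\<forall>P \<in> Poly_Mapping.keys D. real_point P)"

definition totally_real_series :: "divisor set \<Rightarrow> bool" where
  "totally_real_series L \<longleftrightarrow> (\<exists>D\<in>L. effective D \<and> totally_real_divisor D)"

text \<open>A real line is given by a nonzero coefficient vector \<open>l\<close>.\<close>

definition on_line :: "real ^ 3 \<Rightarrow> complex ^ 3 \<Rightarrow> bool" where
  "on_line l v \<longleftrightarrow> (\<Sum>i\<in>UNIV. of_real (l $ i) * v $ i) = 0"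

text \<open>The univariate polynomial \<open>F(p + t q)\<close> in \<open>t\<close>.\<close>

definition restrict_to_line :: "poly3 \<Rightarrow> complex ^ 3 \<Rightarrow> complex ^ 3 \<Rightarrow> complex poly" where
  "restrict_to_line F p q = subst (\<lambda>c. [:of_real c:]) F (\<chi> i. [:p $ i, q $ i:])"

text \<open>The intersection multiplicity of the curve with the line \<open>l\<close> at \<open>P\<close> is the order of
  vanishing of \<open>F\<close> along the line. For a form \<open>F\<close> not vanishing identically on the line it does
  not depend on the chosen parametrization \<open>p + t q\<close> with \<open>P = [p]\<close>.\<close>

definition intersection_mult :: "poly3 \<Rightarrow> real ^ 3 \<Rightarrow> (complex ^ 3) set \<Rightarrow> nat" where
  "intersection_mult F l P =
     (if P \<in> proj_plane \<and> (\<forall>v\<in>P. on_line l v)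
      then SOME m. \<exists>p q. p \<noteq> 0 \<and> P = vec.span {p} \<and> on_line l q \<and> q \<notin> P \<and>
             m = order 0 (restrict_to_line F p q)
      else 0)"

definition line_series :: "poly3 \<Rightarrow> divisor set" where
  "line_series F = {D \<in> divisors F.
     \<exists>l. l \<noteq> 0 \<and> (\<forall>P. Poly_Mapping.lookup D P = int (intersection_mult F l P))}"

end

theory Submission imports Defs
begin

text \<open>Multiplying the lines \<open>w = a u + b v\<close> over all \<open>d\<close>-th roots of unity \<open>a\<close>, \<open>b\<close> gives a real form in
  \<open>u\<^sup>d\<close>, \<open>v\<^sup>d\<close>, \<open>w\<^sup>d\<close>, hence a form \<open>R(x, y, z)\<close> of degree \<open>d\<close>. Its real zeros are the circle
  \<open>(cos\<^sup>d \<theta> : sin\<^sup>d \<theta> : (cos \<theta> + sin \<theta>)\<^sup>d)\<close> and \<open>g\<close> solitary nodes. As \<open>R(x, 0, z) = (z - x)\<^sup>d\<close>, the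
  line \<open>y = 0\<close> is a hyperflex, and it remains one for \<open>F = R + \<epsilon> h\<close> if \<open>y\<close> divides \<open>h\<close>. A hyperflex makes
  the series of lines totally real, and a smooth curve with a hyperflex is irreducible.

  No nonzero form of degree \<open>d - 3\<close> vanishes at all nodes, because the curve \<open>R = 0\<close> is rational and
  there are \<open>g = dim\<close> nodes. So \<open>h = x y z K\<close> can be chosen with prescribed values at the nodes, and for
  small \<open>\<epsilon> > 0\<close> the curve \<open>F = 0\<close> is smooth, while each node either disappears or becomes an oval according
  to the sign of \<open>h\<close> there. The circle deforms to one further branch.\<close>

text \<open>R is the image of the line w = u + v under the coordinatewise d-th power, a local
  isomorphism away from the coordinate lines. Questions about R become questions about d^2 lines
  with coefficients on the unit circle. A second line through a point of w = u + v amounts to a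
  triangle inscribed in this circle and known up to similarity, which determines all nodes. At a
  node the two lines are exchanged by conjugation, so R is locally a real factor of constant sign
  times a squared modulus, and only its sign relative to that of h matters. As the values of h at
  the g nodes are independent, one degeneration serves every s. Total reality would ordinarily call
  for d real intersections that survive the perturbation. The hyperflex avoids this: it is a
  polynomial identity on y = 0, untouched by \<epsilon> h. Branches are counted without an implicit
  function theorem: the real zeros are enclosed in compact families of arcs along which F, or the
  quotient - R / h, is strictly monotone, and compactness excludes zeros elsewhere.\<close>

no_notation fps_nth (infixl "$" 75)


section \<open>Evaluation and derivatives of ternary forms\<close>

definition monom_val :: "'a::comm_semiring_1 ^ 3 \<Rightarrow> (3 \<Rightarrow>\<^sub>0 nat) \<Rightarrow> 'a" where
  "monom_val v m = (\<Prod>i\<in>UNIV. (v $ i) ^ Poly_Mapping.lookup m i)"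

definition total_degree :: "(3 \<Rightarrow>\<^sub>0 nat) \<Rightarrow> nat" where
  "total_degree m = (\<Sum>i\<in>UNIV. Poly_Mapping.lookup m i)"

text \<open>Coefficients lie in an arbitrary semiring \<open>'b\<close>, since the product of lines
  has complex coefficients; \<open>subst\<close> is the case of real ones.\<close>

definition msubst :: "('b::comm_semiring_1 \<Rightarrow> 'a::comm_semiring_1) \<Rightarrow>
    ((3 \<Rightarrow>\<^sub>0 nat) \<Rightarrow>\<^sub>0 'b) \<Rightarrow> 'a ^ 3 \<Rightarrow> 'a" where
  "msubst h F v = (\<Sum>m \<in> Poly_Mapping.keys F. h (Poly_Mapping.lookup F m) * monom_val v m)"

lemma prod_UNIV_3: "prod f (UNIV :: 3 set) = f 1 * f 2 * f 3"
  unfolding UNIV_3 by (simp add: mult.assoc)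

lemma monom_val_3:
  "monom_val v m = v $ 1 ^ Poly_Mapping.lookup m 1 * v $ 2 ^ Poly_Mapping.lookup m 2 *
     v $ 3 ^ Poly_Mapping.lookup m 3"
  by (simp add: monom_val_def prod_UNIV_3)

lemma total_degree_3:
  "total_degree m = Poly_Mapping.lookup m 1 + Poly_Mapping.lookup m 2 + Poly_Mapping.lookup m 3"
  by (simp add: total_degree_def sum_3)

lemma total_degree_add: "total_degree (m + m') = total_degree m + total_degree m'"
  by (simp add: total_degree_def lookup_add sum.distrib)

lemma monom_val_add: "monom_val v (m + m') = monom_val v m * monom_val v m'"
  by (simp add: monom_val_def lookup_add power_add prod.distrib)

lemma monom_val_0 [simp]: "monom_val v 0 = 1"
  by (simp add: monom_val_def)

lemma monom_val_single: "monom_val v (Poly_Mapping.single i n) = v $ i ^ n"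
proof -
  have "(\<Prod>j\<in>UNIV. (v $ j) ^ Poly_Mapping.lookup (Poly_Mapping.single i n) j) =
      (\<Prod>j\<in>UNIV. if j = i then v $ i ^ n else 1)"
    by (intro prod.cong) (auto simp: lookup_single when_def)
  then show ?thesis by (simp add: monom_val_def)
qed

lemma monom_val_scale: "monom_val (\<chi> i. c * v $ i) m = c ^ total_degree m * monom_val v m"
  by (simp add: monom_val_def power_mult_distrib prod.distrib total_degree_def power_sum)

lemma exponent_eqI:
  fixes m m' :: "3 \<Rightarrow>\<^sub>0 nat"
  assumes "Poly_Mapping.lookup m 1 = Poly_Mapping.lookup m' 1"
    and "Poly_Mapping.lookup m 2 = Poly_Mapping.lookup m' 2"
    and "Poly_Mapping.lookup m 3 = Poly_Mapping.lookup m' 3"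
  shows "m = m'"
  using assms by (simp add: poly_mapping_eq_iff fun_eq_iff forall_3)

definition exponent3 :: "nat \<Rightarrow> nat \<Rightarrow> nat \<Rightarrow> (3 \<Rightarrow>\<^sub>0 nat)" where
  "exponent3 a b c = Poly_Mapping.single 1 a + Poly_Mapping.single 2 b + Poly_Mapping.single 3 c"

lemma lookup_exponent3 [simp]:
  "Poly_Mapping.lookup (exponent3 a b c) 1 = a"
  "Poly_Mapping.lookup (exponent3 a b c) 2 = b"
  "Poly_Mapping.lookup (exponent3 a b c) 3 = c"
  by (simp_all add: exponent3_def lookup_add lookup_single when_def)

lemma exponent3_lookup:
  "exponent3 (Poly_Mapping.lookup m 1) (Poly_Mapping.lookup m 2) (Poly_Mapping.lookup m 3) = m"
  by (rule exponent_eqI) simp_all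

lemma poly_mapping_sum_single: "(\<Sum>m\<in>Poly_Mapping.keys F. Poly_Mapping.single m (Poly_Mapping.lookup F m)) = F"
proof (rule poly_mapping_eqI)
  fix k
  show "Poly_Mapping.lookup (\<Sum>m\<in>Poly_Mapping.keys F. Poly_Mapping.single m (Poly_Mapping.lookup F m)) k =
      Poly_Mapping.lookup F k"
    by (simp add: lookup_sum lookup_single when_def not_in_keys_iff_lookup_eq_zero)
qed

text \<open>Evaluation at points, restriction to a line, the grading and the symmetries of the
  product of lines are all \<open>msubst\<close> along some homomorphism of coefficients, so
  multiplicativity is proved once.\<close>

locale coeff_hom =
  fixes h :: "'b::comm_semiring_1 \<Rightarrow> 'a::comm_semiring_1"
  assumes hom_0 [simp]: "h 0 = 0" and hom_1 [simp]: "h 1 = 1"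
    and hom_add: "h (x + y) = h x + h y" and hom_mult: "h (x * y) = h x * h y"
begin

lemma msubst_superset:
  assumes "finite S" "Poly_Mapping.keys F \<subseteq> S"
  shows "msubst h F v = (\<Sum>m\<in>S. h (Poly_Mapping.lookup F m) * monom_val v m)"
  unfolding msubst_def using assms
  by (intro sum.mono_neutral_left) (auto simp: not_in_keys_iff_lookup_eq_zero)

lemma msubst_0 [simp]: "msubst h 0 v = 0"
  by (simp add: msubst_def)

lemma msubst_single: "msubst h (Poly_Mapping.single m c) v = h c * monom_val v m"
  using msubst_superset[of "{m}" "Poly_Mapping.single m c" v] by (simp add: keys_single)

lemma msubst_1 [simp]: "msubst h 1 v = 1"
  using msubst_single[of 0 1 v] by simp

lemma msubst_add: "msubst h (F + G) v = msubst h F v + msubst h G v"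
proof -
  let ?S = "Poly_Mapping.keys F \<union> Poly_Mapping.keys G"
  have "Poly_Mapping.keys (F + G) \<subseteq> ?S" by (rule keys_add)
  then show ?thesis
    using msubst_superset[of ?S "F + G" v] msubst_superset[of ?S F v] msubst_superset[of ?S G v]
    by (simp add: lookup_add hom_add algebra_simps sum.distrib)
qed

lemma msubst_sum: "msubst h (\<Sum>i\<in>I. F i) v = (\<Sum>i\<in>I. msubst h (F i) v)"
  by (induction I rule: infinite_finite_induct) (simp_all add: msubst_add)

lemma msubst_mult: "msubst h (F * G) v = msubst h F v * msubst h G v"
proof -
  have "F * G = (\<Sum>m\<in>Poly_Mapping.keys F. \<Sum>m'\<in>Poly_Mapping.keys G.
      Poly_Mapping.single (m + m') (Poly_Mapping.lookup F m * Poly_Mapping.lookup G m'))"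
    by (subst (1) poly_mapping_sum_single[of F, symmetric],
        subst (1) poly_mapping_sum_single[of G, symmetric])
       (simp add: sum_product mult_single)
  then have "msubst h (F * G) v = (\<Sum>m\<in>Poly_Mapping.keys F. \<Sum>m'\<in>Poly_Mapping.keys G.
      h (Poly_Mapping.lookup F m) * monom_val v m * (h (Poly_Mapping.lookup G m') * monom_val v m'))"
    by (simp add: msubst_sum msubst_single hom_mult monom_val_add algebra_simps)
  then show ?thesis
    by (simp add: msubst_def sum_product)
qed

lemma msubst_prod: "msubst h (\<Prod>i\<in>I. F i) v = (\<Prod>i\<in>I. msubst h (F i) v)"
  by (induction I rule: infinite_finite_induct) (simp_all add: msubst_mult)

end

lemma subst_eq_msubst: "subst h F v = msubst h F v"
  by (simp add: subst_def msubst_def monom_val_def)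

lemma coeff_hom_of_real: "coeff_hom (of_real :: real \<Rightarrow> 'a::{real_algebra_1,comm_semiring_1})"
  by unfold_locales simp_all

interpretation of_real_hom: coeff_hom "of_real :: real \<Rightarrow> 'a::real_field"
  by (rule coeff_hom_of_real)

lemma eval_eq_msubst: "eval F v = msubst of_real F v"
  by (simp add: eval_def subst_eq_msubst)

lemma eval_0 [simp]: "eval 0 v = 0"
  and eval_1 [simp]: "eval 1 v = 1"
  and eval_add: "eval (F + G) v = eval F v + eval G v"
  and eval_mult: "eval (F * G) v = eval F v * eval G v"
  and eval_single: "eval (Poly_Mapping.single m c) v = of_real c * monom_val v m"
  and eval_sum: "eval (\<Sum>i\<in>I. f i) v = (\<Sum>i\<in>I. eval (f i) v)"
  for v :: "'a::real_field ^ 3"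
  by (simp_all add: eval_eq_msubst of_real_hom.msubst_add of_real_hom.msubst_mult
      of_real_hom.msubst_single of_real_hom.msubst_sum)

lemma eval_const [simp]: "eval (Poly_Mapping.single 0 c) v = of_real c"
  by (simp add: eval_single)

lemma eval_conv_sum:
  fixes v :: "'a::real_field ^ 3"
  shows "eval F v = (\<Sum>m\<in>Poly_Mapping.keys F. of_real (Poly_Mapping.lookup F m) * monom_val v m)"
  by (simp add: eval_eq_msubst msubst_def)

lemma homogeneous_iff: "homogeneous n F \<longleftrightarrow> (\<forall>m\<in>Poly_Mapping.keys F. total_degree m = n)"
  by (simp add: homogeneous_def total_degree_def)

lemma eval_scale:
  fixes v :: "'a::real_field ^ 3"
  assumes "homogeneous n F"
  shows "eval F (\<chi> i. c * v $ i) = c ^ n * eval F v"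
  using assms unfolding eval_conv_sum homogeneous_iff
  by (auto simp: monom_val_scale sum_distrib_left algebra_simps intro!: sum.cong)

lemma eval_of_real:
  fixes v :: "real ^ 3"
  shows "eval F ((\<chi> i. of_real (v $ i)) :: 'a::real_field ^ 3) = of_real (eval F v)"
  by (simp add: eval_conv_sum monom_val_def)

lemma vec3_eqI: "v $ 1 = w $ 1 \<Longrightarrow> v $ 2 = w $ 2 \<Longrightarrow> v $ 3 = w $ 3 \<Longrightarrow> v = (w :: 'a ^ 3)"
  by (simp add: vec_eq_iff forall_3)

lemma continuous_on_monom_val [continuous_intros]:
  fixes f :: "'t::topological_space \<Rightarrow> 'a::real_normed_field ^ 3"
  assumes "continuous_on S f"
  shows "continuous_on S (\<lambda>x. monom_val (f x) m)"
  unfolding monom_val_def using assms by (intro continuous_intros)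

lemma continuous_on_eval [continuous_intros]:
  fixes f :: "'t::topological_space \<Rightarrow> 'a::real_normed_field ^ 3"
  assumes "continuous_on S f"
  shows "continuous_on S (\<lambda>x. eval F (f x))"
  unfolding eval_conv_sum using assms by (intro continuous_intros)

lemma tendsto_eval [tendsto_intros]:
  fixes f :: "'t \<Rightarrow> 'a::real_normed_field ^ 3"
  assumes "(f \<longlongrightarrow> v) net"
  shows "((\<lambda>x. eval F (f x)) \<longlongrightarrow> eval F v) net"
  using continuous_on_tendsto_compose[of UNIV "\<lambda>v. eval F v" f v net] assms
    continuous_on_eval[OF continuous_on_id, of UNIV F]
  by simp

lemma partial_eval: "eval (partial i F) v =
    (\<Sum>m\<in>Poly_Mapping.keys F. of_real (Poly_Mapping.lookup F m) * of_nat (Poly_Mapping.lookup m i) *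
       monom_val v (m - Poly_Mapping.single i 1))"
  by (simp add: partial_def eval_sum eval_single)

lemma monom_val_DERIV:
  fixes \<gamma> :: "'a::real_normed_field \<Rightarrow> 'a ^ 3"
  assumes "\<And>i. ((\<lambda>t. \<gamma> t $ i) has_field_derivative \<gamma>' $ i) (at t within S)"
  shows "((\<lambda>t. monom_val (\<gamma> t) m) has_field_derivative
    (\<Sum>i\<in>UNIV. of_nat (Poly_Mapping.lookup m i) * monom_val (\<gamma> t) (m - Poly_Mapping.single i 1) * \<gamma>' $ i)) (at t within S)"
proof -
  have l: "Poly_Mapping.lookup (m - Poly_Mapping.single i 1) j =
      (if i = j then Poly_Mapping.lookup m j - 1 else Poly_Mapping.lookup m j)" for i j
    by (simp add: lookup_minus lookup_single when_def)
  show ?thesis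
    unfolding monom_val_3 l sum_3
    by (rule derivative_eq_intros assms | simp add: algebra_simps)+
qed

lemma eval_DERIV:
  fixes \<gamma> :: "'a::real_normed_field \<Rightarrow> 'a ^ 3"
  assumes "\<And>i. ((\<lambda>t. \<gamma> t $ i) has_field_derivative \<gamma>' $ i) (at t within S)"
  shows "((\<lambda>t. eval F (\<gamma> t)) has_field_derivative
    (\<Sum>i\<in>UNIV. eval (partial i F) (\<gamma> t) * \<gamma>' $ i)) (at t within S)"
proof -
  have "((\<lambda>t. eval F (\<gamma> t)) has_field_derivative
     (\<Sum>m\<in>Poly_Mapping.keys F. of_real (Poly_Mapping.lookup F m) * (\<Sum>i\<in>UNIV. of_nat (Poly_Mapping.lookup m i) * monom_val (\<gamma> t) (m - Poly_Mapping.single i 1) * \<gamma>' $ i))) (at t within S)"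
    unfolding eval_conv_sum
    by (intro DERIV_sum DERIV_cmult monom_val_DERIV assms)
  also have "(\<Sum>m\<in>Poly_Mapping.keys F. of_real (Poly_Mapping.lookup F m) * (\<Sum>i\<in>UNIV. of_nat (Poly_Mapping.lookup m i) * monom_val (\<gamma> t) (m - Poly_Mapping.single i 1) * \<gamma>' $ i)) =
    (\<Sum>i\<in>UNIV. eval (partial i F) (\<gamma> t) * \<gamma>' $ i)"
    unfolding partial_eval sum_distrib_left sum_distrib_right
    by (subst sum.swap) (simp add: algebra_simps)
  finally show ?thesis .
qed

text \<open>Identifies the formal \<open>partial\<close> with a derivative, so that the sum and
  product rules follow from uniqueness of derivatives instead of a computation with
  exponents.\<close>

lemma partial_DERIV:
  fixes v :: "'a::real_normed_field ^ 3"
  shows "((\<lambda>t. eval F (\<chi> j. v $ j + t * (if j = i then 1 else 0))) has_field_derivative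
    eval (partial i F) v) (at 0)"
proof -
  let ?g = "\<lambda>t. (\<chi> j. v $ j + t * (if j = i then 1 else 0)) :: 'a ^ 3"
  have D: "((\<lambda>t. ?g t $ j) has_field_derivative (\<chi> j. if j = i then 1 else 0) $ j) (at 0)" for j
    by (auto intro!: derivative_eq_intros)
  have "(\<Sum>j\<in>UNIV. eval (partial j F) (?g 0) * (\<chi> j. if j = i then 1 else 0) $ j) =
      (\<Sum>j\<in>UNIV. if j = i then eval (partial j F) (?g 0) else 0)"
    by (intro sum.cong) auto
  moreover have "?g 0 = v" by (simp add: vec_eq_iff)
  ultimately show ?thesis using eval_DERIV[OF D, of F] by simp
qed

lemma eval_partial_add:
  fixes v :: "'a::real_normed_field ^ 3"
  shows "eval (partial i (F + G)) v = eval (partial i F) v + eval (partial i G) v"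
  using DERIV_add[OF partial_DERIV partial_DERIV, of F v i G v i] partial_DERIV[of "F + G" v i]
  by (intro DERIV_unique[of _ _ 0]) (auto simp: eval_add)

lemma eval_partial_mult:
  fixes v :: "'a::real_normed_field ^ 3"
  shows "eval (partial i (F * G)) v = eval (partial i F) v * eval G v + eval F v * eval (partial i G) v"
  using DERIV_mult[OF partial_DERIV partial_DERIV, of F v i G v i] partial_DERIV[of "F * G" v i]
  by (intro DERIV_unique[of _ _ 0]) (auto simp: eval_mult algebra_simps)


section \<open>Homogeneous forms and the genus\<close>

lemma homogeneous_mult:
  assumes "homogeneous a A" "homogeneous b B"
  shows "homogeneous (a + b) (A * B)"
  using assms keys_mult[of A B] unfolding homogeneous_iff by (fastforce simp: total_degree_add)

lemma homogeneous_add: "homogeneous n F \<Longrightarrow> homogeneous n G \<Longrightarrow> homogeneous n (F + G)"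
  using keys_add[of F G] unfolding homogeneous_iff by blast

lemma homogeneous_sum: "(\<And>i. i \<in> I \<Longrightarrow> homogeneous n (f i)) \<Longrightarrow> homogeneous n (\<Sum>i\<in>I. f i)"
proof (induction I rule: infinite_finite_induct)
  case (insert i I)
  then show ?case by (simp add: homogeneous_add)
qed (simp_all add: homogeneous_iff)

lemma homogeneous_single: "total_degree m = n \<Longrightarrow> homogeneous n (Poly_Mapping.single m c)"
  by (auto simp: homogeneous_iff)

lemma total_degree_0 [simp]: "total_degree 0 = 0"
  by (simp add: total_degree_def)

lemma total_degree_eq_0_iff: "total_degree m = 0 \<longleftrightarrow> m = 0"
  by (auto simp: total_degree_3 intro: exponent_eqI)

text \<open>X is prime: one factor has constant coefficient 0, and X can be cancelled. Used over
  \<open>poly3\<close> for the homogeneity of factors and over the complex numbers for the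
  restriction to the flex line.\<close>

lemma monom_factors:
  fixes p q :: "'a::idom poly"
  assumes "p * q = monom c n" "c \<noteq> 0"
  shows "\<exists>a b k l. p = monom a k \<and> q = monom b l \<and> k + l = n"
  using assms(1)
proof (induction n arbitrary: p q)
  case 0
  then have "p \<noteq> 0" "q \<noteq> 0" using \<open>c \<noteq> 0\<close> by (auto simp: monom_0)
  moreover have "degree (p * q) = 0" using 0 by (simp add: monom_0)
  ultimately have "degree p = 0" "degree q = 0" by (simp_all add: degree_mult_eq)
  then show ?case by (metis add_0 degree_0_id monom_0)
next
  case (Suc n)
  have "coeff p 0 * coeff q 0 = 0"
    using Suc.prems using coeff_mult_0[of p q] by simp
  then consider "coeff p 0 = 0" | "coeff q 0 = 0" by auto
  then show ?case
  proof cases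
    case 1
    then obtain p' where p': "p = pCons 0 p'" by (metis coeff_pCons_0 pCons_cases)
    then have "p' * q = monom c n" using Suc.prems by (simp add: monom_Suc)
    then show ?thesis using Suc.IH p' by (metis add_Suc monom_Suc)
  next
    case 2
    then obtain q' where q': "q = pCons 0 q'" by (metis coeff_pCons_0 pCons_cases)
    then have "p * q' = monom c n" using Suc.prems by (simp add: monom_Suc)
    then show ?thesis using Suc.IH q' by (metis add_Suc_right monom_Suc)
  qed
qed

text \<open>The substitution \<open>x\<^sub>i \<mapsto> t x\<^sub>i\<close> separates the homogeneous components: the one of degree \<open>n\<close>
  becomes the coefficient of \<open>t\<^sup>n\<close>.\<close>

definition grading :: "poly3 \<Rightarrow> poly3 poly" where
  "grading F = msubst (\<lambda>c. [:Poly_Mapping.single 0 c:]) F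
     (\<chi> i. monom (Poly_Mapping.single (Poly_Mapping.single i 1) 1) 1)"

interpretation grading_hom: coeff_hom "\<lambda>c. [:Poly_Mapping.single 0 c:] :: poly3 poly"
  by unfold_locales (simp_all add: single_add mult_single one_pCons, simp add: mult.commute)

lemma single_power: "Poly_Mapping.single (Poly_Mapping.single i (1::nat)) (1::'b::comm_semiring_1) ^ k =
    Poly_Mapping.single (Poly_Mapping.single i k) 1"
  by (induction k) (simp_all add: mult_single flip: single_add)

lemma grading_single: "grading (Poly_Mapping.single m c) = monom (Poly_Mapping.single m c) (total_degree m)"
proof -
  have "m = Poly_Mapping.single 1 (Poly_Mapping.lookup m 1) +
      Poly_Mapping.single 2 (Poly_Mapping.lookup m 2) + Poly_Mapping.single 3 (Poly_Mapping.lookup m 3)"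
    using exponent3_lookup[of m] by (simp add: exponent3_def)
  then have "Poly_Mapping.single m c = Poly_Mapping.single 0 c *
      (Poly_Mapping.single (Poly_Mapping.single 1 (Poly_Mapping.lookup m 1)) 1 *
       Poly_Mapping.single (Poly_Mapping.single 2 (Poly_Mapping.lookup m 2)) 1 *
       Poly_Mapping.single (Poly_Mapping.single 3 (Poly_Mapping.lookup m 3)) 1)"
    by (simp only: mult_single mult_1_right add_0_left)
  then show ?thesis
    unfolding grading_def grading_hom.msubst_single monom_val_3 total_degree_3
    by (simp add: monom_power mult_monom smult_monom single_power[unfolded One_nat_def])
qed

lemma coeff_grading:
  "Poly_Mapping.lookup (coeff (grading F) n) m = (if total_degree m = n then Poly_Mapping.lookup F m else 0)"
proof -
  have "grading F = (\<Sum>m\<in>Poly_Mapping.keys F. monom (Poly_Mapping.single m (Poly_Mapping.lookup F m)) (total_degree m))"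
    by (subst poly_mapping_sum_single[of F, symmetric], unfold grading_def grading_hom.msubst_sum)
       (simp only: grading_single flip: grading_def)
  then have "Poly_Mapping.lookup (coeff (grading F) n) m =
      (\<Sum>m'\<in>Poly_Mapping.keys F. Poly_Mapping.lookup
        (coeff (monom (Poly_Mapping.single m' (Poly_Mapping.lookup F m')) (total_degree m')) n) m)"
    by (simp only: coeff_sum lookup_sum)
  also have "\<dots> = (\<Sum>m'\<in>Poly_Mapping.keys F.
      if m' = m then (if total_degree m = n then Poly_Mapping.lookup F m else 0) else 0)"
    by (intro sum.cong refl) (simp add: lookup_single when_def)
  also have "\<dots> = (if total_degree m = n then Poly_Mapping.lookup F m else 0)"
    by (simp add: in_keys_iff)
  finally show ?thesis .
qed

lemma homogeneous_iff_grading: "homogeneous n F \<longleftrightarrow> grading F = monom F n"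
proof
  assume "homogeneous n F"
  then show "grading F = monom F n"
    by (intro poly_eqI poly_mapping_eqI)
       (force simp: coeff_grading homogeneous_iff in_keys_iff)
next
  assume "grading F = monom F n"
  then show "homogeneous n F"
    unfolding homogeneous_iff
    by (metis coeff_grading coeff_monom in_keys_iff lookup_zero)
qed

text \<open>\<open>grading\<close> is multiplicative and turns homogeneity into being a monomial in
  t; factors of a monomial are monomials.\<close>

lemma homogeneous_factors:
  assumes "homogeneous d (A * B)" "A * B \<noteq> 0"
  obtains a b where "homogeneous a A" "homogeneous b B" "a + b = d"
proof -
  have "grading A * grading B = monom (A * B) d"
    using assms(1) unfolding homogeneous_iff_grading grading_def grading_hom.msubst_mult by simp
  then obtain A' B' a b where *: "grading A = monom A' a" "grading B = monom B' b" "a + b = d"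
    using monom_factors assms(2) by metis
  have "homogeneous k C" if "grading C = monom C' k" for C C' k
    unfolding homogeneous_iff by (metis that coeff_grading coeff_monom in_keys_iff lookup_zero)
  then show ?thesis using * that by blast
qed

lemma homogeneous_unique: "homogeneous a F \<Longrightarrow> homogeneous b F \<Longrightarrow> F \<noteq> 0 \<Longrightarrow> a = b"
  unfolding homogeneous_iff keys_eq_empty[symmetric] by (metis ex_in_conv)

lemma homogeneous_0_const: "homogeneous 0 F \<Longrightarrow> F = Poly_Mapping.single 0 (Poly_Mapping.lookup F 0)"
  by (rule poly_mapping_eqI)
     (auto simp: homogeneous_iff total_degree_eq_0_iff lookup_single when_def in_keys_iff)

section \<open>Dimension of the space of forms and the Hilbert polynomial\<close>

definition exponents :: "nat \<Rightarrow> (3 \<Rightarrow>\<^sub>0 nat) set" where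
  "exponents n = {m. total_degree m = n}"

lemma bij_betw_exponents:
  "bij_betw (\<lambda>(a, b). exponent3 a b (n - a - b)) (SIGMA a:{..n}. {..n - a}) (exponents n)"
proof (rule bij_betw_byWitness)
  let ?g = "\<lambda>m. (Poly_Mapping.lookup m 1, Poly_Mapping.lookup m 2)"
  show "\<forall>p\<in>SIGMA a:{..n}. {..n - a}. ?g (case p of (a, b) \<Rightarrow> exponent3 a b (n - a - b)) = p"
    by auto
  show "\<forall>m\<in>exponents n. (case ?g m of (a, b) \<Rightarrow> exponent3 a b (n - a - b)) = m"
    unfolding exponents_def total_degree_3 by (auto intro: exponent_eqI)
  show "(\<lambda>(a, b). exponent3 a b (n - a - b)) ` (SIGMA a:{..n}. {..n - a}) \<subseteq> exponents n"
    unfolding exponents_def total_degree_3 by auto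
  show "?g ` exponents n \<subseteq> (SIGMA a:{..n}. {..n - a})"
    unfolding exponents_def total_degree_3 by auto
qed

lemma finite_exponents [simp]: "finite (exponents n)"
  using bij_betw_finite[OF bij_betw_exponents[of n]] by simp

lemma card_exponents: "2 * card (exponents n) = (n + 1) * (n + 2)"
proof -
  have "card (exponents n) = (\<Sum>a\<le>n. Suc (n - a))"
    using bij_betw_same_card[OF bij_betw_exponents[of n]] by simp
  also have "\<dots> = (\<Sum>a\<le>n. Suc a)"
    by (rule sum.reindex_bij_witness[of _ "\<lambda>a. n - a" "\<lambda>a. n - a"]) auto
  finally have "card (exponents n) = (\<Sum>a\<le>n. Suc a)" .
  moreover have "2 * (\<Sum>a\<le>n. Suc a) = (n + 1) * (n + 2)"
    by (induction n) (simp_all add: algebra_simps)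
  ultimately show ?thesis by simp
qed

text \<open>Multiplication by P is injective, so P times the monomials of degree n is a basis.
  Applied with P = 1 to all forms and with P = F to the multiples of F.\<close>

lemma dim_multiples:
  assumes "P \<noteq> (0 :: poly3)"
  shows "vector_space.dim scale3 ((\<lambda>H. P * H) ` {H. homogeneous n H}) = card (exponents n)"
proof -
  interpret V: vector_space scale3 by (rule vector_space_scale3)
  let ?e = "\<lambda>m. P * Poly_Mapping.single m 1"
  have inj: "inj_on ?e (exponents n)"
    using assms by (auto simp: inj_on_def) (metis lookup_single_eq lookup_single_not_eq zero_neq_one)
  have combination: "(\<Sum>m\<in>exponents n. scale3 (c m) (?e m)) = P * (\<Sum>m\<in>exponents n. Poly_Mapping.single m (c m))" for c
    by (simp add: sum_distrib_left algebra_simps mult_single)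
  have "V.independent (?e ` exponents n)"
  proof (subst V.independent_explicit_finite_subsets, intro allI impI ballI)
    fix S u v assume S: "S \<subseteq> ?e ` exponents n" "finite S" "(\<Sum>v\<in>S. scale3 (u v) v) = 0" "v \<in> S"
    define c where "c m = (if ?e m \<in> S then u (?e m) else 0)" for m
    have "(\<Sum>m\<in>exponents n. scale3 (c m) (?e m)) = (\<Sum>v\<in>?e ` exponents n. if v \<in> S then scale3 (u v) v else 0)"
      by (subst sum.reindex[OF inj]) (auto simp: c_def intro!: sum.cong)
    also have "\<dots> = (\<Sum>v\<in>S. scale3 (u v) v)"
      using S(1) by (subst sum.inter_restrict[symmetric]) (auto simp: Int_absorb1)
    finally have "(\<Sum>m\<in>exponents n. Poly_Mapping.single m (c m)) = 0"
      using S(3) combination assms by simp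
    then have "Poly_Mapping.lookup (\<Sum>m\<in>exponents n. Poly_Mapping.single m (c m)) k = 0" for k
      by simp
    then have "(if k \<in> exponents n then c k else 0) = 0" for k
      by (simp add: lookup_sum lookup_single when_def)
    then have "c m = 0" if "m \<in> exponents n" for m
      using that by presburger
    moreover obtain m where "m \<in> exponents n" "v = ?e m" using S(1,4) by blast
    ultimately show "u v = 0" using S(4) by (metis c_def)
  qed
  moreover have "(\<lambda>H. P * H) ` {H. homogeneous n H} \<subseteq> V.span (?e ` exponents n)"
  proof safe
    fix H assume H: "homogeneous n H"
    have "H = (\<Sum>m\<in>exponents n. Poly_Mapping.single m (Poly_Mapping.lookup H m))"
      using H by (subst poly_mapping_sum_single[of H, symmetric], intro sum.mono_neutral_left)
        (auto simp: exponents_def homogeneous_iff in_keys_iff finite_exponents[unfolded exponents_def])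
    then have "P * H = (\<Sum>m\<in>exponents n. scale3 (Poly_Mapping.lookup H m) (?e m))"
      using combination by simp
    moreover have "(\<Sum>m\<in>exponents n. scale3 (Poly_Mapping.lookup H m) (?e m)) \<in> V.span (?e ` exponents n)"
      by (intro V.span_sum V.span_scale V.span_base imageI)
    ultimately show "P * H \<in> V.span (?e ` exponents n)" by simp
  qed
  moreover have "?e ` exponents n \<subseteq> (\<lambda>H. P * H) ` {H. homogeneous n H}"
    by (auto simp: exponents_def intro!: imageI homogeneous_single)
  ultimately show ?thesis
    using V.dim_unique card_image[OF inj] by blast
qed

lemma has_genus_form:
  assumes F: "homogeneous d F" "F \<noteq> 0" and d: "d \<ge> 1"
  shows "has_genus F ((d - 1) * (d - 2) div 2)"
  unfolding has_genus_def
proof (intro exI conjI)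
  \<comment> \<open>The multiples of F in degree n \<ge> d are F times the forms of degree n - d, so
    the Hilbert polynomial is (n + 1)(n + 2) / 2 minus the same expression at n - d.\<close>
  define P :: "real poly" where
    "P = smult (1/2) ([:1, 1:] * [:2, 1:] - [:1 - real d, 1:] * [:2 - real d, 1:])"
  have card: "real (card (exponents n)) = (real n + 1) * (real n + 2) / 2" for n
    using card_exponents[of n] by (metis (no_types, lifting) of_nat_1 of_nat_add of_nat_mult
        of_nat_numeral nonzero_mult_div_cancel_left zero_neq_numeral)
  have "real_of_int (hilbert_function F n) = poly P (real n)" if n: "n \<ge> d" for n
  proof -
    have "{G. homogeneous n G} = (\<lambda>H. 1 * H) ` {H. homogeneous n H}" by simp
    then have 1: "vector_space.dim scale3 {G. homogeneous n G} = card (exponents n)"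
      using dim_multiples[of 1 n] by simp
    have "{G. homogeneous n G \<and> F dvd G} = (\<lambda>H. F * H) ` {H. homogeneous (n - d) H}"
    proof (intro equalityI subsetI)
      fix G assume "G \<in> {G. homogeneous n G \<and> F dvd G}"
      then obtain H where G: "G = F * H" "homogeneous n (F * H)" by (auto elim: dvdE)
      show "G \<in> (\<lambda>H. F * H) ` {H. homogeneous (n - d) H}"
      proof (cases "H = 0")
        case True
        then show ?thesis using G by (auto simp: homogeneous_iff)
      next
        case False
        then have "F * H \<noteq> 0" using F by simp
        then obtain a b where ab: "homogeneous a F" "homogeneous b H" "a + b = n"
          using homogeneous_factors G by metis
        then have "a = d" using homogeneous_unique F by blast
        then show ?thesis using ab G by auto
      qed
    next
      fix G assume "G \<in> (\<lambda>H. F * H) ` {H. homogeneous (n - d) H}"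
      then show "G \<in> {G. homogeneous n G \<and> F dvd G}"
        using homogeneous_mult[OF F(1), of "n - d"] n by auto
    qed
    then have 2: "vector_space.dim scale3 {G. homogeneous n G \<and> F dvd G} = card (exponents (n - d))"
      using dim_multiples[OF F(2), of "n - d"] by simp
    have "real (n - d) = real n - real d" using n by simp
    then show ?thesis
      unfolding hilbert_function_def 1 2 P_def
      by (simp add: card field_simps)
  qed
  then show "\<forall>\<^sub>F n in sequentially. real_of_int (hilbert_function F n) = poly P (of_nat n)"
    unfolding eventually_sequentially by blast
  have "even ((d - 1) * (d - 2))" by (cases "even d") (use d in auto)
  then have "real ((d - 1) * (d - 2) div 2) = real ((d - 1) * (d - 2)) / 2"
    by (simp add: real_of_nat_div)
  also have "real ((d - 1) * (d - 2)) = (real d - 1) * (real d - 2)"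
  \<comment> \<open>For d = 1 the subtraction d - 2 truncates, but the factor d - 1 is 0.\<close>
  proof (cases "d = 1")
    case False
    then show ?thesis using d by (simp add: of_nat_diff)
  qed simp
  finally show "poly P 0 = 1 - of_nat ((d - 1) * (d - 2) div 2)"
    by (simp add: P_def field_simps)
qed


section \<open>A rational Harnack form\<close>

definition unity_root :: "nat \<Rightarrow> nat \<Rightarrow> complex" where
  "unity_root d k = exp (2 * of_real pi * \<i> * of_nat k / of_nat d)"

lemma unity_root_0 [simp]: "unity_root d 0 = 1"
  by (simp add: unity_root_def)

lemma unity_root_add: "unity_root d (j + k) = unity_root d j * unity_root d k"
  by (simp add: unity_root_def exp_add[symmetric] add_divide_distrib[symmetric] algebra_simps)

lemma unity_root_power: "unity_root d k ^ n = unity_root d (k * n)"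
  by (induction n) (simp_all add: unity_root_add)

abbreviation unity_roots :: "nat \<Rightarrow> complex set" where
  "unity_roots d \<equiv> {z. z ^ d = 1}"

lemma unity_root_eq_iff: "d > 0 \<Longrightarrow> j < d \<Longrightarrow> k < d \<Longrightarrow> unity_root d j = unity_root d k \<longleftrightarrow> j = k"
  unfolding unity_root_def by (simp add: complex_root_unity_eq)

lemma unity_root_eq_1_iff: "d > 0 \<Longrightarrow> unity_root d k = 1 \<longleftrightarrow> d dvd k"
  unfolding unity_root_def by (simp add: complex_root_unity_eq_1)

lemma unity_root_in [simp]: "d > 0 \<Longrightarrow> unity_root d k ^ d = 1"
  unfolding unity_root_power by (simp add: unity_root_eq_1_iff)

lemma unity_rootsE:
  assumes "z ^ d = 1" "d > 0" obtains k where "k < d" "z = unity_root d k"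
  using assms complex_roots_unity[of d] that unfolding unity_root_def by auto

lemma finite_unity_roots [simp]: "d > 0 \<Longrightarrow> finite (unity_roots d)"
  using finite_roots_unity[of d] by simp

lemma unity_root_norm: "z ^ d = 1 \<Longrightarrow> d > 0 \<Longrightarrow> cmod z = 1"
  by (metis norm_one norm_power norm_ge_zero power_eq_1_iff less_numeral_extra(3))

lemma unity_root_cnj: "z ^ d = 1 \<Longrightarrow> d > 0 \<Longrightarrow> cnj z * z = 1"
  using unity_root_norm[of z d] by (metis complex_norm_square mult.commute of_real_1 power_one)

text \<open>X^d - 1 is square-free because its derivative has no zero except possibly 0, so it is
  the product of its linear factors; homogenizing gives the formula.\<close>

lemma prod_unity_roots:
  fixes a b :: complex
  assumes "d > 0"
  shows "(\<Prod>\<zeta>\<in>unity_roots d. a - \<zeta> * b) = a ^ d - b ^ d"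
proof -
  have *: "(\<Prod>\<zeta>\<in>unity_roots d. x - \<zeta>) = x ^ d - 1" for x :: complex
  proof -
    let ?p = "monom 1 d - 1 :: complex poly"
    have roots: "{z. poly ?p z = 0} = unity_roots d" by (simp add: poly_monom)
    have lc: "lead_coeff ?p = 1" and p0: "degree ?p = d"
    proof -
      show "degree ?p = d"
        using assms by (subst diff_conv_add_uminus, subst degree_add_eq_left) (simp_all add: degree_monom_eq)
      then show "lead_coeff ?p = 1" using assms by (simp add: coeff_1)
    qed
    have "rsquarefree ?p"
      unfolding rsquarefree_roots
    proof (intro allI notI)
      fix z assume "poly ?p z = 0 \<and> poly (pderiv ?p) z = 0"
      then have "z ^ d = 1" "of_nat d * z ^ (d - 1) = 0"
        by (simp_all add: poly_monom pderiv_diff pderiv_monom pderiv_1)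
      then show False using assms by (auto simp: power_0_left)
    qed
    from complex_poly_decompose_rsquarefree[OF this]
    have "?p = (\<Prod>\<zeta>\<in>unity_roots d. [:- \<zeta>, 1:])" unfolding lc roots by simp
    then have "poly ?p x = (\<Prod>\<zeta>\<in>unity_roots d. x - \<zeta>)" by (simp add: poly_prod)
    then show ?thesis by (simp add: poly_monom)
  qed
  show ?thesis
  proof (cases "b = 0")
    case True
    then show ?thesis using assms by (simp add: card_roots_unity_eq power_0_left)
  next
    case False
    have "(\<Prod>\<zeta>\<in>unity_roots d. a - \<zeta> * b) = (\<Prod>\<zeta>\<in>unity_roots d. b * (a / b - \<zeta>))"
      using False by (intro prod.cong) (simp_all add: field_simps)
    also have "\<dots> = b ^ d * ((a / b) ^ d - 1)"
      using assms by (simp add: prod.distrib * card_roots_unity_eq)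
    also have "\<dots> = a ^ d - b ^ d" using False by (simp add: field_simps)
    finally show ?thesis .
  qed
qed

section \<open>Symmetries of the product of lines\<close>

type_synonym cpoly3 = "(3 \<Rightarrow>\<^sub>0 nat) \<Rightarrow>\<^sub>0 complex"

abbreviation cvar :: "3 \<Rightarrow> cpoly3" where
  "cvar i \<equiv> Poly_Mapping.single (Poly_Mapping.single i 1) 1"

abbreviation cconst :: "complex \<Rightarrow> cpoly3" where
  "cconst c \<equiv> Poly_Mapping.single 0 c"

text \<open>Invariance under such a substitution is a condition on each coefficient separately, by
  \<open>lookup_rescale\<close>; it yields divisibility of exponents and reality of
  coefficients.\<close>

definition rescale :: "(complex \<Rightarrow> complex) \<Rightarrow> complex ^ 3 \<Rightarrow> cpoly3 \<Rightarrow> cpoly3" where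
  "rescale \<sigma> c P = msubst (\<lambda>x. cconst (\<sigma> x)) P (\<chi> i. cconst (c $ i) * cvar i)"

lemma cconst_power: "cconst c ^ n = cconst (c ^ n)"
  by (induction n) (simp_all add: mult_single)

lemma single_var_power:
  "Poly_Mapping.single (Poly_Mapping.single i 1) (x :: complex) ^ n = Poly_Mapping.single (Poly_Mapping.single i n) (x ^ n)"
  by (induction n) (simp_all add: mult_single flip: single_add)

lemma lookup_cconst_mult: "Poly_Mapping.lookup (cconst c * F) m = c * Poly_Mapping.lookup F m"
  by (simp add: Poly_Mapping.map.rep_eq when_def flip: mult_map_scale_conv_mult)

lemma lookup_rescale:
  assumes "coeff_hom \<sigma>"
  shows "Poly_Mapping.lookup (rescale \<sigma> c P) m = \<sigma> (Poly_Mapping.lookup P m) * monom_val c m"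
proof -
  interpret \<sigma>: coeff_hom \<sigma> by fact
  have "monom_val (\<chi> i. cconst (c $ i) * cvar i) k = Poly_Mapping.single k (monom_val c k)" for k
  proof -
    have "Poly_Mapping.single k (monom_val c k) = Poly_Mapping.single (exponent3 (Poly_Mapping.lookup k 1)
        (Poly_Mapping.lookup k 2) (Poly_Mapping.lookup k 3)) (monom_val c k)"
      by (simp only: exponent3_lookup)
    also have "\<dots> = monom_val (\<chi> i. cconst (c $ i) * cvar i) k"
      unfolding exponent3_def monom_val_3
      by (simp add: single_var_power[unfolded One_nat_def] mult_single ac_simps)
    finally show ?thesis ..
  qed
  then have "rescale \<sigma> c P = (\<Sum>k\<in>Poly_Mapping.keys P. Poly_Mapping.single k (\<sigma> (Poly_Mapping.lookup P k) * monom_val c k))"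
    by (simp add: rescale_def msubst_def mult_single)
  then show ?thesis
    by (simp add: lookup_sum lookup_single when_def in_keys_iff)
qed

definition line_factor :: "complex \<Rightarrow> complex \<Rightarrow> cpoly3" where
  "line_factor a b = cvar 3 + cconst (- a) * cvar 1 + cconst (- b) * cvar 2"

definition line_product :: "nat \<Rightarrow> cpoly3" where
  "line_product d = (\<Prod>(a, b)\<in>unity_roots d \<times> unity_roots d. line_factor a b)"

lemma rescale_hom: "coeff_hom \<sigma> \<Longrightarrow> coeff_hom (\<lambda>x. cconst (\<sigma> x))"
  unfolding coeff_hom_def by (simp add: single_add mult_single)

lemma rescale_line_factor:
  assumes "coeff_hom \<sigma>"
  shows "rescale \<sigma> c (line_factor a b) =
    cconst (c $ 3) * cvar 3 + cconst (\<sigma> (- a) * c $ 1) * cvar 1 + cconst (\<sigma> (- b) * c $ 2) * cvar 2"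
proof -
  interpret \<sigma>: coeff_hom \<sigma> by fact
  interpret H: coeff_hom "\<lambda>x. cconst (\<sigma> x)" using assms by (rule rescale_hom)
  show ?thesis
    unfolding rescale_def line_factor_def
    by (simp add: H.msubst_add H.msubst_mult H.msubst_single monom_val_single[unfolded One_nat_def] mult_single)
qed

lemma coeff_hom_id: "coeff_hom (\<lambda>x. x)" and coeff_hom_cnj: "coeff_hom cnj"
  by (unfold_locales; simp)+

text \<open>The substitution permutes the factors, sending (a, b) to
  (\<open>\<sigma> a * c $ 1\<close>, \<open>\<sigma> b * c $ 2\<close>). The third scale is 1 so
  that each factor stays monic in the third variable.\<close>

lemma rescale_line_product:
  assumes d: "d > 0" and \<sigma>: "coeff_hom \<sigma>" "\<And>x. \<sigma> (- x) = - \<sigma> x"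
    and bij: "bij_betw \<sigma> (unity_roots d) (unity_roots d)"
    and c: "c $ 1 ^ d = 1" "c $ 2 ^ d = 1" "c $ 3 = 1"
  shows "rescale \<sigma> c (line_product d) = line_product d"
proof -
  interpret \<sigma>: coeff_hom \<sigma> by fact
  interpret H: coeff_hom "\<lambda>x. cconst (\<sigma> x)" using \<sigma>(1) by (rule rescale_hom)
  have c0: "c $ 1 \<noteq> 0" "c $ 2 \<noteq> 0" using c d by (auto simp: power_0_left)
  have scale: "bij_betw (\<lambda>x. x * e) (unity_roots d) (unity_roots d)" if "e ^ d = 1" for e :: complex
    using that d by (intro bij_betw_byWitness[where f' = "\<lambda>x. x / e"]) (auto simp: power_mult_distrib power_divide power_0_left)
  have "bij_betw (map_prod (\<lambda>a. \<sigma> a * c $ 1) (\<lambda>b. \<sigma> b * c $ 2)) (unity_roots d \<times> unity_roots d) (unity_roots d \<times> unity_roots d)"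
    using bij_betw_trans[OF bij scale[OF c(1)]] bij_betw_trans[OF bij scale[OF c(2)]]
    by (intro bij_betw_map_prod) (simp_all add: o_def)
  moreover have "rescale \<sigma> c (line_factor a b) = line_factor (\<sigma> a * c $ 1) (\<sigma> b * c $ 2)" for a b
    unfolding rescale_line_factor[OF \<sigma>(1)] by (simp add: c line_factor_def \<sigma>(2))
  then have "rescale \<sigma> c (line_product d) = (\<Prod>p\<in>unity_roots d \<times> unity_roots d.
      (\<lambda>(a, b). line_factor a b) (map_prod (\<lambda>a. \<sigma> a * c $ 1) (\<lambda>b. \<sigma> b * c $ 2) p))"
    unfolding line_product_def rescale_def H.msubst_prod by (auto intro!: prod.cong)
  ultimately show ?thesis
    unfolding line_product_def by (simp add: prod.reindex_bij_betw)
qed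

text \<open>A monomial that occurs is fixed by all symmetries: a primitive root on one variable
  forces d to divide its exponent, and conjugation forces a real coefficient.\<close>

lemma line_product_keys:
  assumes d: "d > 0" and m: "m \<in> Poly_Mapping.keys (line_product d)"
  shows "d dvd Poly_Mapping.lookup m i" "total_degree m = d * d"
    "cnj (Poly_Mapping.lookup (line_product d) m) = Poly_Mapping.lookup (line_product d) m"
proof -
  let ?Q = "line_product d" and ?\<omega> = "unity_root d 1"
  have Qm: "Poly_Mapping.lookup ?Q m \<noteq> 0" using m by (simp add: in_keys_iff)
  have fix_id: "monom_val c m = 1" if "c $ 1 ^ d = 1" "c $ 2 ^ d = 1" "c $ 3 = 1" for c :: "complex ^ 3"
  proof -
    have "rescale (\<lambda>x. x) c ?Q = ?Q"
      using that d by (intro rescale_line_product coeff_hom_id) (simp_all add: bij_betw_def)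
    then show ?thesis using lookup_rescale[OF coeff_hom_id, of c ?Q m] Qm by simp
  qed
  have 1: "d dvd Poly_Mapping.lookup m 1"
    using fix_id[of "vector [?\<omega>, 1, 1]"] d
    by (simp add: monom_val_3 unity_root_power unity_root_eq_1_iff)
  have 2: "d dvd Poly_Mapping.lookup m 2"
    using fix_id[of "vector [1, ?\<omega>, 1]"] d
    by (simp add: monom_val_3 unity_root_power unity_root_eq_1_iff)
  interpret H: coeff_hom "\<lambda>x. cconst x" using coeff_hom_id by (rule rescale_hom)
  \<comment> \<open>Homogeneity: doubling all variables doubles each of the d^2 factors, and a power
    of 2 determines its exponent.\<close>
  have "rescale (\<lambda>x. x) (\<chi> i. 2) ?Q = (\<Prod>(a, b)\<in>unity_roots d \<times> unity_roots d. cconst 2 * line_factor a b)"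
  proof -
    have "cconst (- a * 2) = cconst 2 * cconst (- a)" for a
      by (simp only: mult_single add_0_left mult.commute)
    then have "rescale (\<lambda>x. x) (\<chi> i. 2) (line_factor a b) = cconst 2 * line_factor a b" for a b
      by (simp only: rescale_line_factor[OF coeff_hom_id] vec_lambda_beta mult.assoc)
        (simp only: line_factor_def distrib_left)
    then show ?thesis
      unfolding line_product_def rescale_def H.msubst_prod by (auto intro!: prod.cong)
  qed
  also have "\<dots> = cconst (2 ^ (d * d)) * ?Q"
    unfolding line_product_def case_prod_unfold prod.distrib
    using d by (simp add: cconst_power card_cartesian_product card_roots_unity_eq del: single_numeral)
  finally have "Poly_Mapping.lookup ?Q m * monom_val (\<chi> i. 2) m = 2 ^ (d * d) * Poly_Mapping.lookup ?Q m"
    using lookup_rescale[OF coeff_hom_id, of "\<chi> i. 2" ?Q m] by (simp only: lookup_cconst_mult)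
  then have "(2 :: complex) ^ total_degree m = 2 ^ (d * d)"
    using Qm by (simp add: monom_val_def total_degree_def power_sum)
  then have "cmod (2 ^ total_degree m) = cmod (2 ^ (d * d))" by simp
  then show deg: "total_degree m = d * d" by (simp add: norm_power)
  \<comment> \<open>The third variable is never rescaled on its own; its exponent is what the other
    two leave of the degree d * d.\<close>
  have "d dvd Poly_Mapping.lookup m 3"
    using deg 1 2 unfolding total_degree_3 by (metis dvd_add dvd_add_right_iff dvd_triv_left)
  then show "d dvd Poly_Mapping.lookup m i" using 1 2 forall_3[of "\<lambda>i. d dvd Poly_Mapping.lookup m i"] by blast
  have "rescale cnj (\<chi> i. 1) ?Q = ?Q"
    using d by (intro rescale_line_product coeff_hom_cnj bij_betw_byWitness[where f' = cnj])
      (auto simp flip: complex_cnj_power)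
  then show "cnj (Poly_Mapping.lookup ?Q m) = Poly_Mapping.lookup ?Q m"
    using lookup_rescale[OF coeff_hom_cnj, of "\<chi> i. 1" ?Q m] by (simp add: monom_val_def)
qed

definition power_map :: "nat \<Rightarrow> 'a::comm_semiring_1 ^ 3 \<Rightarrow> 'a ^ 3" where
  "power_map d y = (\<chi> i. y $ i ^ d)"

lemma power_map_nth [simp]: "power_map d y $ i = y $ i ^ d"
  by (simp add: power_map_def)

text \<open>The product of the lines is a polynomial in the \<open>d\<close>-th powers of the variables with real
  coefficients, so that neither the division of the exponents nor \<open>Re\<close> loses information.\<close>

definition harnack_form :: "nat \<Rightarrow> poly3" where
  "harnack_form d = (\<Sum>m\<in>Poly_Mapping.keys (line_product d).
     Poly_Mapping.single (exponent3 (Poly_Mapping.lookup m 1 div d) (Poly_Mapping.lookup m 2 div d)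
       (Poly_Mapping.lookup m 3 div d)) (Re (Poly_Mapping.lookup (line_product d) m)))"

lemma homogeneous_harnack_form:
  assumes "d > 0"
  shows "homogeneous d (harnack_form d)"
  unfolding harnack_form_def
proof (intro homogeneous_sum homogeneous_single)
  fix m assume m: "m \<in> Poly_Mapping.keys (line_product d)"
  note dvd = line_product_keys(1)[OF assms m]
  obtain k1 k2 k3 where k: "Poly_Mapping.lookup m 1 = d * k1" "Poly_Mapping.lookup m 2 = d * k2"
    "Poly_Mapping.lookup m 3 = d * k3"
    using dvd by (meson dvdE)
  then have "d * (k1 + k2 + k3) = d * d"
    using line_product_keys(2)[OF assms m] by (simp add: total_degree_3 distrib_left)
  then show "total_degree (exponent3 (Poly_Mapping.lookup m 1 div d) (Poly_Mapping.lookup m 2 div d)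
       (Poly_Mapping.lookup m 3 div d)) = d"
    using assms by (simp add: total_degree_3 k)
qed

text \<open>Together with homogeneity, this factorization of the pullback is all that later proofs
  use of the form.\<close>

lemma eval_harnack_form:
  assumes d: "d > 0"
  shows "eval (harnack_form d) (power_map d y) =
    (\<Prod>(a, b)\<in>unity_roots d \<times> unity_roots d. y $ 3 - a * y $ 1 - b * y $ 2)"
proof -
  let ?Q = "line_product d"
  have factor: "msubst (\<lambda>x. x) (line_factor a b) y = y $ 3 - a * y $ 1 - b * y $ 2" for a b
    by (simp only: line_factor_def coeff_hom.msubst_add[OF coeff_hom_id] coeff_hom.msubst_mult[OF coeff_hom_id]
      coeff_hom.msubst_single[OF coeff_hom_id] monom_val_single) simp
  have "eval (harnack_form d) (power_map d y) = (\<Sum>m\<in>Poly_Mapping.keys ?Q. Poly_Mapping.lookup ?Q m * monom_val y m)"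
    unfolding harnack_form_def eval_sum eval_single
  proof (intro sum.cong refl arg_cong2[where f = "(*)"])
    fix m assume m: "m \<in> Poly_Mapping.keys ?Q"
    note dvd = line_product_keys(1)[OF d m]
    show "of_real (Re (Poly_Mapping.lookup ?Q m)) = Poly_Mapping.lookup ?Q m"
      using line_product_keys(3)[OF d m] by (intro of_real_Re) (simp add: Reals_cnj_iff)
    show "monom_val (power_map d y) (exponent3 (Poly_Mapping.lookup m 1 div d) (Poly_Mapping.lookup m 2 div d)
       (Poly_Mapping.lookup m 3 div d)) = monom_val y m"
      using dvd by (simp add: monom_val_3 flip: power_mult)
  qed
  also have "\<dots> = msubst (\<lambda>x. x) ?Q y" by (simp add: msubst_def)
  also have "\<dots> = (\<Prod>(a, b)\<in>unity_roots d \<times> unity_roots d. msubst (\<lambda>x. x) (line_factor a b) y)"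
    by (subst line_product_def, subst coeff_hom.msubst_prod[OF coeff_hom_id]) (simp only: case_prod_unfold)
  also have "\<dots> = (\<Prod>(a, b)\<in>unity_roots d \<times> unity_roots d. y $ 3 - a * y $ 1 - b * y $ 2)"
    by (simp only: factor)
  finally show ?thesis .
qed


section \<open>Nodes of the Harnack form\<close>

lemma complex_nth_root:
  assumes "d > 0"
  shows "\<exists>z :: complex. z ^ d = c"
proof (cases "c = 0")
  case True
  then show ?thesis using assms by (intro exI[of _ 0]) (simp add: power_0_left)
next
  case False
  have "exp (Ln c / of_nat d) ^ d = c"
    using assms False by (simp flip: exp_of_nat_mult)
  then show ?thesis by blast
qed

text \<open>The map z -> 1 / (z - 1) has its pole on the unit circle and therefore straightens the
  circle to a line.\<close>

lemma Re_inverse_unit: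
  assumes "cmod z = 1" "z \<noteq> 1"
  shows "Re (1 / (z - 1)) = - 1 / 2"
proof -
  have 1: "(Re z)\<^sup>2 + (Im z)\<^sup>2 = 1" using assms(1) by (simp add: cmod_power2[symmetric])
  then have 2: "(Re z - 1)\<^sup>2 + (Im z)\<^sup>2 = 2 * (1 - Re z)" by (simp add: power2_eq_square algebra_simps)
  have "Re z \<noteq> 1" using 1 assms(2) by (auto simp: complex_eq_iff)
  have "Re (1 / (z - 1)) = (Re z - 1) / ((Re z - 1)\<^sup>2 + (Im z)\<^sup>2)"
    by (simp add: Re_divide)
  then have "Re (1 / (z - 1)) * (2 * (1 - Re z)) = Re z - 1"
    using \<open>Re z \<noteq> 1\<close> unfolding 2 by (simp add: divide_simps)
  then have "(Re z - 1) * (1 + 2 * Re (1 / (z - 1))) = 0"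
    by algebra
  then show ?thesis using \<open>Re z \<noteq> 1\<close> by simp
qed

text \<open>A similarity that fixes \<open>1\<close> and maps two further points of the unit circle to the unit circle
  fixes the circle, hence is the identity.\<close>

lemma unit_circle_similar:
  fixes z w z' w' :: complex
  assumes unit: "cmod z = 1" "cmod w = 1" "cmod z' = 1" "cmod w' = 1"
    and neq: "z \<noteq> 1" "w \<noteq> 1" "z \<noteq> w" "z' \<noteq> 1"
    and similar: "(w' - 1) * (z - 1) = (w - 1) * (z' - 1)"
  shows "z' = z \<and> w' = w"
proof -
  \<comment> \<open>After z -> 1 / (z - 1) the circle is the line Re = -1/2 and the similarity is
    multiplication by m. Two distinct points of this line stay on it, which forces m = 1.\<close>
  define m where "m = (z - 1) / (z' - 1)"
  have w': "w' \<noteq> 1" using similar neq by auto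
  have P: "1 / (z' - 1) = m * (1 / (z - 1))" using neq by (simp add: m_def)
  have Q: "1 / (w' - 1) = m * (1 / (w - 1))"
    using similar neq w' by (simp add: m_def divide_simps) (simp add: algebra_simps)
  have "Re m * (-1/2) - Im m * Im (1 / (z - 1)) = -1/2"
    using Re_inverse_unit[OF unit(3) neq(4)] unfolding P times_complex.sel Re_inverse_unit[OF unit(1) neq(1)] .
  moreover have "Re m * (-1/2) - Im m * Im (1 / (w - 1)) = -1/2"
    using Re_inverse_unit[OF unit(4) w'] unfolding Q times_complex.sel Re_inverse_unit[OF unit(2) neq(2)] .
  moreover have neq_Im: "Im (1 / (z - 1)) \<noteq> Im (1 / (w - 1))"
  proof
    assume "Im (1 / (z - 1)) = Im (1 / (w - 1))"
    then have "1 / (z - 1) = 1 / (w - 1)"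
      using Re_inverse_unit[OF unit(1) neq(1)] Re_inverse_unit[OF unit(2) neq(2)] by (simp add: complex_eq_iff)
    then show False using neq by simp
  qed
  ultimately have "Im m * (Im (1 / (z - 1)) - Im (1 / (w - 1))) = 0" "Re m = 1 - 2 * (Im m * Im (1 / (z - 1)))"
    unfolding right_diff_distrib by linarith+
  with neq_Im have "m = 1" by (simp add: complex_eq_iff)
  then show ?thesis using P Q neq w' by simp
qed

text \<open>The form \<open>harnack_form d\<close> is parametrized by \<open>(cos\<^sup>d \<theta> : sin\<^sup>d \<theta> : (cos \<theta> + sin \<theta>)\<^sup>d)\<close>. A node arises
  where the line \<open>z = x + y\<close> in the root coordinates meets the line \<open>z = a x + b y\<close> with
  \<open>a = unity_root d j\<close> and \<open>b = unity_root d k\<close>, that is, where \<open>(a - 1) x + (b - 1) y = 0\<close>.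
  The denominator of \<open>chord\<close> makes the \<open>d\<close>-th powers of the coordinates real.\<close>

definition chord :: "nat \<Rightarrow> nat \<Rightarrow> complex" where
  "chord d k = (unity_root d k - 1) / (2 * \<i>)"

definition node_root :: "nat \<Rightarrow> nat \<Rightarrow> nat \<Rightarrow> complex ^ 3" where
  "node_root d j k = vector [chord d k, - chord d j, chord d k - chord d j]"

definition node :: "nat \<Rightarrow> nat \<Rightarrow> nat \<Rightarrow> real ^ 3" where
  "node d j k = (\<chi> i. Re (node_root d j k $ i ^ d))"

definition complexify :: "real ^ 3 \<Rightarrow> complex ^ 3" where
  "complexify v = (\<chi> i. of_real (v $ i))"

lemma complexify_nth [simp]: "complexify v $ i = of_real (v $ i)"
  by (simp add: complexify_def)

lemma eval_complexify: "eval F (complexify v) = of_real (eval F v)"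
  unfolding complexify_def by (rule eval_of_real)

lemma unity_root_chord: "unity_root d k = 1 + 2 * \<i> * chord d k"
  by (simp add: chord_def)

lemma node_root_nth:
  "node_root d j k $ 1 = chord d k" "node_root d j k $ 2 = - chord d j"
  "node_root d j k $ 3 = chord d k - chord d j"
  by (simp_all add: node_root_def)

lemma cmod_unity_root [simp]: "d > 0 \<Longrightarrow> cmod (unity_root d k) = 1"
  by (rule unity_root_norm[where d = d]) auto

lemma unity_root_neq_0 [simp]: "unity_root d k \<noteq> 0"
  by (simp add: unity_root_def)

lemma cnj_unity_root_mult: "d > 0 \<Longrightarrow> cnj (unity_root d k) * unity_root d k = 1"
  by (rule unity_root_cnj[where d = d]) auto

text \<open>On the unit circle cnj (u - w) = - cnj u cnj w (u - w), and the \<i> in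
  \<open>chord\<close> removes the sign. So conjugation multiplies by a d-th root of unity, and d-th
  powers become real.\<close>

lemma cnj_chord_diff:
  assumes "d > 0"
  shows "cnj (chord d k - chord d j) = cnj (unity_root d (j + k)) * (chord d k - chord d j)"
proof -
  let ?u = "unity_root d k" and ?w = "unity_root d j"
  have eq: "cnj ?w - cnj ?u = cnj ?w * cnj ?u * (?u - ?w)"
  proof -
    have "cnj ?w * cnj ?u * (?u - ?w) = cnj ?w * (cnj ?u * ?u) - cnj ?u * (cnj ?w * ?w)"
      by (simp only: right_diff_distrib mult.assoc mult.left_commute mult.commute)
    then show ?thesis by (simp only: cnj_unity_root_mult[OF assms] mult_1_right)
  qed
  have diff: "chord d k - chord d j = (?u - ?w) / (2 * \<i>)"
    by (simp add: chord_def diff_divide_distrib right_diff_distrib)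
  have "cnj (chord d k - chord d j) = (cnj ?w - cnj ?u) / (2 * \<i>)"
    unfolding diff by (simp add: diff_divide_distrib right_diff_distrib)
  also have "\<dots> = cnj (unity_root d (j + k)) * (chord d k - chord d j)"
    unfolding eq diff unity_root_add by simp
  finally show ?thesis .
qed

lemma cnj_chord: "d > 0 \<Longrightarrow> cnj (chord d k) = cnj (unity_root d k) * chord d k"
  using cnj_chord_diff[of d k 0] by (simp add: chord_def)

text \<open>The factor by which complex conjugation multiplies the coordinates of \<open>node_root\<close>.\<close>

definition conj_factor :: "nat \<Rightarrow> nat \<Rightarrow> nat \<Rightarrow> complex ^ 3" where
  "conj_factor d j k = vector [cnj (unity_root d k), cnj (unity_root d j), cnj (unity_root d (j + k))]"

lemma conj_factor_nth:
  "conj_factor d j k $ 1 = cnj (unity_root d k)" "conj_factor d j k $ 2 = cnj (unity_root d j)"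
  "conj_factor d j k $ 3 = cnj (unity_root d (j + k))"
  by (simp_all add: conj_factor_def)

lemma conj_factor_power: "d > 0 \<Longrightarrow> conj_factor d j k $ i ^ d = 1"
  using forall_3[of "\<lambda>i. conj_factor d j k $ i ^ d = 1"]
  by (simp add: conj_factor_nth flip: complex_cnj_power)

lemma cnj_node_root:
  assumes "d > 0"
  shows "cnj (node_root d j k $ i) = conj_factor d j k $ i * node_root d j k $ i"
proof -
  show ?thesis
    using cnj_chord[OF assms] cnj_chord_diff[OF assms, of k j] forall_3[of "\<lambda>i. cnj (node_root d j k $ i) = conj_factor d j k $ i * node_root d j k $ i"]
    by (simp add: node_root_nth conj_factor_nth)
qed

lemma power_map_node_root:
  assumes "d > 0"
  shows "power_map d (node_root d j k) = complexify (node d j k)"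
proof -
  have "cnj (node_root d j k $ i ^ d) = node_root d j k $ i ^ d" for i
    using assms by (simp add: cnj_node_root power_mult_distrib conj_factor_power)
  then have "of_real (Re (node_root d j k $ i ^ d)) = node_root d j k $ i ^ d" for i
    by (intro of_real_Re) (simp only: Reals_cnj_iff)
  then show ?thesis by (simp add: vec_eq_iff node_def)
qed

lemma chord_eq_0_iff: "0 < k \<Longrightarrow> k < d \<Longrightarrow> chord d k \<noteq> 0"
  by (auto simp: chord_def unity_root_eq_1_iff dest: dvd_imp_le)

lemma chord_eq_iff: "j < d \<Longrightarrow> k < d \<Longrightarrow> chord d j = chord d k \<longleftrightarrow> j = k"
  by (auto simp: chord_def unity_root_eq_iff)

lemma node_root_nonzero:
  assumes "0 < j" "j < d" "0 < k" "k < d" "j \<noteq> k"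
  shows "node_root d j k $ i \<noteq> 0"
  using assms chord_eq_0_iff[of j d] chord_eq_0_iff[of k d] chord_eq_iff[of k d j]
    forall_3[of "\<lambda>i. node_root d j k $ i \<noteq> 0"]
  by (auto simp: node_root_nth)

lemma node_nonzero:
  assumes "0 < j" "j < d" "0 < k" "k < d" "j \<noteq> k"
  shows "node d j k $ i \<noteq> 0"
proof -
  have "d > 0" using assms by simp
  then have "power_map d (node_root d j k) $ i = complexify (node d j k) $ i"
    by (simp only: power_map_node_root)
  moreover have "node_root d j k $ i ^ d \<noteq> 0"
    using node_root_nonzero[OF assms] by (rule power_not_zero)
  ultimately show ?thesis by auto
qed

text \<open>A line through the node makes the triangle 1, a, b similar to 1,
  \<open>unity_root d j\<close>, \<open>unity_root d k\<close>. Both are inscribed in the unit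
  circle, so they agree unless a = b = 1. Hence no third line passes through the node.\<close>

lemma node_factors:
  assumes jk: "0 < j" "j < d" "0 < k" "k < d" "j \<noteq> k"
    and ab: "a ^ d = 1" "b ^ d = 1"
    and zero: "node_root d j k $ 3 - a * node_root d j k $ 1 - b * node_root d j k $ 2 = 0"
  shows "(a, b) = (1, 1) \<or> (a, b) = (unity_root d j, unity_root d k)"
proof -
  have d: "d > 0" using jk by simp
  have eq: "(b - 1) * (unity_root d j - 1) = (unity_root d k - 1) * (a - 1)"
  proof -
    have "chord d k - chord d j - a * chord d k + b * chord d j = 0"
      using zero by (simp add: node_root_nth)
    then show ?thesis using unity_root_chord[of d j] unity_root_chord[of d k] by algebra
  qed
  have nz: "unity_root d j \<noteq> 1" "unity_root d k \<noteq> 1" "unity_root d j \<noteq> unity_root d k"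
    using jk d by (auto simp: unity_root_eq_1_iff unity_root_eq_iff dest: dvd_imp_le)
  show ?thesis
  proof (cases "a = 1")
    case True
    have "(b - 1) * (unity_root d j - 1) = 0" unfolding eq True by simp
    then have "b = 1" using nz(1) by simp
    then show ?thesis using True by blast
  next
    case False
    have "a = unity_root d j \<and> b = unity_root d k"
      by (rule unit_circle_similar[OF cmod_unity_root[OF d] cmod_unity_root[OF d]
          unity_root_norm[OF ab(1) d] unity_root_norm[OF ab(2) d] nz False eq])
    then show ?thesis by blast
  qed
qed

lemma node_on_lines:
  "node_root d j k $ 3 - node_root d j k $ 1 - node_root d j k $ 2 = 0"
  "node_root d j k $ 3 - unity_root d j * node_root d j k $ 1 - unity_root d k * node_root d j k $ 2 = 0"
  by (simp_all add: node_root_nth unity_root_chord algebra_simps)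

text \<open>Nonzero coordinates exclude a = 1, b = 1 and a = b, the cases in which the two lines
  meet on a coordinate line. The exponents of a and b are then the indices of the node.\<close>

lemma double_point_root:
  fixes y :: "complex ^ 3"
  assumes d: "d > 0" and y: "\<And>i. y $ i \<noteq> 0" "y $ 3 = y $ 1 + y $ 2"
    and ab: "a ^ d = 1" "b ^ d = 1" "(a, b) \<noteq> (1, 1)" "y $ 3 = a * y $ 1 + b * y $ 2"
  obtains j k c where "0 < j" "j < d" "0 < k" "k < d" "j \<noteq> k" "c \<noteq> 0"
    "y = (\<chi> i. c * node_root d j k $ i)"
proof -
  obtain j where j: "j < d" "a = unity_root d j" using ab(1) d by (rule unity_rootsE)
  obtain k where k: "k < d" "b = unity_root d k" using ab(2) d by (rule unity_rootsE)
  have eq: "(a - 1) * y $ 1 = (1 - b) * y $ 2" using y(2) ab(4) by (simp add: algebra_simps)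
  have "a = 1 \<longleftrightarrow> b = 1"
    using eq y(1)[of 1] y(1)[of 2] by (metis diff_self mult_eq_0_iff right_minus_eq)
  then have "a \<noteq> 1" "b \<noteq> 1" using ab(3) by auto
  moreover have "a \<noteq> b"
  proof
    assume "a = b"
    then have "(a - 1) * y $ 3 = (a - 1) * y $ 1 - (1 - b) * y $ 2"
      unfolding y(2) by (simp add: algebra_simps)
    then have "(a - 1) * y $ 3 = 0" using eq by simp
    then show False using y(1)[of 3] \<open>a \<noteq> 1\<close> by simp
  qed
  ultimately have jk: "0 < j" "0 < k" "j \<noteq> k" using j(2) k(2) by (auto intro!: gr0I)
  define c where "c = y $ 1 / chord d k"
  have ck: "chord d k \<noteq> 0" using jk k by (simp add: chord_eq_0_iff)
  have 2: "y $ 2 = - c * chord d j"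
  proof -
    have "c * chord d k = y $ 1" using ck by (simp add: c_def)
    then have "(1 - b) * y $ 2 = 2 * \<i> * chord d j * (c * chord d k)"
      using eq by (simp add: j(2) unity_root_chord)
    then have "(1 - b) * (y $ 2 + c * chord d j) = 0"
      by (simp add: distrib_left) (simp add: k(2) unity_root_chord)
    then show ?thesis using \<open>b \<noteq> 1\<close> by (simp add: eq_neg_iff_add_eq_0)
  qed
  have "y = (\<chi> i. c * node_root d j k $ i)"
  proof (rule vec3_eqI)
    show 1: "y $ 1 = (\<chi> i. c * node_root d j k $ i) $ 1" using ck by (simp add: node_root_nth c_def)
    show 3: "y $ 2 = (\<chi> i. c * node_root d j k $ i) $ 2" using 2 by (simp add: node_root_nth)
    show "y $ 3 = (\<chi> i. c * node_root d j k $ i) $ 3"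
      unfolding y(2) 1 3 by (simp add: node_root_nth algebra_simps)
  qed
  moreover have "c \<noteq> 0" using y(1) ck by (simp add: c_def)
  ultimately show ?thesis using that jk j k by blast
qed

lemma unity_root_diff: "k \<le> d \<Longrightarrow> d > 0 \<Longrightarrow> unity_root d (d - k) = cnj (unity_root d k)"
proof -
  assume k: "k \<le> d" and d: "d > 0"
  have "unity_root d (d - k) * unity_root d k = 1"
    using k d by (simp add: unity_root_eq_1_iff flip: unity_root_add)
  then show ?thesis using cnj_unity_root_mult[OF d, of k] by (metis mult_cancel_right unity_root_neq_0)
qed

text \<open>Conjugation replaces j, k by d - j, d - k but fixes the real point, so every node arises
  from two ordered pairs. Restricting to j < k later selects one of them.\<close>

lemma node_reverse:
  assumes "0 < j" "j < d" "0 < k" "k < d"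
  shows "node d (d - j) (d - k) = (-1) ^ d *\<^sub>R node d j k"
proof -
  have c: "chord d (d - l) = - cnj (chord d l)" if "l < d" for l
    using that by (simp add: chord_def unity_root_diff)
  have "node_root d (d - j) (d - k) $ i = - cnj (node_root d j k $ i)" for i
    using forall_3[of "\<lambda>i. node_root d (d - j) (d - k) $ i = - cnj (node_root d j k $ i)"] assms
    by (simp add: node_root_nth c)
  then have "node_root d (d - j) (d - k) $ i ^ d = (-1) ^ d * cnj (node_root d j k $ i ^ d)" for i
    by (simp add: power_minus[of "cnj (node_root d j k $ i)"])
  then have "Re (node_root d (d - j) (d - k) $ i ^ d) = (-1) ^ d * Re (node_root d j k $ i ^ d)" for i
    by (cases "even d") (simp_all flip: complex_cnj_power)
  then show ?thesis by (simp add: vec_eq_iff node_def)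
qed

section \<open>Nodes up to conjugation, and roots of zeros\<close>

definition node_indices :: "nat \<Rightarrow> (nat \<times> nat) set" where
  "node_indices d = {(j, k). 0 < j \<and> j < k \<and> k < d}"

lemma node_sorted:
  assumes "0 < j" "j < d" "0 < k" "k < d" "j \<noteq> k"
  obtains j' k' c where "(j', k') \<in> node_indices d" "c \<noteq> 0" "node d j k = c *\<^sub>R node d j' k'"
proof (cases "j < k")
  case True
  show ?thesis
    by (rule that[of j k 1]) (use True assms in \<open>auto simp: node_indices_def\<close>)
next
  case False
  have rev: "node d j k = (-1) ^ d *\<^sub>R node d (d - j) (d - k)"
    using assms node_reverse[of "d - j" d "d - k"] by simp
  show ?thesis
    by (rule that[OF _ _ rev]) (use False assms in \<open>auto simp: node_indices_def\<close>)
qed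

text \<open>Multiplying the coordinates of a root by d-th roots of unity does not change its power
  image, so whichever line vanishes can be moved to z = x + y.\<close>

lemma form_zero_root:
  fixes v :: "complex ^ 3"
  assumes d: "d > 0" and zero: "eval (harnack_form d) v = 0"
  obtains y where "power_map d y = v" "y $ 3 = y $ 1 + y $ 2"
proof -
  have "\<forall>i. \<exists>z. z ^ d = v $ i" by (intro allI complex_nth_root d)
  from choice[OF this] obtain f where f: "\<forall>i. f i ^ d = v $ i" ..
  then have "power_map d (\<chi> i. f i) = v" by (simp add: vec_eq_iff)
  then have "(\<Prod>(a, b)\<in>unity_roots d \<times> unity_roots d. f 3 - a * f 1 - b * f 2) = 0"
    using eval_harnack_form[OF d, of "\<chi> i. f i"] zero by simp
  then obtain a b where ab: "a ^ d = 1" "b ^ d = 1" "f 3 - a * f 1 - b * f 2 = 0"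
    using d by (auto simp: finite_cartesian_product)
  let ?y = "vector [a * f 1, b * f 2, f 3] :: complex ^ 3"
  show ?thesis
  proof
    show "power_map d ?y = v" by (rule vec3_eqI) (simp_all add: power_mult_distrib ab f)
    show "?y $ 3 = ?y $ 1 + ?y $ 2" using ab(3) by (simp add: algebra_simps)
  qed
qed


section \<open>Singular points and real zeros of the Harnack form\<close>

lemma complexify_power_map: "complexify (power_map d y) = power_map d (complexify y)"
  by (simp add: vec_eq_iff)

text \<open>At a zero coordinate the power map is ramified, and the pullback does not show the
  derivative. Carrying out the product over the roots of this one coordinate leaves a polynomial in
  t itself.\<close>

lemma harnack_form_line_2:
  assumes d: "d > 0"
  shows "eval (harnack_form d) (vector [x ^ d, t, z ^ d]) = (\<Prod>a\<in>unity_roots d. (z - a * x) ^ d - t)"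
proof -
  obtain s where s: "s ^ d = t" using complex_nth_root[OF d] by blast
  have v: "vector [x ^ d, t, z ^ d] = power_map d (vector [x, s, z])"
    by (rule vec3_eqI) (simp_all add: s)
  have "eval (harnack_form d) (vector [x ^ d, t, z ^ d]) =
      (\<Prod>a\<in>unity_roots d. \<Prod>b\<in>unity_roots d. (z - a * x) - b * s)"
    unfolding v eval_harnack_form[OF d] by (simp add: prod.cartesian_product)
  then show ?thesis by (simp only: prod_unity_roots[OF d] s)
qed

lemma harnack_form_line_1:
  assumes d: "d > 0"
  shows "eval (harnack_form d) (vector [t, y ^ d, z ^ d]) = (\<Prod>b\<in>unity_roots d. (z - b * y) ^ d - t)"
proof -
  obtain s where s: "s ^ d = t" using complex_nth_root[OF d] by blast
  have v: "vector [t, y ^ d, z ^ d] = power_map d (vector [s, y, z])"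
    by (rule vec3_eqI) (simp_all add: s)
  have "eval (harnack_form d) (vector [t, y ^ d, z ^ d]) =
      (\<Prod>a\<in>unity_roots d. \<Prod>b\<in>unity_roots d. (z - b * y) - a * s)"
    unfolding v eval_harnack_form[OF d] by (simp add: prod.cartesian_product algebra_simps)
  also have "\<dots> = (\<Prod>b\<in>unity_roots d. \<Prod>a\<in>unity_roots d. (z - b * y) - a * s)"
    by (rule prod.swap)
  finally show ?thesis by (simp only: prod_unity_roots[OF d] s)
qed

lemma harnack_form_line_3:
  assumes d: "d > 0"
  shows "eval (harnack_form d) (vector [x ^ d, y ^ d, t]) = (\<Prod>c\<in>unity_roots d. t - (x + c * y) ^ d)"
proof -
  obtain s where s: "s ^ d = t" using complex_nth_root[OF d] by blast
  have v: "vector [x ^ d, y ^ d, t] = power_map d (vector [x, y, s])"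
    by (rule vec3_eqI) (simp_all add: s)
  have "eval (harnack_form d) (vector [x ^ d, y ^ d, t]) =
      (\<Prod>a\<in>unity_roots d. \<Prod>b\<in>unity_roots d. s - a * x - b * y)"
    unfolding v eval_harnack_form[OF d] by (simp add: prod.cartesian_product)
  also have "\<dots> = (\<Prod>a\<in>unity_roots d. \<Prod>c\<in>unity_roots d. s - a * (x + c * y))"
  proof (rule prod.cong[OF refl])
    fix a assume a: "a \<in> unity_roots d"
    then have a0: "a \<noteq> 0" using d by (auto simp: power_0_left)
    show "(\<Prod>b\<in>unity_roots d. s - a * x - b * y) = (\<Prod>c\<in>unity_roots d. s - a * (x + c * y))"
      by (rule prod.reindex_bij_witness[of _ "\<lambda>c. a * c" "\<lambda>b. b / a"])
         (use a a0 in \<open>auto simp: power_mult_distrib power_divide algebra_simps\<close>)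
  qed
  also have "\<dots> = (\<Prod>c\<in>unity_roots d. \<Prod>a\<in>unity_roots d. s - a * (x + c * y))"
    by (rule prod.swap)
  finally show ?thesis by (simp only: prod_unity_roots[OF d] s)
qed

lemma DERIV_times_id:
  fixes G :: "'a::real_normed_field \<Rightarrow> 'a"
  assumes "isCont G 0"
  shows "((\<lambda>t. t * G t) has_field_derivative G 0) (at 0)"
  unfolding CARAT_DERIV using assms by (intro exI[of _ G]) (simp add: mult.commute)

text \<open>A simple zero along the i-th coordinate direction. Continuity of G at 0 suffices,
  because t * G t then has derivative G 0 there.\<close>

lemma partial_nonzeroI:
  fixes v :: "'a::real_normed_field ^ 3"
  assumes "\<And>t. eval F (\<chi> j. if j = i then t else v $ j) = t * G t" "isCont G 0" "G 0 \<noteq> 0" "v $ i = 0"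
  shows "eval (partial i F) v \<noteq> 0"
proof -
  have "(\<chi> j. v $ j + t * (if j = i then 1 else 0)) = (\<chi> j. if j = i then t else v $ j)" for t
    using assms(4) by (simp add: vec_eq_iff)
  then have "((\<lambda>t. t * G t) has_field_derivative eval (partial i F) v) (at 0)"
    using partial_DERIV[of F v i] assms(1) by simp
  from DERIV_unique[OF this DERIV_times_id[OF assms(2)]] show ?thesis using assms(3) by simp
qed

lemma unity_minus_one_nonzero: "z \<in> unity_roots d - {1} \<Longrightarrow> s \<noteq> 0 \<Longrightarrow> s - z * s \<noteq> (0 :: complex)"
  by auto

text \<open>On a coordinate line exactly one factor of the one-variable product vanishes, to first
  order, so the point is smooth. Elsewhere roots can be moved freely, and a vanishing derivative
  forces a second line through the root.\<close>

lemma singular_point_node: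
  fixes v :: "complex ^ 3"
  assumes d: "d > 0" and v: "v \<noteq> 0" "eval (harnack_form d) v = 0"
    and sing: "\<And>i. eval (partial i (harnack_form d)) v = 0"
  obtains j k c where "(j, k) \<in> node_indices d" "c \<noteq> 0" "v = (\<chi> i. c * of_real (node d j k $ i))"
proof -
  let ?U = "unity_roots d"
  have fin: "finite ?U" and one: "1 \<in> ?U" using d by auto
  have split: "prod f ?U = f 1 * prod f (?U - {1})" for f :: "complex \<Rightarrow> complex"
    using fin one by (simp add: prod.remove)
  obtain y where y: "power_map d y = v" "y $ 3 = y $ 1 + y $ 2"
    using form_zero_root[OF d v(2)] .
  have v_nth: "v $ i = y $ i ^ d" for i using y(1) by auto
  have "v = 0" if "y = 0" using that d by (simp add: vec_eq_iff v_nth power_0_left)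
  then have y0: "y \<noteq> 0" using v(1) by blast
  have "y $ i \<noteq> 0" for i
  proof
    assume i: "y $ i = 0"
    consider "y $ 1 = 0" | "y $ 2 = 0" | "y $ 3 = 0" using i exhaust_3[of i] by metis
    then show False
    proof cases
      case 1
      define s where "s = y $ 2"
      have s: "y $ 2 = s" "y $ 3 = s" "s \<noteq> 0"
        using 1 y(2) y0 by (auto simp: s_def vec_eq_iff forall_3)
      \<comment> \<open>The factor with b = 1 is (s - s)^d - t = - t; G collects the others, which
        are nonzero at t = 0.\<close>
      define G where "G t = - (\<Prod>b\<in>?U - {1}. (s - b * s) ^ d - t)" for t
      have "eval (partial 1 (harnack_form d)) v \<noteq> 0"
      proof (rule partial_nonzeroI[where G = G])
        fix t
        have "(\<chi> j. if j = 1 then t else v $ j) = vector [t, s ^ d, s ^ d]"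
          by (rule vec3_eqI) (simp_all add: v_nth s)
        then show "eval (harnack_form d) (\<chi> j. if j = 1 then t else v $ j) = t * G t"
          using d by (simp add: harnack_form_line_1 split G_def power_0_left)
        show "isCont G 0" unfolding G_def by (intro continuous_intros)
        show "G 0 \<noteq> 0" using fin unity_minus_one_nonzero[OF _ s(3), of _ d] by (auto simp: G_def)
        show "v $ 1 = 0" using 1 d by (simp add: v_nth power_0_left)
      qed
      then show False using sing by blast
    next
      case 2
      define s where "s = y $ 1"
      have s: "y $ 1 = s" "y $ 3 = s" "s \<noteq> 0"
        using 2 y(2) y0 by (auto simp: s_def vec_eq_iff forall_3)
      define G where "G t = - (\<Prod>b\<in>?U - {1}. (s - b * s) ^ d - t)" for t
      have "eval (partial 2 (harnack_form d)) v \<noteq> 0"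
      proof (rule partial_nonzeroI[where G = G])
        fix t
        have "(\<chi> j. if j = 2 then t else v $ j) = vector [s ^ d, t, s ^ d]"
          by (rule vec3_eqI) (simp_all add: v_nth s)
        then show "eval (harnack_form d) (\<chi> j. if j = 2 then t else v $ j) = t * G t"
          using d by (simp add: harnack_form_line_2 split G_def power_0_left)
        show "isCont G 0" unfolding G_def by (intro continuous_intros)
        show "G 0 \<noteq> 0" using fin unity_minus_one_nonzero[OF _ s(3), of _ d] by (auto simp: G_def)
        show "v $ 2 = 0" using 2 d by (simp add: v_nth power_0_left)
      qed
      then show False using sing by blast
    next
      case 3
      define s where "s = y $ 1"
      have s: "y $ 1 = s" "y $ 2 = - s" "s \<noteq> 0"
        using 3 y(2) y0 by (auto simp: s_def vec_eq_iff forall_3 eq_neg_iff_add_eq_0 add.commute)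
      define G where "G t = (\<Prod>c\<in>?U - {1}. t - (s - c * s) ^ d)" for t
      have "eval (partial 3 (harnack_form d)) v \<noteq> 0"
      proof (rule partial_nonzeroI[where G = G])
        fix t
        have "(\<chi> j. if j = 3 then t else v $ j) = vector [s ^ d, (- s) ^ d, t]"
          by (rule vec3_eqI) (simp_all add: v_nth s)
        then show "eval (harnack_form d) (\<chi> j. if j = 3 then t else v $ j) = t * G t"
          using d by (simp add: harnack_form_line_3 split G_def power_0_left)
        show "isCont G 0" unfolding G_def by (intro continuous_intros)
        show "G 0 \<noteq> 0" using fin unity_minus_one_nonzero[OF _ s(3), of _ d] by (auto simp: G_def)
        show "v $ 3 = 0" using 3 d by (simp add: v_nth power_0_left)
      qed
      then show False using sing by blast
    qed
  qed
  note y_nz = this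
  \<comment> \<open>Along \<gamma> the line z - x - y takes the value t. S is the product of the
    remaining lines, and S 0 is the derivative at 0.\<close>
  define S where "S t = (\<Prod>(a, b)\<in>?U \<times> ?U - {(1, 1)}. y $ 3 + t - a * y $ 1 - b * y $ 2)" for t
  define \<gamma> where "\<gamma> t = power_map d (\<chi> j. y $ j + t * (if j = 3 then 1 else 0))" for t
  have \<gamma>0: "\<gamma> 0 = v" unfolding \<gamma>_def y(1)[symmetric] by (simp add: vec_eq_iff)
  have "eval (harnack_form d) (\<gamma> t) = t * S t" for t
  proof -
    have "eval (harnack_form d) (\<gamma> t) = (\<Prod>(a, b)\<in>?U \<times> ?U. y $ 3 + t - a * y $ 1 - b * y $ 2)"
      unfolding \<gamma>_def eval_harnack_form[OF d] by simp
    also have "\<dots> = t * S t"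
      unfolding S_def using fin one by (subst prod.remove[of _ "(1, 1)"]) (auto simp: y(2))
    finally show ?thesis .
  qed
  moreover have "((\<lambda>t. eval (harnack_form d) (\<gamma> t)) has_field_derivative
      (\<Sum>i\<in>UNIV. eval (partial i (harnack_form d)) (\<gamma> 0) *
        (\<chi> j. of_nat d * y $ j ^ (d - 1) * (if j = 3 then 1 else 0)) $ i)) (at 0)"
    by (rule eval_DERIV) (auto simp: \<gamma>_def intro!: derivative_eq_intros)
  ultimately have "((\<lambda>t. t * S t) has_field_derivative 0) (at 0)"
    by (simp add: \<gamma>0 sing)
  moreover have "isCont S 0" unfolding S_def case_prod_unfold by (intro continuous_intros)
  ultimately have "S 0 = 0" using DERIV_times_id DERIV_unique by blast
  then have "\<exists>p\<in>?U \<times> ?U - {(1, 1)}. (case p of (a, b) \<Rightarrow> y $ 3 + 0 - a * y $ 1 - b * y $ 2) = 0"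
    using fin unfolding S_def by (subst (asm) prod_zero_iff) auto
  then obtain a b where "(a, b) \<in> ?U \<times> ?U - {(1, 1)}" "y $ 3 - a * y $ 1 - b * y $ 2 = 0"
    by (auto simp only: add_0_right split: prod.splits)
  then have ab: "a ^ d = 1" "b ^ d = 1" "(a, b) \<noteq> (1, 1)" "y $ 3 = a * y $ 1 + b * y $ 2"
    by (auto simp: algebra_simps)
  obtain j k c where jk: "0 < j" "j < d" "0 < k" "k < d" "j \<noteq> k" "c \<noteq> 0"
    "y = (\<chi> i. c * node_root d j k $ i)"
    using double_point_root[OF d y_nz y(2) ab] .
  obtain j' k' c' where jk': "(j', k') \<in> node_indices d" "c' \<noteq> 0" "node d j k = c' *\<^sub>R node d j' k'"
    using node_sorted[OF jk(1-5)] .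
  have nr: "node_root d j k $ i ^ d = of_real (node d j k $ i)" for i
    using power_map_node_root[OF d, of j k] by (metis complexify_nth power_map_nth)
  have "v = (\<chi> i. (c ^ d * of_real c') * of_real (node d j' k' $ i))"
    by (simp add: vec_eq_iff v_nth jk(7) power_mult_distrib nr jk'(3))
  then show ?thesis using that[OF jk'(1), of "c ^ d * of_real c'"] jk(6) jk'(2) by simp
qed

section \<open>Real zeros: the circle and the solitary nodes\<close>

definition circle_root :: "real \<Rightarrow> real ^ 3" where
  "circle_root \<theta> = vector [cos \<theta>, sin \<theta>, cos \<theta> + sin \<theta>]"

definition circle :: "nat \<Rightarrow> real \<Rightarrow> real ^ 3" where
  "circle d \<theta> = power_map d (circle_root \<theta>)"

lemma circle_root_nth [simp]:
  "circle_root \<theta> $ 1 = cos \<theta>" "circle_root \<theta> $ 2 = sin \<theta>" "circle_root \<theta> $ 3 = cos \<theta> + sin \<theta>"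
  by (simp_all add: circle_root_def)

lemma circle_zero:
  assumes d: "d > 0"
  shows "eval (harnack_form d) (circle d \<theta>) = 0"
proof -
  have "eval (harnack_form d) (complexify (circle d \<theta>)) = 0"
    unfolding circle_def complexify_power_map eval_harnack_form[OF d] using d
    by (intro prod_zero bexI[of _ "(1, 1)"]) auto
  then show ?thesis by (simp add: eval_complexify)
qed

lemma circle_nonzero: "circle d \<theta> \<noteq> 0"
proof
  assume "circle d \<theta> = 0"
  then have "cos \<theta> ^ d = 0" "sin \<theta> ^ d = 0" by (auto simp: circle_def vec_eq_iff forall_3)
  then have "cos \<theta> = 0" "sin \<theta> = 0" by simp_all
  then show False using sin_cos_squared_add[of \<theta>] by simp
qed

text \<open>For real v, the root y and its conjugate have equal d-th powers and differ by roots of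
  unity q in the coordinates. If the q agree, y is a multiple of a real vector and gives a point of
  the circle; otherwise the conjugate of z = x + y is a second line through y, and v is a
  node.\<close>

lemma real_zero_cases:
  fixes v :: "real ^ 3"
  assumes d: "d > 0" and v: "v \<noteq> 0" "eval (harnack_form d) v = 0"
  obtains (circle) \<theta> c where "c \<noteq> 0" "v = c *\<^sub>R circle d \<theta>"
  | (node) j k c where "(j, k) \<in> node_indices d" "c \<noteq> 0" "v = c *\<^sub>R node d j k"
proof -
  have "eval (harnack_form d) (complexify v) = 0" using v(2) by (simp add: eval_complexify)
  then obtain y where y: "power_map d y = complexify v" "y $ 3 = y $ 1 + y $ 2"
    using form_zero_root[OF d] by blast
  have vy: "of_real (v $ i) = y $ i ^ d" for i
    using y(1) by (metis complexify_nth power_map_nth)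
  have real_case: thesis if s: "s \<noteq> 0" and r: "\<And>i. y $ i = s * of_real (r $ i)" for s and r :: "real ^ 3"
  proof -
    obtain i where i: "v $ i \<noteq> 0" using v(1) by (auto simp: vec_eq_iff)
    have ri: "r $ i ^ d \<noteq> 0"
    proof
      assume "r $ i ^ d = 0"
      then have "y $ i = 0" using r[of i] by simp
      then show False using vy[of i] i d by (simp add: power_0_left)
    qed
    define c where "c = v $ i / r $ i ^ d"
    have sd: "s ^ d = of_real c"
      using vy[of i] ri by (simp add: r power_mult_distrib c_def field_simps)
    have vr: "v $ l = c * r $ l ^ d" for l
    proof -
      have "of_real (v $ l) = (of_real (c * r $ l ^ d) :: complex)"
        using vy[of l] by (simp add: r power_mult_distrib sd)
      then show ?thesis by (simp only: of_real_eq_iff)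
    qed
    have "of_real (r $ 3) = (of_real (r $ 1 + r $ 2) :: complex)"
      using y(2) s unfolding r by (simp flip: distrib_left)
    then have r3: "r $ 3 = r $ 1 + r $ 2" by (simp only: of_real_eq_iff)
    obtain \<rho> \<theta> where polar: "r $ 1 = \<rho> * cos \<theta>" "r $ 2 = \<rho> * sin \<theta>" using polar_Ex by blast
    have "r $ l = \<rho> * circle_root \<theta> $ l" for l
      using forall_3[of "\<lambda>l. r $ l = \<rho> * circle_root \<theta> $ l"] by (simp add: polar r3 algebra_simps)
    then have "v = (c * \<rho> ^ d) *\<^sub>R circle d \<theta>"
      by (simp add: vec_eq_iff vr circle_def power_mult_distrib)
    moreover from this have "c * \<rho> ^ d \<noteq> 0" using v(1) by auto
    ultimately show thesis by (rule circle[rotated])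
  qed
  \<comment> \<open>With one coordinate zero, z = x + y alone makes y a multiple of a real
    vector.\<close>
  have zero_case: thesis if i0: "y $ i = 0" for i
  proof -
    have "of_real (v $ l) = (0 :: complex)" if "y = 0" for l using that d vy[of l] by (simp add: power_0_left)
    then have "y \<noteq> 0" using v(1) by (auto simp: vec_eq_iff)
    consider "y $ 1 = 0" | "y $ 2 = 0" | "y $ 3 = 0" using i0 exhaust_3[of i] by metis
    then show thesis
    proof cases
      case 1
      have "y $ 2 \<noteq> 0" using 1 y(2) \<open>y \<noteq> 0\<close> by (auto simp: vec_eq_iff forall_3)
      moreover have "y $ l = y $ 2 * of_real ((vector [0, 1, 1] :: real ^ 3) $ l)" for l
        using exhaust_3[of l] 1 y(2) by auto
      ultimately show thesis by (rule real_case)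
    next
      case 2
      have "y $ 1 \<noteq> 0" using 2 y(2) \<open>y \<noteq> 0\<close> by (auto simp: vec_eq_iff forall_3)
      moreover have "y $ l = y $ 1 * of_real ((vector [1, 0, 1] :: real ^ 3) $ l)" for l
        using exhaust_3[of l] 2 y(2) by auto
      ultimately show thesis by (rule real_case)
    next
      case 3
      have y2: "y $ 2 = - y $ 1" using 3 y(2) by (simp add: eq_neg_iff_add_eq_0 add.commute)
      have "y $ 1 \<noteq> 0" using 3 y(2) \<open>y \<noteq> 0\<close> by (auto simp: vec_eq_iff forall_3)
      moreover have "y $ l = y $ 1 * of_real ((vector [1, - 1, 0] :: real ^ 3) $ l)" for l
        using exhaust_3[of l] 3 y(2) y2 by auto
      ultimately show thesis by (rule real_case)
    qed
  qed
  show thesis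
  proof (cases "\<exists>i. y $ i = 0")
    case True
    then show thesis using zero_case by blast
  next
    case False
    then have nz: "y $ i \<noteq> 0" for i by blast
    define q where "q i = cnj (y $ i) / y $ i" for i
    have q: "cnj (y $ i) = q i * y $ i" "q i ^ d = 1" for i
    proof -
      show "cnj (y $ i) = q i * y $ i" using nz[of i] by (simp add: q_def)
      have "cnj (y $ i) ^ d = y $ i ^ d" using vy[of i] by (metis complex_cnj_complex_of_real complex_cnj_power)
      then show "q i ^ d = 1" using nz[of i] by (simp add: q_def power_divide)
    qed
    have q0: "q i \<noteq> 0" for i using q(2)[of i] d by (auto simp: power_0_left)
    have conj_eq: "q 3 * y $ 3 = q 1 * y $ 1 + q 2 * y $ 2"
      using y(2) unfolding q(1)[symmetric] by simp
    show thesis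
    proof (cases "q 1 = q 3 \<and> q 2 = q 3")
      case True
      then have qi: "q i = q 1" for i using exhaust_3[of i] by auto
      have "cnj (y $ i / y $ 1) = y $ i / y $ 1" for i
        using q0[of 1] qi[of i] by (simp add: q(1))
      then have "of_real (Re (y $ i / y $ 1)) = y $ i / y $ 1" for i
        by (intro of_real_Re) (simp only: Reals_cnj_iff)
      then have "y $ i = y $ 1 * of_real ((\<chi> i. Re (y $ i / y $ 1)) $ i)" for i
        using nz[of 1] by simp
      then show thesis by (rule real_case[OF nz])
    next
      case False
      have ab: "(q 1 / q 3) ^ d = 1" "(q 2 / q 3) ^ d = 1" "(q 1 / q 3, q 2 / q 3) \<noteq> (1, 1)"
        using q(2) q0 False by (auto simp: power_divide)
      have "y $ 3 = q 1 / q 3 * y $ 1 + q 2 / q 3 * y $ 2"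
        using conj_eq q0[of 3] by (simp add: field_simps)
      from double_point_root[OF d nz y(2) ab this]
      obtain j k c where jk: "0 < j" "j < d" "0 < k" "k < d" "j \<noteq> k" "c \<noteq> 0"
        "y = (\<chi> i. c * node_root d j k $ i)" .
      obtain j' k' c' where jk': "(j', k') \<in> node_indices d" "c' \<noteq> 0" "node d j k = c' *\<^sub>R node d j' k'"
        using node_sorted[OF jk(1-5)] .
      have nr: "node_root d j k $ i ^ d = of_real (node d j k $ i)" for i
        using power_map_node_root[OF d, of j k] by (metis complexify_nth power_map_nth)
      have vn: "of_real (v $ i) = c ^ d * of_real (node d j k $ i)" for i
        by (simp add: vy jk(7) power_mult_distrib nr)
      define e where "e = v $ 1 / node d j k $ 1"
      have "node d j k $ 1 \<noteq> 0" using node_nonzero[OF jk(1-5)] .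
      then have ce: "c ^ d = of_real e" using vn[of 1] by (simp add: e_def field_simps)
      have "v = e *\<^sub>R node d j k"
      proof -
        have "of_real (v $ i) = (of_real (e * node d j k $ i) :: complex)" for i
          using vn[of i] by (simp add: ce)
        then show ?thesis by (simp only: of_real_eq_iff vec_eq_iff scaleR_vec_def vec_lambda_beta) simp
      qed
      then have ve: "v = (e * c') *\<^sub>R node d j' k'" by (simp add: jk'(3))
      have "e \<noteq> 0" using ce jk(6) by auto
      then show thesis using node[OF jk'(1) _ ve] jk'(2) by simp
    qed
  qed
qed

lemma proportional_powers:
  fixes y z :: "complex ^ 3"
  assumes d: "d > 0" and nz: "\<And>i. y $ i \<noteq> 0" "\<And>i. z $ i \<noteq> 0"
    and ratio: "\<And>i. y $ i ^ d = \<kappa> * z $ i ^ d"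
  obtains \<mu> a where "\<mu> \<noteq> 0" "\<And>i. a i ^ d = 1" "\<And>i. y $ i = a i * \<mu> * z $ i"
proof -
  obtain \<mu> where \<mu>: "\<mu> ^ d = \<kappa>" using complex_nth_root[OF d] by blast
  have "\<kappa> \<noteq> 0" using ratio[of 1] nz(1)[of 1] by auto
  then have \<mu>0: "\<mu> \<noteq> 0" using \<mu> d by (auto simp: power_0_left)
  show ?thesis
  proof (rule that[of \<mu> "\<lambda>i. y $ i / (\<mu> * z $ i)"])
    show "(y $ i / (\<mu> * z $ i)) ^ d = 1" for i
      using \<open>\<kappa> \<noteq> 0\<close> nz(2)[of i] by (simp add: power_divide power_mult_distrib \<mu> ratio)
  qed (use \<mu>0 nz in auto)
qed

lemma node_root_power: "d > 0 \<Longrightarrow> node_root d j k $ i ^ d = of_real (node d j k $ i)"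
  using power_map_node_root[of d j k] by (metis complexify_nth power_map_nth)

text \<open>A real root on z = x + y, twisted by the roots of unity \<open>a i\<close>, would give a
  conjugation-invariant line through the node root. But only two lines pass through it, and
  conjugation exchanges them.\<close>

lemma circle_not_node:
  assumes jk: "(j, k) \<in> node_indices d"
  shows "circle d \<theta> \<noteq> c *\<^sub>R node d j k"
proof
  assume eq: "circle d \<theta> = c *\<^sub>R node d j k"
  have jk': "0 < j" "j < d" "0 < k" "k < d" "j \<noteq> k" and d: "d > 0"
    using jk by (auto simp: node_indices_def)
  have c: "c \<noteq> 0" using eq circle_nonzero[of d \<theta>] by auto
  let ?y = "node_root d j k" and ?z = "complexify (circle_root \<theta>)"
  have pow: "?y $ i ^ d = of_real (1 / c) * ?z $ i ^ d" for i
  proof -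
    have "circle d \<theta> $ i = c * node d j k $ i" by (simp add: eq)
    then show ?thesis using c d by (simp add: node_root_power circle_def flip: of_real_power)
  qed
  have nz: "?y $ i \<noteq> 0" "?z $ i \<noteq> 0" for i
    using node_root_nonzero[OF jk', of i] pow[of i] d by (auto simp: power_0_left simp del: complexify_nth)
  obtain \<mu> a where a: "\<mu> \<noteq> 0" "\<And>i. a i ^ d = 1" "\<And>i. ?y $ i = a i * \<mu> * ?z $ i"
    using proportional_powers[OF d nz pow] by blast
  have a0: "a i \<noteq> 0" for i using a(2)[of i] d by (auto simp: power_0_left)
  \<comment> \<open>The right side does not depend on i: this is the conjugation invariance of the
    twisted line.\<close>
  have q: "conj_factor d j k $ i * a i * a i = cnj \<mu> / \<mu>" for i
  proof -
    have "cnj (a i) * cnj \<mu> * ?z $ i = conj_factor d j k $ i * (a i * \<mu> * ?z $ i)"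
      using cnj_node_root[OF d, of j k i] unfolding a(3) by simp
    then have "cnj (a i) * cnj \<mu> = conj_factor d j k $ i * a i * \<mu>"
      using nz(2)[of i] by simp
    then have "(cnj (a i) * a i) * cnj \<mu> = conj_factor d j k $ i * a i * a i * \<mu>"
      by (simp add: ac_simps)
    then have "cnj \<mu> = conj_factor d j k $ i * a i * a i * \<mu>"
      by (simp only: unity_root_cnj[OF a(2) d] mult_1_left)
    then show ?thesis using a(1) by simp
  qed
  have ratio: "?y $ i / a i = \<mu> * ?z $ i" for i using a0 by (simp add: a(3))
  have "?y $ 3 / a 3 = ?y $ 1 / a 1 + ?y $ 2 / a 2"
    unfolding ratio by (simp add: distrib_left)
  then have "?y $ 3 - a 3 / a 1 * ?y $ 1 - a 3 / a 2 * ?y $ 2 = 0"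
    using a0 by (simp add: field_simps)
  moreover have "(a 3 / a 1) ^ d = 1" "(a 3 / a 2) ^ d = 1" using a(2) by (simp_all add: power_divide)
  ultimately have "a 3 / a 1 = 1 \<or> a 3 / a 1 = unity_root d j"
    using node_factors[OF jk', of "a 3 / a 1" "a 3 / a 2"] by blast
  then have "a 3 = a 1 \<or> a 3 = unity_root d j * a 1" using a0 by (auto simp: field_simps)
  moreover have eq13: "conj_factor d j k $ 1 * a 1 * a 1 = conj_factor d j k $ 3 * a 3 * a 3"
    using q by metis
  ultimately have "unity_root d j = 1"
  proof (elim disjE)
    assume "a 3 = a 1"
    then have "conj_factor d j k $ 1 = conj_factor d j k $ 3" using eq13 a0 by simp
    then have "cnj (unity_root d k) * 1 = cnj (unity_root d k) * cnj (unity_root d j)"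
      by (simp add: conj_factor_nth unity_root_add mult.commute)
    then have "1 = cnj (unity_root d j)" by (subst (asm) mult_cancel_left) simp
    then show ?thesis by (metis complex_cnj_cnj complex_cnj_one)
  next
    assume a3: "a 3 = unity_root d j * a 1"
    have "conj_factor d j k $ 3 * a 3 * a 3 =
        cnj (unity_root d k) * a 1 * a 1 * unity_root d j * (cnj (unity_root d j) * unity_root d j)"
      by (simp add: conj_factor_nth unity_root_add a3 ac_simps)
    then have "cnj (unity_root d k) * a 1 * a 1 * 1 = cnj (unity_root d k) * a 1 * a 1 * unity_root d j"
      using eq13 by (simp add: cnj_unity_root_mult[OF d] conj_factor_nth)
    then show ?thesis using a0[of 1] by (subst (asm) mult_cancel_left) simp
  qed
  then show False using jk' d by (auto simp: unity_root_eq_1_iff dest: dvd_imp_le)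
qed

text \<open>The twist carries z = x + y to one of the two lines through the other node root.
  Comparing inscribed triangles gives (j', k') = (j, k) in one case and (d - j, d - k) in the other,
  which the order of the indices excludes.\<close>

lemma node_distinct:
  assumes jk: "(j, k) \<in> node_indices d" and jk': "(j', k') \<in> node_indices d"
    and eq: "node d j' k' = c *\<^sub>R node d j k"
  shows "(j', k') = (j, k)"
proof -
  have i: "0 < j" "j < d" "0 < k" "k < d" "j \<noteq> k" and i': "0 < j'" "j' < d" "0 < k'" "k' < d" "j' \<noteq> k'"
    and d: "d > 0" using jk jk' by (auto simp: node_indices_def)
  let ?y = "node_root d j' k'" and ?z = "node_root d j k"
  have pow: "?y $ i ^ d = of_real c * ?z $ i ^ d" for i
    using d by (simp add: node_root_power eq)
  obtain \<mu> a where a: "\<mu> \<noteq> 0" "\<And>i. a i ^ d = 1" "\<And>i. ?y $ i = a i * \<mu> * ?z $ i"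
    using proportional_powers[OF d node_root_nonzero[OF i'] node_root_nonzero[OF i] pow] by blast
  have a0: "a i \<noteq> 0" for i using a(2)[of i] d by (auto simp: power_0_left)
  have "\<mu> * (a 3 * ?z $ 3 - a 1 * ?z $ 1 - a 2 * ?z $ 2) = 0"
    using node_on_lines(1)[of d j' k'] unfolding a(3) by (simp add: algebra_simps)
  then have "(a 3 * ?z $ 3 - a 1 * ?z $ 1 - a 2 * ?z $ 2) / a 3 = 0"
    using a(1) by simp
  then have "?z $ 3 - a 1 / a 3 * ?z $ 1 - a 2 / a 3 * ?z $ 2 = 0"
    using a0[of 3] by (simp only: diff_divide_distrib times_divide_eq_left) simp
  moreover have "(a 1 / a 3) ^ d = 1" "(a 2 / a 3) ^ d = 1" using a(2) by (simp_all add: power_divide)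
  ultimately have "(a 1 / a 3, a 2 / a 3) = (1, 1) \<or> (a 1 / a 3, a 2 / a 3) = (unity_root d j, unity_root d k)"
    by (intro node_factors[OF i])
  then have cases: "(a 1 = a 3 \<and> a 2 = a 3) \<or> (a 1 = unity_root d j * a 3 \<and> a 2 = unity_root d k * a 3)"
    using a0 by (auto simp: field_simps)
  have y: "chord d k' = a 1 * \<mu> * chord d k" "chord d j' = a 2 * \<mu> * chord d j"
    using a(3)[of 1] a(3)[of 2] by (simp_all add: node_root_nth)
  have units: "unity_root d l \<noteq> 1" if "0 < l" "l < d" for l
    using that d by (auto simp: unity_root_eq_1_iff dest: dvd_imp_le)
  have neq: "unity_root d j \<noteq> unity_root d k" using i d by (simp add: unity_root_eq_iff)
  from cases show ?thesis
  proof
    assume "a 1 = a 3 \<and> a 2 = a 3"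
    then have "chord d k' * chord d j = chord d k * chord d j'" using y by simp
    then have "(unity_root d k' - 1) * (unity_root d j - 1) = (unity_root d k - 1) * (unity_root d j' - 1)"
      by (simp add: unity_root_chord)
    then have "unity_root d j' = unity_root d j \<and> unity_root d k' = unity_root d k"
      using d i i' neq units by (intro unit_circle_similar) auto
    then show ?thesis using i i' d by (simp add: unity_root_eq_iff)
  next
    assume *: "a 1 = unity_root d j * a 3 \<and> a 2 = unity_root d k * a 3"
    have "chord d k' * (unity_root d k * chord d j) = unity_root d j * chord d k * chord d j'"
      unfolding y using * by simp
    then have "cnj (unity_root d j) * cnj (unity_root d k) * (chord d k' * (unity_root d k * chord d j)) =
        cnj (unity_root d j) * cnj (unity_root d k) * (unity_root d j * chord d k * chord d j')"
      by (simp only:)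
    then have "(cnj (unity_root d k) * unity_root d k) * chord d k' * (cnj (unity_root d j) * chord d j) =
        (cnj (unity_root d j) * unity_root d j) * (cnj (unity_root d k) * chord d k) * chord d j'"
      by (simp only: ac_simps)
    then have "chord d k' * cnj (chord d j) = cnj (chord d k) * chord d j'"
      by (simp add: cnj_unity_root_mult[OF d] cnj_chord[OF d])
    then have "(unity_root d k' - 1) * (cnj (unity_root d j) - 1) = (cnj (unity_root d k) - 1) * (unity_root d j' - 1)"
      by (simp add: unity_root_chord)
    then have sim: "(unity_root d k' - 1) * (unity_root d (d - j) - 1) = (unity_root d (d - k) - 1) * (unity_root d j' - 1)"
      using i d by (simp add: unity_root_diff)
    have "unity_root d (d - j) \<noteq> unity_root d (d - k)" using i d by (simp add: unity_root_eq_iff)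
    then have "unity_root d j' = unity_root d (d - j) \<and> unity_root d k' = unity_root d (d - k)"
      using d i i' units sim by (intro unit_circle_similar) auto
    then have "j' = d - j" "k' = d - k" using i i' d by (simp_all add: unity_root_eq_iff)
    then show ?thesis using jk jk' by (auto simp: node_indices_def)
  qed
qed

lemma finite_node_indices [simp]: "finite (node_indices d)"
  by (rule finite_subset[of _ "{..d} \<times> {..d}"]) (auto simp: node_indices_def)

lemma card_node_indices: "card (node_indices d) = (d - 1) * (d - 2) div 2"
proof -
  have "bij_betw (\<lambda>(k, j). (j, k)) (SIGMA k:{..<d}. {0<..<k}) (node_indices d)"
    by (rule bij_betw_byWitness[where f' = "\<lambda>(j, k). (k, j)"]) (auto simp: node_indices_def)
  then have "card (node_indices d) = (\<Sum>k<d. k - 1)"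
    using bij_betw_same_card by fastforce
  moreover have "2 * (\<Sum>k<d. k - 1) = (d - 1) * (d - 2)"
  proof (induction d)
    case (Suc d)
    then show ?case by (cases d; cases "d - 1") (auto simp: algebra_simps)
  qed simp
  ultimately show ?thesis by simp
qed


section \<open>Smoothness of a small perturbation\<close>

lemma homogeneous_partial:
  assumes "homogeneous n F"
  shows "homogeneous (n - 1) (partial i F)"
  unfolding partial_def
proof (rule homogeneous_sum)
  fix m assume m: "m \<in> Poly_Mapping.keys F"
  show "homogeneous (n - 1) (Poly_Mapping.single (m - Poly_Mapping.single i 1)
      (Poly_Mapping.lookup F m * of_nat (Poly_Mapping.lookup m i)))"
  proof (cases "Poly_Mapping.lookup m i = 0")
    case False
    have "m - Poly_Mapping.single i 1 + Poly_Mapping.single i 1 = m"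
    proof (rule poly_mapping_eqI)
      fix l
      show "Poly_Mapping.lookup (m - Poly_Mapping.single i 1 + Poly_Mapping.single i 1) l = Poly_Mapping.lookup m l"
        using False by (cases "i = l") (simp_all add: lookup_add lookup_minus lookup_single when_def)
    qed
    then have "total_degree m = total_degree (m - Poly_Mapping.single i 1) + total_degree (Poly_Mapping.single i 1)"
      by (metis total_degree_add)
    moreover have "total_degree (Poly_Mapping.single i 1) = 1"
      by (simp add: total_degree_def lookup_single when_def)
    ultimately show ?thesis using assms m by (intro homogeneous_single) (auto simp: homogeneous_iff)
  qed (simp add: homogeneous_iff)
qed

lemma eval_partial_const [simp]:
  fixes v :: "'a::real_normed_field ^ 3"
  shows "eval (partial i (Poly_Mapping.single 0 c)) v = 0"
  by (simp add: partial_eval)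

definition perturbed :: "poly3 \<Rightarrow> poly3 \<Rightarrow> real \<Rightarrow> poly3" where
  "perturbed F h \<epsilon> = F + Poly_Mapping.single 0 \<epsilon> * h"

lemma eval_perturbed: "eval (perturbed F h \<epsilon>) v = eval F v + of_real \<epsilon> * eval h v"
  by (simp add: perturbed_def eval_add eval_mult)

lemma eval_partial_perturbed:
  fixes v :: "'a::real_normed_field ^ 3"
  shows "eval (partial i (perturbed F h \<epsilon>)) v = eval (partial i F) v + of_real \<epsilon> * eval (partial i h) v"
  by (simp add: perturbed_def eval_partial_add eval_partial_mult)

lemma homogeneous_perturbed: "homogeneous d F \<Longrightarrow> homogeneous d h \<Longrightarrow> homogeneous d (perturbed F h \<epsilon>)"
  unfolding perturbed_def
  using homogeneous_mult[of 0 "Poly_Mapping.single 0 \<epsilon>" d h]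
  by (intro homogeneous_add) (auto simp: homogeneous_single)

section \<open>Local factorization at a node\<close>

definition line_val :: "complex \<times> complex \<Rightarrow> complex ^ 3 \<Rightarrow> complex" where
  "line_val p y = y $ 3 - fst p * y $ 1 - snd p * y $ 2"

definition other_lines :: "nat \<Rightarrow> nat \<Rightarrow> nat \<Rightarrow> (complex \<times> complex) set" where
  "other_lines d j k = unity_roots d \<times> unity_roots d - {(1, 1), (unity_root d j, unity_root d k)}"

definition cofactor :: "nat \<Rightarrow> nat \<Rightarrow> nat \<Rightarrow> complex ^ 3 \<Rightarrow> complex" where
  "cofactor d j k y = (\<Prod>p\<in>other_lines d j k. line_val p y)"

lemma finite_other_lines [simp]: "d > 0 \<Longrightarrow> finite (other_lines d j k)"
  by (simp add: other_lines_def)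

lemma harnack_form_factors:
  assumes jk: "0 < j" "j < d"
  shows "eval (harnack_form d) (power_map d y) =
    line_val (1, 1) y * line_val (unity_root d j, unity_root d k) y * cofactor d j k y"
proof -
  have d: "d > 0" using jk by simp
  let ?A = "unity_roots d \<times> unity_roots d" and ?p = "(unity_root d j, unity_root d k)"
  have neq: "?p \<noteq> (1, 1)" using jk d by (auto simp: unity_root_eq_1_iff dest: dvd_imp_le)
  have "eval (harnack_form d) (power_map d y) = (\<Prod>p\<in>?A. line_val p y)"
    unfolding eval_harnack_form[OF d] by (simp add: line_val_def case_prod_unfold)
  also have "\<dots> = line_val (1, 1) y * (\<Prod>p\<in>?A - {(1, 1)}. line_val p y)"
    using d by (intro prod.remove) auto
  also have "(\<Prod>p\<in>?A - {(1, 1)}. line_val p y) = line_val ?p y * (\<Prod>p\<in>?A - {(1, 1)} - {?p}. line_val p y)"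
    using d neq by (intro prod.remove) auto
  also have "?A - {(1, 1)} - {?p} = other_lines d j k" by (auto simp: other_lines_def)
  finally show ?thesis by (simp add: cofactor_def)
qed

lemma cofactor_node_root:
  assumes "0 < j" "j < d" "0 < k" "k < d" "j \<noteq> k"
  shows "cofactor d j k (node_root d j k) \<noteq> 0"
proof -
  have "line_val p (node_root d j k) \<noteq> 0" if "p \<in> other_lines d j k" for p
    using node_factors[OF assms, of "fst p" "snd p"] that
    by (auto simp: line_val_def other_lines_def)
  then show ?thesis using assms by (simp add: cofactor_def)
qed

lemma line_val_node_root:
  "line_val (1, 1) (node_root d j k) = 0"
  "line_val (unity_root d j, unity_root d k) (node_root d j k) = 0"
  using node_on_lines[of d j k] by (simp_all add: line_val_def)

definition cofactor_deriv :: "nat \<Rightarrow> nat \<Rightarrow> nat \<Rightarrow> complex ^ 3 \<Rightarrow> complex ^ 3 \<Rightarrow> complex" where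
  "cofactor_deriv d j k e y =
     (\<Sum>p\<in>other_lines d j k. line_val p e * (\<Prod>q\<in>other_lines d j k - {p}. line_val q y))"

lemma line_val_DERIV: "((\<lambda>t. line_val p (\<chi> i. y $ i + t * e $ i)) has_field_derivative line_val p e) (at t)"
  unfolding line_val_def by (auto intro!: derivative_eq_intros)

lemma cofactor_DERIV:
  "((\<lambda>t. cofactor d j k (\<chi> i. y $ i + t * e $ i)) has_field_derivative
     cofactor_deriv d j k e (\<chi> i. y $ i + t * e $ i)) (at t)"
  unfolding cofactor_def cofactor_deriv_def
  by (intro has_field_derivative_prod line_val_DERIV)

lemma tendsto_line_val [tendsto_intros]:
  "(f \<longlongrightarrow> y) net \<Longrightarrow> ((\<lambda>x. line_val p (f x)) \<longlongrightarrow> line_val p y) net"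
  unfolding line_val_def by (intro tendsto_intros)

lemma tendsto_cofactor [tendsto_intros]:
  "(f \<longlongrightarrow> y) net \<Longrightarrow> ((\<lambda>x. cofactor d j k (f x)) \<longlongrightarrow> cofactor d j k y) net"
  unfolding cofactor_def by (intro tendsto_intros)

lemma tendsto_cofactor_deriv [tendsto_intros]:
  "(f \<longlongrightarrow> y) net \<Longrightarrow> ((\<lambda>x. cofactor_deriv d j k e (f x)) \<longlongrightarrow> cofactor_deriv d j k e y) net"
  unfolding cofactor_deriv_def by (intro tendsto_intros)

definition pullback_deriv :: "nat \<Rightarrow> poly3 \<Rightarrow> complex ^ 3 \<Rightarrow> complex ^ 3 \<Rightarrow> complex" where
  "pullback_deriv d h e y =
     (\<Sum>i\<in>UNIV. eval (partial i h) (power_map d y) * (of_nat d * y $ i ^ (d - 1) * e $ i))"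

lemma pullback_DERIV:
  "((\<lambda>t. eval h (power_map d (\<chi> i. y $ i + t * e $ i))) has_field_derivative pullback_deriv d h e y) (at 0)"
proof -
  let ?\<gamma> = "\<lambda>t. power_map d (\<chi> i. y $ i + t * e $ i)"
  have D: "((\<lambda>t. ?\<gamma> t $ i) has_field_derivative (\<chi> i. of_nat d * y $ i ^ (d - 1) * e $ i) $ i) (at 0)" for i
    by (auto intro!: derivative_eq_intros)
  have "?\<gamma> 0 = power_map d y" by (simp add: vec_eq_iff)
  then show ?thesis using eval_DERIV[OF D, of h] by (simp add: pullback_deriv_def)
qed

lemma tendsto_power_map [tendsto_intros]:
  fixes f :: "'x \<Rightarrow> 'a::real_normed_field ^ 3"
  shows "(f \<longlongrightarrow> y) net \<Longrightarrow> ((\<lambda>x. power_map d (f x)) \<longlongrightarrow> power_map d y) net"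
  unfolding power_map_def by (intro tendsto_intros)

lemma tendsto_pullback_deriv [tendsto_intros]:
  "(f \<longlongrightarrow> y) net \<Longrightarrow> ((\<lambda>x. pullback_deriv d h e (f x)) \<longlongrightarrow> pullback_deriv d h e y) net"
  unfolding pullback_deriv_def by (intro tendsto_intros)

text \<open>Near a node, the form is \<open>L\<^sub>1 L\<^sub>2 S\<close> in the root coordinates, and differentiating along the two
  lines \<open>L\<^sub>1 = 0\<close> and \<open>L\<^sub>2 = 0\<close> eliminates \<open>L\<^sub>1\<close> and \<open>L\<^sub>2\<close> from the equations of a singular point
  of the perturbed curve.\<close>

lemma singular_perturbation_identity:
  fixes y :: "complex ^ 3" and \<epsilon> :: real and j k d :: nat
  assumes jk: "0 < j" "j < d" and \<epsilon>: "\<epsilon> \<noteq> 0"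
    and zero: "eval (perturbed (harnack_form d) h \<epsilon>) (power_map d y) = 0"
    and sing: "\<And>i. eval (partial i (perturbed (harnack_form d) h \<epsilon>)) (power_map d y) = 0"
  defines "a \<equiv> unity_root d j" and "b \<equiv> unity_root d k"
  defines "e \<equiv> vector [1, - 1, 0] :: complex ^ 3"
  defines "f \<equiv> vector [unity_root d k, - unity_root d j, 0] :: complex ^ 3"
  shows "eval h (power_map d y) *
      ((b - a) * cofactor d j k y + line_val (a, b) y * cofactor_deriv d j k e y) *
      ((a - b) * cofactor d j k y + line_val (1, 1) y * cofactor_deriv d j k f y) =
    - of_real \<epsilon> * cofactor d j k y * pullback_deriv d h e y * pullback_deriv d h f y"
proof -
  let ?F = "perturbed (harnack_form d) h \<epsilon>"
  define L1 L2 S H where "L1 = line_val (1, 1) y" and "L2 = line_val (a, b) y"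
    and "S = cofactor d j k y" and "H = eval h (power_map d y)"
  have form_val: "eval ?F (power_map d u) =
      line_val (1, 1) u * line_val (a, b) u * cofactor d j k u + of_real \<epsilon> * eval h (power_map d u)" for u
    unfolding eval_perturbed harnack_form_factors[OF jk, of u k] a_def b_def ..
  have eq0: "L1 * L2 * S + of_real \<epsilon> * H = 0"
    using zero unfolding form_val by (simp add: L1_def L2_def S_def H_def)
  have deriv: "(line_val (1, 1) w * L2 + L1 * line_val (a, b) w) * S + L1 * L2 * cofactor_deriv d j k w y
      + of_real \<epsilon> * pullback_deriv d h w y = 0" for w
  proof -
    have y0: "(\<chi> i. y $ i + 0 * w $ i) = y" by (simp add: vec_eq_iff)
    have "((\<lambda>t. eval ?F (power_map d (\<chi> i. y $ i + t * w $ i))) has_field_derivative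
        (line_val (1, 1) w * L2 + L1 * line_val (a, b) w) * S + L1 * L2 * cofactor_deriv d j k w y
      + of_real \<epsilon> * pullback_deriv d h w y) (at 0)"
      unfolding form_val
      by (rule derivative_eq_intros line_val_DERIV cofactor_DERIV pullback_DERIV refl)+
         (simp add: y0[simplified] L1_def L2_def S_def algebra_simps)
    moreover have "((\<lambda>t. eval ?F (power_map d (\<chi> i. y $ i + t * w $ i))) has_field_derivative 0) (at 0)"
      using pullback_DERIV[of ?F d y w] by (simp add: pullback_deriv_def sing)
    ultimately show ?thesis by (rule DERIV_unique)
  qed
  have 1: "L1 * ((b - a) * S + L2 * cofactor_deriv d j k e y) = - of_real \<epsilon> * pullback_deriv d h e y"
  proof -
    have "line_val (1, 1) e = 0" "line_val (a, b) e = b - a" by (simp_all add: line_val_def e_def)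
    then have "L1 * (b - a) * S + L1 * L2 * cofactor_deriv d j k e y + of_real \<epsilon> * pullback_deriv d h e y = 0"
      using deriv[of e] by simp
    then show ?thesis by (simp add: algebra_simps eq_neg_iff_add_eq_0)
  qed
  have 2: "L2 * ((a - b) * S + L1 * cofactor_deriv d j k f y) = - of_real \<epsilon> * pullback_deriv d h f y"
  proof -
    have "line_val (1, 1) f = a - b" "line_val (a, b) f = 0" by (simp_all add: line_val_def f_def a_def b_def)
    then have "(a - b) * L2 * S + L1 * L2 * cofactor_deriv d j k f y + of_real \<epsilon> * pullback_deriv d h f y = 0"
      using deriv[of f] by simp
    then show ?thesis by (simp add: algebra_simps eq_neg_iff_add_eq_0)
  qed
  define A B where "A = (b - a) * S + L2 * cofactor_deriv d j k e y"
    and "B = (a - b) * S + L1 * cofactor_deriv d j k f y"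
  define He Hf where "He = pullback_deriv d h e y" and "Hf = pullback_deriv d h f y"
  \<comment> \<open>\<open>eq0\<close> trades \<epsilon> H for - L1 L2 S, and 1 and 2 trade L1 A and
    L2 B for multiples of \<epsilon>. After cancelling one \<epsilon>, the right side still tends to
    0 with \<epsilon>.\<close>
  have "of_real \<epsilon> * (H * A * B) = - (L1 * L2 * S) * A * B"
    using eq0 by (simp add: eq_neg_iff_add_eq_0 add.commute)
      (metis (no_types, opaque_lifting) add.commute eq_neg_iff_add_eq_0 minus_mult_left mult.assoc add_eq_0_iff)
  also have "\<dots> = - S * ((L1 * A) * (L2 * B))" by (simp add: ac_simps)
  also have "\<dots> = - S * ((- of_real \<epsilon> * He) * (- of_real \<epsilon> * Hf))"
    using 1 2 unfolding A_def B_def He_def Hf_def by (simp only:)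
  also have "\<dots> = of_real \<epsilon> * (- of_real \<epsilon> * S * He * Hf)" by (simp add: ac_simps)
  finally have "H * A * B = - of_real \<epsilon> * S * He * Hf" using \<epsilon> by (subst (asm) mult_cancel_left) simp
  then show ?thesis by (simp add: H_def A_def B_def S_def He_def Hf_def L1_def L2_def)
qed

lemma not_eventually_at_right_0:
  assumes "\<not> (\<forall>\<^sub>F \<epsilon> in at_right (0 :: real). P \<epsilon>)"
  obtains \<epsilon> where "\<And>n. 0 < \<epsilon> n" "\<And>n. \<not> P (\<epsilon> n)" "\<epsilon> \<longlonglongrightarrow> 0"
proof -
  have "\<exists>e. 0 < e \<and> e < 1 / real (Suc n) \<and> \<not> P e" for n
    using assms unfolding eventually_at_right_field by (metis of_nat_0_less_iff zero_less_Suc zero_less_divide_1_iff)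
  then obtain \<epsilon> where e: "\<And>n. 0 < \<epsilon> n \<and> \<epsilon> n < 1 / real (Suc n) \<and> \<not> P (\<epsilon> n)" by metis
  have "\<epsilon> \<longlonglongrightarrow> 0"
    by (rule tendsto_sandwich[OF _ _ tendsto_const LIMSEQ_Suc[OF lim_1_over_n]])
       (use e in \<open>auto intro!: always_eventually less_imp_le\<close>)
  then show ?thesis using that e by blast
qed

text \<open>On the complex unit sphere, singular points for \<epsilon> -> 0 would accumulate at a
  singular point of R, hence at a node. The elimination identity has there the limit h (b - a) (a -
  b) S^2 = 0, although all factors are nonzero.\<close>

lemma smooth_perturbation:
  assumes d: "d > 0" and h: "homogeneous d h"
    and nodes: "\<And>j k. (j, k) \<in> node_indices d \<Longrightarrow> eval h (node d j k) \<noteq> 0"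
  shows "\<forall>\<^sub>F \<epsilon> in at_right 0. smooth (perturbed (harnack_form d) h \<epsilon>)"
proof (rule ccontr)
  let ?F = "\<lambda>\<epsilon>. perturbed (harnack_form d) h \<epsilon>"
  note hom = homogeneous_perturbed[OF homogeneous_harnack_form[OF d] h]
  assume "\<not> ?thesis"
  then obtain \<epsilon> where \<epsilon>: "\<And>n. 0 < \<epsilon> n" "\<And>n. \<not> smooth (?F (\<epsilon> n))" "\<epsilon> \<longlonglongrightarrow> 0"
    by (rule not_eventually_at_right_0) blast
  have "\<exists>v :: complex ^ 3. norm v = 1 \<and> eval (?F (\<epsilon> n)) v = 0 \<and> (\<forall>i. eval (partial i (?F (\<epsilon> n))) v = 0)" for n
  proof -
    obtain v :: "complex ^ 3" where v: "v \<noteq> 0" "eval (?F (\<epsilon> n)) v = 0" "\<And>i. eval (partial i (?F (\<epsilon> n))) v = 0"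
      using \<epsilon>(2)[of n] by (auto simp: smooth_def)
    have w: "(1 / norm v) *\<^sub>R v = (\<chi> i. complex_of_real (1 / norm v) * v $ i)"
      by (simp add: vec_eq_iff) (simp add: scaleR_conv_of_real)
    show ?thesis
      using v by (intro exI[of _ "(1 / norm v) *\<^sub>R v"] conjI allI, simp)
        (simp_all only: w eval_scale[OF hom] eval_scale[OF homogeneous_partial[OF hom]] mult_zero_right)
  qed
  then obtain w :: "nat \<Rightarrow> complex ^ 3" where w: "\<And>n. norm (w n) = 1" "\<And>n. eval (?F (\<epsilon> n)) (w n) = 0"
    "\<And>n i. eval (partial i (?F (\<epsilon> n))) (w n) = 0"
    by metis
  have "seq_compact (sphere (0 :: complex ^ 3) 1)" by (simp add: compact_imp_seq_compact)
  then obtain l r where l: "l \<in> sphere 0 1" "strict_mono r" "(w \<circ> r) \<longlonglongrightarrow> l"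
    using w(1) by (auto simp: seq_compact_def dest!: spec[of _ w])
  have l0: "l \<noteq> 0" using l(1) by auto
  have er: "(\<lambda>n. \<epsilon> (r n)) \<longlonglongrightarrow> 0" using LIMSEQ_subseq_LIMSEQ[OF \<epsilon>(3) l(2)] by (simp add: o_def)
  have wr: "(\<lambda>n. w (r n)) \<longlonglongrightarrow> l" using l(3) by (simp add: o_def)
  have lim: "eval G l = 0" if "\<And>n. eval G (w (r n)) + of_real (\<epsilon> (r n)) * eval G' (w (r n)) = 0" for G G'
  proof -
    have "(\<lambda>n. eval G (w (r n)) + of_real (\<epsilon> (r n)) * eval G' (w (r n))) \<longlonglongrightarrow> eval G l + of_real 0 * eval G' l"
      by (intro tendsto_intros er wr)
    then show ?thesis unfolding that by (simp add: LIMSEQ_const_iff)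
  qed
  have "eval (harnack_form d) l = 0" "eval (partial i (harnack_form d)) l = 0" for i
    using w(2,3) unfolding eval_perturbed eval_partial_perturbed by (auto intro: lim)
  then obtain j k c where jk: "(j, k) \<in> node_indices d" "c \<noteq> 0" "l = (\<chi> i. c * of_real (node d j k $ i))"
    using singular_point_node[OF d l0] by metis
  have jk': "0 < j" "j < d" "0 < k" "k < d" "j \<noteq> k" using jk(1) by (auto simp: node_indices_def)
  define x where "x n = (\<chi> i. 1 / c * w (r n) $ i)" for n
  have x: "eval (?F (\<epsilon> (r n))) (x n) = 0" "eval (partial i (?F (\<epsilon> (r n)))) (x n) = 0" for n i
    unfolding x_def eval_scale[OF hom] eval_scale[OF homogeneous_partial[OF hom]] by (simp_all add: w)
  let ?p = "node d j k" and ?u = "node_root d j k"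
  have xlim: "(\<lambda>n. x n $ i) \<longlonglongrightarrow> of_real (?p $ i)" for i
  proof -
    have "(\<lambda>n. 1 / c * w (r n) $ i) \<longlonglongrightarrow> 1 / c * l $ i" by (intro tendsto_intros wr)
    then show ?thesis using jk(2) by (simp add: x_def jk(3))
  qed
  have p0: "of_real (?p $ i) \<noteq> (0 :: complex)" for i using node_nonzero[OF jk'] by simp
  \<comment> \<open>The branch of the d-th root near \<open>node_root\<close>: the quotients tend to
    1, where Ln is continuous, so u tends to the root of the node and not to another
    preimage.\<close>
  define u where "u n = (\<chi> i. ?u $ i * exp (Ln (x n $ i / of_real (?p $ i)) / of_nat d))" for n
  have ulim: "u \<longlonglongrightarrow> ?u"
  proof (rule vec_tendstoI)
    fix i
    have "(\<lambda>n. x n $ i / of_real (?p $ i)) \<longlonglongrightarrow> of_real (?p $ i) / of_real (?p $ i)"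
      using p0 by (intro tendsto_intros xlim)
    then have "(\<lambda>n. x n $ i / of_real (?p $ i)) \<longlonglongrightarrow> 1" using p0[of i] by simp
    then have "(\<lambda>n. ?u $ i * exp (Ln (x n $ i / of_real (?p $ i)) / of_nat d)) \<longlonglongrightarrow> ?u $ i * exp (Ln 1 / of_nat d)"
      using d by (intro tendsto_intros) auto
    then show "(\<lambda>n. u n $ i) \<longlonglongrightarrow> ?u $ i" by (simp add: u_def)
  qed
  have pow: "\<forall>\<^sub>F n in sequentially. power_map d (u n) = x n"
  proof -
    have "\<forall>\<^sub>F n in sequentially. x n $ i \<noteq> 0" for i
      using xlim[of i] p0[of i] by (rule tendsto_imp_eventually_ne)
    then have "\<forall>\<^sub>F n in sequentially. \<forall>i. x n $ i \<noteq> 0" by (rule eventually_all_finite)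
    then show ?thesis
    proof eventually_elim
      case (elim n)
      have "u n $ i ^ d = x n $ i" for i
      proof -
        have "exp (Ln (x n $ i / of_real (?p $ i)) / of_nat d) ^ d = x n $ i / of_real (?p $ i)"
          using d elim p0 by (simp flip: exp_of_nat_mult)
        then show ?thesis
          using p0[of i] by (simp add: u_def power_mult_distrib node_root_power[OF d])
      qed
      then show ?case by (simp add: vec_eq_iff)
    qed
  qed
  define a b e f where "a = unity_root d j" and "b = unity_root d k"
    and "e = (vector [1, - 1, 0] :: complex ^ 3)" and "f = (vector [b, - a, 0] :: complex ^ 3)"
  let ?lhs = "\<lambda>y. eval h (power_map d y) *
      ((b - a) * cofactor d j k y + line_val (a, b) y * cofactor_deriv d j k e y) *
      ((a - b) * cofactor d j k y + line_val (1, 1) y * cofactor_deriv d j k f y)"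
  let ?rhs = "\<lambda>\<delta> y. - of_real \<delta> * cofactor d j k y * pullback_deriv d h e y * pullback_deriv d h f y"
  have identity: "\<forall>\<^sub>F n in sequentially. ?lhs (u n) = ?rhs (\<epsilon> (r n)) (u n)"
    using pow
  proof eventually_elim
    case (elim n)
    show ?case unfolding a_def b_def e_def f_def
      using \<epsilon>(1)[of "r n"] x(1)[of n] x(2)[where n = n] unfolding elim[symmetric]
      by (intro singular_perturbation_identity jk') auto
  qed
  have "(\<lambda>n. ?lhs (u n)) \<longlonglongrightarrow> ?lhs ?u" by (intro tendsto_intros ulim)
  from Lim_transform_eventually[OF this identity]
  have "(\<lambda>n. ?rhs (\<epsilon> (r n)) (u n)) \<longlonglongrightarrow> ?lhs ?u" .
  moreover have "(\<lambda>n. ?rhs (\<epsilon> (r n)) (u n)) \<longlonglongrightarrow> ?rhs 0 ?u" by (intro tendsto_intros ulim er)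
  ultimately have "?lhs ?u = ?rhs 0 ?u" by (rule LIMSEQ_unique)
  then have "eval h (power_map d ?u) * (b - a) * (a - b) * cofactor d j k ?u * cofactor d j k ?u = 0"
    unfolding a_def b_def by (auto simp: line_val_node_root)
  moreover have "b \<noteq> a" using jk' by (simp add: a_def b_def unity_root_eq_iff)
  moreover have "eval h (power_map d ?u) \<noteq> 0"
    using nodes[OF jk(1)] by (simp add: power_map_node_root[OF d] eval_complexify)
  ultimately show False using cofactor_node_root[OF jk'] by simp
qed


section \<open>Curves with a hyperflex\<close>

lemma vec_span_singleton: "vec.span {v :: 'a::field ^ 3} = range (\<lambda>c. c *s v)"
  by (rule vec.span_singleton)

lemma coeff_hom_const_poly: "coeff_hom (\<lambda>c. [:of_real c :: complex:])"
  by unfold_locales (simp_all add: one_pCons)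

lemma restrict_to_line_eq: "restrict_to_line F p q = msubst (\<lambda>c. [:of_real c:]) F (\<chi> i. [:p $ i, q $ i:])"
  by (simp add: restrict_to_line_def subst_eq_msubst)

lemma restrict_to_line_mult: "restrict_to_line (F * G) p q = restrict_to_line F p q * restrict_to_line G p q"
  unfolding restrict_to_line_eq by (rule coeff_hom.msubst_mult[OF coeff_hom_const_poly])

lemma poly_restrict_to_line: "poly (restrict_to_line F p q) t = eval F (\<chi> i. p $ i + t * q $ i)"
  by (simp add: restrict_to_line_eq msubst_def eval_conv_sum poly_sum monom_val_3)

lemma degree_restrict_to_line:
  assumes "homogeneous n F"
  shows "degree (restrict_to_line F p q) \<le> n"
  unfolding restrict_to_line_eq msubst_def
proof (rule degree_sum_le)
  fix m assume m: "m \<in> Poly_Mapping.keys F"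
  have pw: "degree ([:a, b:] ^ k) \<le> k" for a b :: complex and k
    using degree_power_le[of "[:a, b:]" k] by (rule order_trans) (cases "b = 0"; simp)
  have "degree (monom_val (\<chi> i. [:p $ i, q $ i:]) m) \<le> total_degree m"
    unfolding monom_val_3 total_degree_3
    by (intro order_trans[OF degree_mult_le] add_mono) (simp_all add: pw)
  then show "degree ([:of_real (Poly_Mapping.lookup F m):] * monom_val (\<chi> i. [:p $ i, q $ i:]) m) \<le> n"
    using assms m by (intro order_trans[OF degree_mult_le]) (auto simp: homogeneous_iff)
qed simp

text \<open>The line \<open>y = 0\<close> meets the curve only in \<open>(1 : 0 : 1)\<close>. Hence both factors of a proper
  factorization vanish there, and the curve would be singular.\<close>

lemma irreducible_hyperflex:
  assumes F: "homogeneous d F" "smooth F" and d: "d > 0"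
    and flex: "\<And>x z :: complex. eval F (vector [x, 0, z]) = (z - x) ^ d"
  shows "irreducible F"
proof (rule irreducibleI)
  show F0: "F \<noteq> 0" using flex[of 0 1] by auto
  show "\<not> F dvd 1"
  proof
    assume "F dvd 1"
    then obtain G where G: "1 = F * G" by (auto elim: dvdE)
    have "homogeneous 0 (1 :: poly3)" by (simp add: homogeneous_iff)
    then obtain a b where ab: "homogeneous a F" "homogeneous b G" "a + b = 0"
      using G by (metis homogeneous_factors zero_neq_one)
    then show False using homogeneous_unique[OF ab(1) F(1) F0] d by simp
  qed
  fix A B assume AB: "F = A * B"
  obtain a b where ab: "homogeneous a A" "homogeneous b B" "a + b = d"
    using homogeneous_factors[of d A B] F(1) F0 unfolding AB by metis
  have unit: "C dvd 1" if "homogeneous 0 C" "C \<noteq> 0" for C :: poly3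
  proof -
    let ?c = "Poly_Mapping.lookup C 0"
    have C: "C = Poly_Mapping.single 0 ?c" using that(1) by (rule homogeneous_0_const)
    then have "?c \<noteq> 0" using that(2) by (metis single_zero)
    then have "C * Poly_Mapping.single 0 (1 / ?c) = 1"
      by (subst C) (simp add: mult_single)
    then show ?thesis by (metis dvd_triv_left)
  qed
  show "A dvd 1 \<or> B dvd 1"
  proof (rule ccontr)
    assume "\<not> (A dvd 1 \<or> B dvd 1)"
    then have pos: "a > 0" "b > 0" using unit[of A] unit[of B] ab F0 AB by (auto intro!: gr0I)
    \<comment> \<open>The parameter t = 0 is the flex, and F restricts to (-t)^d.\<close>
    let ?p = "vector [1, 0, 1] :: complex ^ 3" and ?q = "vector [1, 0, 0] :: complex ^ 3"
    have pt: "(\<chi> i. ?p $ i + t * ?q $ i) = vector [1 + t, 0, 1]" for t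
      by (rule vec3_eqI) simp_all
    have product: "restrict_to_line A ?p ?q * restrict_to_line B ?p ?q = monom ((-1) ^ d) d"
      unfolding restrict_to_line_mult[symmetric] AB[symmetric]
      by (simp add: poly_eq_poly_eq_iff[symmetric] fun_eq_iff poly_restrict_to_line pt flex poly_monom
          flip: power_mult_distrib)
    have "(- 1 :: complex) ^ d \<noteq> 0" by simp
    from monom_factors[OF product this]
    obtain \<alpha> \<beta> k l where kl: "restrict_to_line A ?p ?q = monom \<alpha> k"
      "restrict_to_line B ?p ?q = monom \<beta> l" "k + l = d"
      by blast
    have nz: "\<alpha> \<noteq> 0" "\<beta> \<noteq> 0"
      using product by (auto simp: kl)
    \<comment> \<open>Since k + l = a + b, both inequalities are equalities: each factor meets the
      line with its full degree at the flex.\<close>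
    have "k \<le> a" "l \<le> b"
      using degree_restrict_to_line[OF ab(1), of ?p ?q] degree_restrict_to_line[OF ab(2), of ?p ?q] nz
      by (simp_all add: kl degree_monom_eq)
    then have "k > 0" "l > 0" using kl(3) ab(3) pos by simp_all
    moreover have "eval A ?p = poly (restrict_to_line A ?p ?q) 0" "eval B ?p = poly (restrict_to_line B ?p ?q) 0"
      by (simp_all add: poly_restrict_to_line)
    ultimately have zero: "eval A ?p = 0" "eval B ?p = 0"
      by (simp_all add: kl poly_monom)
    then have "eval F ?p = 0" "\<And>i. eval (partial i F) ?p = 0"
      by (simp_all add: AB eval_mult eval_partial_mult)
    moreover have "?p \<noteq> 0" by (simp add: vec_eq_iff forall_3)
    ultimately show False using F(2) by (auto simp: smooth_def)
  qed
qed

text \<open>The line y = 0 cuts out d times the real point (1 : 0 : 1).\<close>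

lemma totally_real_hyperflex:
  assumes F: "homogeneous d F" and d: "d > 0"
    and flex: "\<And>x z :: complex. eval F (vector [x, 0, z]) = (z - x) ^ d"
  shows "totally_real_series (line_series F)"
proof -
  define l :: "real ^ 3" where "l = vector [0, 1, 0]"
  define p\<^sub>0 :: "complex ^ 3" where "p\<^sub>0 = vector [1, 0, 1]"
  define P where "P = vec.span {p\<^sub>0}"
  have l0: "l \<noteq> 0" by (simp add: l_def vec_eq_iff forall_3)
  have on_l: "on_line l v \<longleftrightarrow> v $ 2 = 0" for v by (simp add: on_line_def l_def sum_3)
  have p0: "p\<^sub>0 \<noteq> 0" by (simp add: p\<^sub>0_def vec_eq_iff forall_3)
  have in_P: "v \<in> P \<longleftrightarrow> v $ 1 = v $ 3 \<and> v $ 2 = 0" for v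
  proof
    assume "v \<in> P"
    then show "v $ 1 = v $ 3 \<and> v $ 2 = 0" by (auto simp: P_def vec_span_singleton p\<^sub>0_def)
  next
    assume "v $ 1 = v $ 3 \<and> v $ 2 = 0"
    then have "v = v $ 1 *s p\<^sub>0" by (intro vec3_eqI) (simp_all add: p\<^sub>0_def)
    then show "v \<in> P" unfolding P_def vec_span_singleton by blast
  qed
  have P_line: "P \<in> proj_plane" using p0 by (auto simp: P_def proj_plane_def)
  have order: "order 0 (restrict_to_line F p q) = (if vec.span {p} = P then d else 0)"
    if p: "p \<noteq> 0" "p $ 2 = 0" and q: "q $ 2 = 0" "q \<notin> vec.span {p}" for p q
  proof -
    have "(\<chi> i. p $ i + t * q $ i) = vector [p $ 1 + t * q $ 1, 0, p $ 3 + t * q $ 3]" for t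
      using p q by (intro vec3_eqI) simp_all
    \<comment> \<open>The restriction is the d-th power of a linear polynomial, so its order at 0 is
      d or 0 according to whether p is the flex.\<close>
    then have r: "restrict_to_line F p q = [:p $ 3 - p $ 1, q $ 3 - q $ 1:] ^ d"
      by (simp add: poly_eq_poly_eq_iff[symmetric] fun_eq_iff poly_restrict_to_line flex algebra_simps)
    show ?thesis
    proof (cases "p $ 1 = p $ 3")
      case True
      then have p1: "p $ 1 \<noteq> 0" using p by (auto simp: vec_eq_iff forall_3)
      have p0p: "p\<^sub>0 = (1 / p $ 1) *s p" using True p p1 by (intro vec3_eqI) (simp_all add: p\<^sub>0_def)
      have "vec.span {p} = P"
      proof
        show "vec.span {p} \<subseteq> P"
          using in_P[of p] True p unfolding P_def by (intro vec.span_minimal vec.subspace_span) simp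
        show "P \<subseteq> vec.span {p}"
          unfolding P_def using p0p
          by (intro vec.span_minimal vec.subspace_span) (auto simp: vec_span_singleton)
      qed
      moreover from this have "q $ 3 - q $ 1 \<noteq> 0" using q in_P[of q] by auto
      moreover have "[:0, q $ 3 - q $ 1:] ^ d = smult ((q $ 3 - q $ 1) ^ d) ([:- 0, 1:] ^ d)"
        by (simp flip: smult_power)
      ultimately show ?thesis
        unfolding r by (simp add: True order_smult order_power_n_n del: minus_zero)
    next
      case False
      then have "vec.span {p} \<noteq> P" using in_P[of p] vec.span_base[of p "{p}"] by auto
      then show ?thesis using False by (simp add: r order_0I)
    qed
  qed
  have mult: "intersection_mult F l Q = (if Q = P then d else 0)" for Q
  proof (cases "Q \<in> proj_plane \<and> (\<forall>v\<in>Q. on_line l v)")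
    case True
    then obtain p where p: "p \<noteq> 0" "Q = vec.span {p}" by (auto simp: proj_plane_def)
    have p2: "p $ 2 = 0" using True p vec.span_base[of p "{p}"] by (auto simp: on_l)
    obtain q where q: "q $ 2 = 0" "q \<notin> Q"
    proof (cases "p $ 1 = 0")
      case True
      then have "vector [1, 0, 0] \<notin> Q"
        by (auto simp: p(2) vec_span_singleton vec_eq_iff forall_3)
      then show ?thesis using that[of "vector [1, 0, 0]"] by simp
    next
      case False
      then have "vector [0, 0, 1] \<notin> Q"
        by (auto simp: p(2) vec_span_singleton vec_eq_iff forall_3)
      then show ?thesis using that[of "vector [0, 0, 1]"] by simp
    qed
    have "intersection_mult F l Q = (SOME m. \<exists>p q. p \<noteq> 0 \<and> Q = vec.span {p} \<and> on_line l q \<and> q \<notin> Q \<and>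
        m = order 0 (restrict_to_line F p q))"
      using True unfolding intersection_mult_def by (subst if_P) auto
    \<comment> \<open>\<open>SOME\<close> is determined here: every admissible pair p, q gives the
      same order.\<close>
    also have "\<dots> = (if Q = P then d else 0)"
    proof (rule some_equality)
      show "\<exists>p q. p \<noteq> 0 \<and> Q = vec.span {p} \<and> on_line l q \<and> q \<notin> Q \<and>
          (if Q = P then d else 0) = order 0 (restrict_to_line F p q)"
        using p p2 q order[of p q] by (intro exI[of _ p] exI[of _ q]) (auto simp: on_l)
    next
      fix m assume "\<exists>p q. p \<noteq> 0 \<and> Q = vec.span {p} \<and> on_line l q \<and> q \<notin> Q \<and>
          m = order 0 (restrict_to_line F p q)"
      then obtain p' q' where p': "p' \<noteq> 0" "Q = vec.span {p'}" "q' $ 2 = 0" "q' \<notin> Q"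
        "m = order 0 (restrict_to_line F p' q')" by (auto simp: on_l)
      moreover have "p' $ 2 = 0" using True p' vec.span_base[of p' "{p'}"] by (auto simp: on_l)
      ultimately show "m = (if Q = P then d else 0)" using order[of p' q'] by simp
    qed
    finally show ?thesis .
  next
    case False
    then have "Q \<noteq> P" using P_line in_P by (auto simp: on_l)
    then show ?thesis using False unfolding intersection_mult_def by (subst if_not_P) auto
  qed
  define D where "D = Poly_Mapping.single P (int d)"
  have keys: "Poly_Mapping.keys D = {P}" using d by (simp add: D_def)
  have conj_P: "conj_point Q = P \<longleftrightarrow> Q = P" for Q
  proof -
    have inv: "conj_point (conj_point Q) = Q" for Q
      by (simp add: conj_point_def image_image)
    have "conj_point P \<subseteq> P" by (auto simp: conj_point_def in_P)
    then have "conj_point P = P" using inv[of P] unfolding conj_point_def by (metis image_mono subset_antisym)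
    then show ?thesis using inv by metis
  qed
  have "eval F v = 0" if "v \<in> P" for v
  proof -
    have "v = vector [v $ 1, 0, v $ 1]" using that by (intro vec3_eqI) (simp_all add: in_P)
    then have "eval F v = (v $ 1 - v $ 1) ^ d" using flex by metis
    then show ?thesis using d by (simp add: power_0_left)
  qed
  then have "P \<in> zero_locus F" using P_line by (simp add: zero_locus_def)
  then have "D \<in> divisors F"
    unfolding divisors_def using keys conj_P by (auto simp: D_def lookup_single when_def)
  moreover have "Poly_Mapping.lookup D Q = int (intersection_mult F l Q)" for Q
    by (simp add: mult D_def lookup_single when_def)
  ultimately have "D \<in> line_series F" using l0 by (auto simp: line_series_def)
  moreover have "effective D" by (simp add: effective_def D_def lookup_single when_def)
  moreover have "real_point P"
    unfolding real_point_def P_def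
    by (intro exI[of _ "vector [1, 0, 1]"] conjI arg_cong[where f = "\<lambda>v. vec.span {v}"])
      (simp_all add: vec_eq_iff forall_3 p\<^sub>0_def)
  then have "totally_real_divisor D" using keys by (simp add: totally_real_divisor_def)
  ultimately show ?thesis by (auto simp: totally_real_series_def)
qed


section \<open>Interpolation at the nodes\<close>

text \<open>Gaussian elimination of one unknown per equation. Arbitrary index types let exponents
  and pairs of node indices serve directly as indices.\<close>

lemma homogeneous_system_solution:
  fixes A :: "'i \<Rightarrow> 'j \<Rightarrow> 'a::field"
  assumes "finite I" "finite J" "card I < card J"
  shows "\<exists>c. (\<exists>j\<in>J. c j \<noteq> 0) \<and> (\<forall>i\<in>I. (\<Sum>j\<in>J. A i j * c j) = 0)"
  using assms
proof (induction I arbitrary: J A)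
  case empty
  then obtain j where "j \<in> J" by (metis card.empty ex_in_conv less_numeral_extra(3))
  then show ?case by (intro exI[of _ "\<lambda>_. 1"]) auto
next
  case (insert i I)
  show ?case
  proof (cases "\<forall>j\<in>J. A i j = 0")
    case True
    obtain c where "\<exists>j\<in>J. c j \<noteq> 0" "\<forall>i\<in>I. (\<Sum>j\<in>J. A i j * c j) = 0"
      using insert.IH[of J A] insert.prems insert.hyps by auto
    then show ?thesis using True by (intro exI[of _ c]) auto
  next
    case False
    then obtain j0 where j0: "j0 \<in> J" "A i j0 \<noteq> 0" by blast
    let ?J = "J - {j0}"
    have "card I < card ?J" using insert.prems insert.hyps j0 by simp
    then obtain c where c: "\<exists>j\<in>?J. c j \<noteq> 0"
      "\<forall>i'\<in>I. (\<Sum>j\<in>?J. (A i' j - A i' j0 * A i j / A i j0) * c j) = 0"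
      using insert.IH[of ?J "\<lambda>i' j. A i' j - A i' j0 * A i j / A i j0"] insert.prems by auto
    \<comment> \<open>Up to sign, the value of the pivot unknown that the i-th equation
      dictates.\<close>
    define e where "e = (\<Sum>j\<in>?J. A i j * c j) / A i j0"
    define c' where "c' = c(j0 := - e)"
    have sum: "(\<Sum>j\<in>J. A i' j * c' j) = (\<Sum>j\<in>?J. A i' j * c j) - A i' j0 * e" for i'
    proof -
      have "(\<Sum>j\<in>J. A i' j * c' j) = A i' j0 * c' j0 + (\<Sum>j\<in>?J. A i' j * c' j)"
        using insert.prems(1) j0(1) by (rule sum.remove)
      also have "(\<Sum>j\<in>?J. A i' j * c' j) = (\<Sum>j\<in>?J. A i' j * c j)"
        by (intro sum.cong) (auto simp: c'_def)
      finally show ?thesis by (simp add: c'_def)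
    qed
    have "(\<Sum>j\<in>J. A i j * c' j) = 0" unfolding sum e_def using j0(2) by simp
    moreover have "(\<Sum>j\<in>J. A i' j * c' j) = 0" if "i' \<in> I" for i'
    proof -
      have "(\<Sum>j\<in>?J. (A i' j - A i' j0 * A i j / A i j0) * c j) = (\<Sum>j\<in>?J. A i' j * c j) - A i' j0 * e"
        by (simp add: e_def left_diff_distrib sum_subtractf sum_distrib_left sum_divide_distrib mult.assoc)
      then show ?thesis using c(2) that unfolding sum by simp
    qed
    moreover have "\<exists>j\<in>J. c' j \<noteq> 0" using c(1) by (auto simp: c'_def)
    ultimately show ?thesis by auto
  qed
qed

text \<open>The right-hand side becomes one more column \<open>None\<close>. The enlarged
  homogeneous system has a nontrivial solution; its \<open>None\<close> entry is nonzero as the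
  kernel is trivial, and dividing by it solves the system.\<close>

lemma square_system_solution:
  fixes A :: "'i \<Rightarrow> 'j \<Rightarrow> 'a::field"
  assumes fin: "finite I" "finite J" "card I = card J"
    and kernel: "\<And>c j. (\<forall>i\<in>I. (\<Sum>j\<in>J. A i j * c j) = 0) \<Longrightarrow> j \<in> J \<Longrightarrow> c j = 0"
  shows "\<exists>c. \<forall>i\<in>I. (\<Sum>j\<in>J. A i j * c j) = b i"
proof -
  let ?A = "\<lambda>i. case_option (- b i) (A i)" and ?J = "insert None (Some ` J)"
  have "card I < card ?J" using fin by (simp add: card_image)
  then obtain c where c: "\<exists>j\<in>?J. c j \<noteq> 0" "\<forall>i\<in>I. (\<Sum>j\<in>?J. ?A i j * c j) = 0"
    using homogeneous_system_solution[of I ?J ?A] fin by auto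
  have sum: "(\<Sum>j\<in>?J. ?A i j * c j) = - b i * c None + (\<Sum>j\<in>J. A i j * c (Some j))" for i
    using fin by (simp add: sum.reindex)
  have "c None \<noteq> 0"
  proof
    assume 0: "c None = 0"
    then have "\<forall>i\<in>I. (\<Sum>j\<in>J. A i j * c (Some j)) = 0" using c(2) unfolding sum by simp
    then show False using kernel[of "\<lambda>j. c (Some j)"] c(1) 0 by auto
  qed
  have "(\<Sum>j\<in>J. A i j * (c (Some j) / c None)) = b i" if "i \<in> I" for i
  proof -
    have "(\<Sum>j\<in>J. A i j * c (Some j)) = b i * c None" using c(2) that unfolding sum by auto
    moreover have "(\<Sum>j\<in>J. A i j * (c (Some j) / c None)) = (\<Sum>j\<in>J. A i j * c (Some j)) / c None"
      by (simp add: sum_divide_distrib)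
    ultimately show ?thesis using \<open>c None \<noteq> 0\<close> by simp
  qed
  then show ?thesis by (intro exI[of _ "\<lambda>j. c (Some j) / c None"] ballI)
qed

text \<open>Comparing coefficients first in x and then in z isolates the term m, since the pairs of
  exponents are distinct.\<close>

lemma two_variable_identity:
  fixes c :: "'m \<Rightarrow> complex"
  assumes "finite M" and inj: "inj_on (\<lambda>m. (f m, g m)) M"
    and zero: "\<And>x z. (\<Sum>m\<in>M. c m * x ^ f m * z ^ g m) = 0" and m: "m \<in> M"
  shows "c m = 0"
proof -
  have fin: "finite M" by fact
  have "(\<Sum>k\<in>M. if f k = f m then c k * z ^ g k else 0) = 0" for z
  proof -
    have "(\<Sum>k\<in>M. monom (c k * z ^ g k) (f k)) = 0"
      by (simp add: poly_eq_poly_eq_iff[symmetric] fun_eq_iff poly_sum poly_monom)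
         (use zero[of _ z] in \<open>simp add: ac_simps\<close>)
    then have "coeff (\<Sum>k\<in>M. monom (c k * z ^ g k) (f k)) (f m) = 0" by simp
    then show ?thesis by (simp add: coeff_sum)
  qed
  then have "(\<Sum>k\<in>M. monom (if f k = f m then c k else 0) (g k)) = 0"
    by (simp add: poly_eq_poly_eq_iff[symmetric] fun_eq_iff poly_sum poly_monom if_distrib[where f = "\<lambda>u. u * _"] cong: if_cong)
  then have "coeff (\<Sum>k\<in>M. monom (if f k = f m then c k else 0) (g k)) (g m) = 0" by simp
  then have "(\<Sum>k\<in>M. if g k = g m then (if f k = f m then c k else 0) else 0) = 0"
    by (simp add: coeff_sum)
  moreover have "(\<Sum>k\<in>M. if g k = g m then (if f k = f m then c k else 0) else 0) = (\<Sum>k\<in>M. if k = m then c m else 0)"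
    using inj m by (intro sum.cong) (auto simp: inj_on_def)
  ultimately show ?thesis using m fin by simp
qed

text \<open>A form of degree \<open>d - 3\<close> through all nodes has \<open>(d - 1) (d - 2)\<close> zeros on the rational curve,
  two at each node, but only degree \<open>d (d - 3)\<close> in its parameter.\<close>

lemma adjoint_vanishes_on_curve:
  assumes d: "d \<ge> 3" and K: "homogeneous (d - 3) K"
    and nodes: "\<And>j k. (j, k) \<in> node_indices d \<Longrightarrow> eval K (node d j k) = 0"
  shows "eval K (vector [t ^ d, (-1) ^ d, (t - 1) ^ d] :: complex ^ 3) = 0"
proof -
  have d0: "d > 0" using d by simp
  \<comment> \<open>The line z = x + y with y = -1 and x = t, under the power map.\<close>
  define w :: "complex poly ^ 3" where "w = vector [[:0, 1:] ^ d, [:(-1) ^ d:], [:-1, 1:] ^ d]"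
  define P where "P = msubst (\<lambda>c. [:of_real c :: complex:]) K w"
  have poly_P: "poly P t = eval K (vector [t ^ d, (-1) ^ d, (t - 1) ^ d])" for t
    by (simp add: P_def msubst_def eval_conv_sum poly_sum monom_val_3 w_def)
  have deg: "degree P \<le> d * (d - 3)"
    unfolding P_def msubst_def
  proof (rule degree_sum_le)
    fix m assume m: "m \<in> Poly_Mapping.keys K"
    have lin: "degree (([:a, 1:] ^ d) ^ k) \<le> d * k" for a :: complex and k
      using degree_power_le[of "[:a, 1:]" "d * k"] by (simp flip: power_mult)
    have const: "degree ([:(-1) ^ d :: complex:] ^ k) \<le> d * k" for k
      using degree_power_le[of "[:(-1) ^ d :: complex:]" k] by simp
    have "degree (monom_val w m) \<le> d * Poly_Mapping.lookup m 1 + d * Poly_Mapping.lookup m 2 + d * Poly_Mapping.lookup m 3"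
      unfolding monom_val_3 w_def vector_3
      by (intro order_trans[OF degree_mult_le] add_mono lin const)
    also have "\<dots> = d * (d - 3)" using K m by (auto simp: homogeneous_iff total_degree_3 simp flip: distrib_left)
    finally show "degree ([:of_real (Poly_Mapping.lookup K m):] * monom_val w m) \<le> d * (d - 3)"
      by (intro order_trans[OF degree_mult_le]) simp
  qed simp
  \<comment> \<open>All ordered pairs are used: (j, k) and (d - j, d - k) give the same node at
    different parameters. \<open>\<tau>\<close> is the first coordinate of \<open>node_root\<close>
    once the second is scaled to -1.\<close>
  define I where "I = {(j, k). 0 < j \<and> j < d \<and> 0 < k \<and> k < d \<and> j \<noteq> k}"
  define \<tau> where "\<tau> = (\<lambda>(j, k). chord d k / chord d j)"
  have root: "poly P (\<tau> p) = 0" if pI: "p \<in> I" for p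
  proof -
    obtain j k where p: "p = (j, k)" "0 < j" "j < d" "0 < k" "k < d" "j \<noteq> k"
      using pI by (cases p) (auto simp: I_def)
    obtain j' k' c where s: "(j', k') \<in> node_indices d" "c \<noteq> 0" "node d j k = c *\<^sub>R node d j' k'"
      using node_sorted[OF p(2-6)] .
    have "node d j k = (\<chi> i. c * node d j' k' $ i)" unfolding s(3) by (simp add: vec_eq_iff)
    then have "eval K (node d j k) = 0" by (simp add: eval_scale[OF K] nodes[OF s(1)])
    then have 0: "eval K (power_map d (node_root d j k)) = 0"
      by (simp add: power_map_node_root[OF d0] eval_complexify)
    have cj: "chord d j \<noteq> 0" using p by (simp add: chord_eq_0_iff)
    let ?v = "vector [\<tau> p ^ d, (-1) ^ d, (\<tau> p - 1) ^ d] :: complex ^ 3"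
    have v: "?v = (\<chi> i. (1 / chord d j) ^ d * power_map d (node_root d j k) $ i)"
    proof (rule vec3_eqI)
      have "\<tau> p - 1 = 1 / chord d j * (chord d k - chord d j)" using cj by (simp add: \<tau>_def p(1) field_simps)
      then show "?v $ 3 = (\<chi> i. (1 / chord d j) ^ d * power_map d (node_root d j k) $ i) $ 3"
        by (simp only: vector_3 vec_lambda_beta power_map_nth node_root_nth power_mult_distrib)
      have "- 1 = 1 / chord d j * (- chord d j)" using cj by simp
      then show "?v $ 2 = (\<chi> i. (1 / chord d j) ^ d * power_map d (node_root d j k) $ i) $ 2"
        by (simp only: vector_3 vec_lambda_beta power_map_nth node_root_nth power_mult_distrib)
    qed (simp add: \<tau>_def p(1) node_root_nth power_divide)
    show ?thesis unfolding poly_P v eval_scale[OF K] 0 by simp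
  qed
  have "inj_on \<tau> I"
  proof (rule inj_onI)
    fix p p' assume p: "p \<in> I" "p' \<in> I" "\<tau> p = \<tau> p'"
    obtain j k j' k' where jk: "p = (j, k)" "p' = (j', k')" "0 < j" "j < d" "0 < k" "k < d" "j \<noteq> k"
      "0 < j'" "j' < d" "0 < k'" "k' < d" "j' \<noteq> k'" using p by (auto simp: I_def)
    have "chord d k' * chord d j = chord d k * chord d j'"
      using p(3) jk chord_eq_0_iff[of j d] chord_eq_0_iff[of j' d] by (auto simp: \<tau>_def field_simps)
    then have sim: "(unity_root d k' - 1) * (unity_root d j - 1) = (unity_root d k - 1) * (unity_root d j' - 1)"
      by (simp add: unity_root_chord)
    have units: "unity_root d l \<noteq> 1" if "0 < l" "l < d" for l
      using that d0 by (auto simp: unity_root_eq_1_iff dest: dvd_imp_le)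
    have "unity_root d j' = unity_root d j \<and> unity_root d k' = unity_root d k"
      using sim units jk d0 by (intro unit_circle_similar) (auto simp: unity_root_eq_iff)
    then show "p = p'" using jk d0 by (simp add: unity_root_eq_iff)
  qed
  moreover have "card I = (d - 1) * (d - 2)"
  proof -
    have "I = {0<..<d} \<times> {0<..<d} - (\<lambda>j. (j, j)) ` {0<..<d}" by (auto simp: I_def)
    moreover have "card ((\<lambda>j. (j, j)) ` {0<..<d}) = d - 1" by (subst card_image) (auto simp: inj_on_def)
    ultimately have "card I = (d - 1) * (d - 1) - (d - 1)"
      by (simp add: card_Diff_subset image_subset_iff card_cartesian_product)
    also have "\<dots> = (d - 1) * (d - 2)" using d by (simp add: diff_mult_distrib2 numeral_2_eq_2)
    finally show ?thesis .
  qed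
  \<comment> \<open>The two sides differ by exactly 2, whatever d is.\<close>
  moreover have "d * (d - 3) < (d - 1) * (d - 2)"
  proof -
    obtain e where "d = e + 3" using d by (metis add.commute le_Suc_ex)
    then show ?thesis by (simp add: algebra_simps)
  qed
  moreover have "card (\<tau> ` I) \<le> degree P" if "P \<noteq> 0"
    using root that by (intro order_trans[OF card_mono card_poly_roots_bound] poly_roots_finite) auto
  ultimately have "P = 0" using deg by (metis card_image leD order_trans)
  then show ?thesis using poly_P[of t] by simp
qed

text \<open>For generic t, the line with x : y = t^d : (-1)^d meets the curve in the d points with
  third coordinate (a t - 1)^d, one for each root of unity a. These are too many for degree d - 3,
  so K vanishes on generic lines of this pencil and hence everywhere.\<close>

lemma adjoint_zero:
  assumes d: "d \<ge> 3" and K: "homogeneous (d - 3) K"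
    and nodes: "\<And>j k. (j, k) \<in> node_indices d \<Longrightarrow> eval K (node d j k) = 0"
  shows "K = 0"
proof -
  let ?U = "unity_roots d"
  have d0: "d > 0" using d by simp
  have finU: "finite ?U" using d0 by simp
  \<comment> \<open>Two values (a t - 1)^d and (b t - 1)^d agree only if a t - 1 = c (b t - 1) for a
    root of unity c; solving for t gives finitely many exceptions.\<close>
  define bad where "bad = insert 0 ((\<lambda>(a, b, c). (1 - c) / (a - c * b)) ` (?U \<times> ?U \<times> ?U))"
  have fin_bad: "finite bad" using finU by (simp add: bad_def)
  have vanish: "eval K (vector [t ^ d, (-1) ^ d, z] :: complex ^ 3) = 0" if t: "t \<notin> bad" for t z
  proof -
    let ?p = "vector [t ^ d, (-1) ^ d, 0] :: complex ^ 3" and ?q = "vector [0, 0, 1] :: complex ^ 3"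
    define P where "P = restrict_to_line K ?p ?q"
    have poly_P: "poly P z = eval K (vector [t ^ d, (-1) ^ d, z])" for z
      unfolding P_def poly_restrict_to_line by (intro arg_cong[where f = "eval K"] vec3_eqI) simp_all
    have roots: "poly P ((a * t - 1) ^ d) = 0" if "a \<in> ?U" for a
      using adjoint_vanishes_on_curve[OF d K nodes, of "a * t"] that
      by (simp add: poly_P power_mult_distrib)
    have "inj_on (\<lambda>a. (a * t - 1) ^ d) ?U"
    proof (rule inj_onI)
      fix a b assume ab: "a \<in> ?U" "b \<in> ?U" "(a * t - 1) ^ d = (b * t - 1) ^ d"
      obtain c where c: "c \<in> ?U" "a * t - 1 = c * (b * t - 1)"
      proof (cases "b * t - 1 = 0")
        case True
        then have "a * t - 1 = 0" using ab(3) d0 by (simp add: power_0_left)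
        then show ?thesis using True that[of 1] by simp
      next
        case False
        then have "((a * t - 1) / (b * t - 1)) ^ d = 1" using ab(3) by (simp add: power_divide)
        then show ?thesis using False that[of "(a * t - 1) / (b * t - 1)"] by simp
      qed
      then have eq: "(a - c * b) * t = 1 - c" by (simp add: algebra_simps)
      show "a = b"
      proof (cases "a - c * b = 0")
        case True
        then show ?thesis using eq by simp
      next
        case False
        then have "t = (1 - c) / (a - c * b)" using eq by (simp add: field_simps)
        then have "t \<in> bad" using ab c unfolding bad_def by (intro insertI2 image_eqI[of _ _ "(a, b, c)"]) auto
        then show ?thesis using t by blast
      qed
    qed
    then have "card ((\<lambda>a. (a * t - 1) ^ d) ` ?U) = d"
      using d0 by (simp add: card_image card_roots_unity_eq)
    moreover have "card ((\<lambda>a. (a * t - 1) ^ d) ` ?U) \<le> degree P" if "P \<noteq> 0"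
      using roots that by (intro order_trans[OF card_mono card_poly_roots_bound] poly_roots_finite) auto
    moreover have "degree P \<le> d - 3" unfolding P_def using K by (rule degree_restrict_to_line)
    ultimately have "P = 0" using d by fastforce
    then show ?thesis using poly_P[of z] by simp
  qed
  have all: "eval K (vector [x, (-1) ^ d, z] :: complex ^ 3) = 0" for x z
  proof -
    let ?p = "vector [0, (-1) ^ d, z] :: complex ^ 3" and ?q = "vector [1, 0, 0] :: complex ^ 3"
    define P where "P = restrict_to_line K ?p ?q"
    have poly_P: "poly P x = eval K (vector [x, (-1) ^ d, z])" for x
      unfolding P_def poly_restrict_to_line by (intro arg_cong[where f = "eval K"] vec3_eqI) simp_all
    have "P = 0"
    proof (rule ccontr)
      assume "P \<noteq> 0"
      then have "finite {x. poly P x = 0}" by (rule poly_roots_finite)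
      moreover have "x \<in> {x. poly P x = 0}" if "x \<notin> (\<lambda>t. t ^ d) ` bad" for x
      proof -
        obtain t where "t ^ d = x" using complex_nth_root[OF d0] by blast
        then show ?thesis using vanish[of t z] that by (auto simp: poly_P)
      qed
      then have "UNIV \<subseteq> {x. poly P x = 0} \<union> (\<lambda>t. t ^ d) ` bad" by blast
      ultimately have "finite (UNIV :: complex set)" using fin_bad by (metis finite_UnI finite_imageI finite_subset)
      then show False using infinite_UNIV_char_0 by blast
    qed
    then show ?thesis using poly_P[of x] by simp
  qed
  \<comment> \<open>Fixing y loses nothing: in a given degree the exponent of y is determined by the
    other two.\<close>
  have "of_real (Poly_Mapping.lookup K m) * ((-1) ^ d) ^ Poly_Mapping.lookup m 2 = (0 :: complex)"
    if m: "m \<in> Poly_Mapping.keys K" for m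
  proof (rule two_variable_identity[where f = "\<lambda>m. Poly_Mapping.lookup m 1" and g = "\<lambda>m. Poly_Mapping.lookup m 3"
        and c = "\<lambda>m. of_real (Poly_Mapping.lookup K m) * ((-1) ^ d) ^ Poly_Mapping.lookup m 2" and M = "Poly_Mapping.keys K"])
    show "inj_on (\<lambda>m. (Poly_Mapping.lookup m 1, Poly_Mapping.lookup m 3)) (Poly_Mapping.keys K)"
    proof (rule inj_onI)
      fix m m' assume "m \<in> Poly_Mapping.keys K" "m' \<in> Poly_Mapping.keys K"
        and eq: "(Poly_Mapping.lookup m 1, Poly_Mapping.lookup m 3) = (Poly_Mapping.lookup m' 1, Poly_Mapping.lookup m' 3)"
      then have "total_degree m = total_degree m'" using K by (auto simp: homogeneous_iff)
      then show "m = m'" using eq by (intro exponent_eqI) (simp_all add: total_degree_3)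
    qed
    show "(\<Sum>m\<in>Poly_Mapping.keys K. of_real (Poly_Mapping.lookup K m) * ((-1) ^ d) ^ Poly_Mapping.lookup m 2 *
        x ^ Poly_Mapping.lookup m 1 * z ^ Poly_Mapping.lookup m 3) = 0" for x z :: complex
      using all[of x z] by (simp add: eval_conv_sum monom_val_3 ac_simps)
  qed (use m in simp_all)
  then have "Poly_Mapping.lookup K m = 0" for m by (cases "m \<in> Poly_Mapping.keys K") (auto simp: in_keys_iff)
  then show "K = 0" by (intro poly_mapping_eqI) simp
qed

lemma node_interpolation:
  assumes d: "d \<ge> 3"
  obtains h where "homogeneous d h" "\<And>v :: complex ^ 3. v $ 2 = 0 \<Longrightarrow> eval h v = 0"
    "\<And>j k. (j, k) \<in> node_indices d \<Longrightarrow> eval h (node d j k) = \<beta> j k"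
proof -
  let ?J = "exponents (d - 3)"
  define b where "b = (\<lambda>(j, k). \<beta> j k / (node d j k $ 1 * node d j k $ 2 * node d j k $ 3))"
  define form where "form c = (\<Sum>m\<in>?J. Poly_Mapping.single m (c m))" for c :: "(3 \<Rightarrow>\<^sub>0 nat) \<Rightarrow> real"
  have hom: "homogeneous (d - 3) (form c)" for c
    unfolding form_def by (intro homogeneous_sum homogeneous_single) (simp add: exponents_def)
  have eval_form: "eval (form c) v = (\<Sum>m\<in>?J. monom_val v m * c m)" for c and v :: "real ^ 3"
    by (simp add: form_def eval_sum eval_single mult.commute)
  have "\<exists>c. \<forall>p\<in>node_indices d. (\<Sum>m\<in>?J. monom_val (node d (fst p) (snd p)) m * c m) = b p"
  proof (rule square_system_solution)
    have "2 * card ?J = (d - 2) * (d - 1)"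
    proof -
      obtain e where "d = e + 3" using d by (metis add.commute le_Suc_ex)
      then show ?thesis using card_exponents[of "d - 3"] by (simp add: algebra_simps)
    qed
    then show "card (node_indices d) = card ?J" by (simp add: card_node_indices mult.commute)
    fix c m assume c: "\<forall>p\<in>node_indices d. (\<Sum>m\<in>?J. monom_val (node d (fst p) (snd p)) m * c m) = 0" and m: "m \<in> ?J"
    have "form c = 0" using c by (intro adjoint_zero[OF d hom]) (auto simp: eval_form)
    then have "Poly_Mapping.lookup (form c) m = 0" by simp
    then show "c m = 0" using m by (simp add: form_def lookup_sum lookup_single when_def)
  qed simp_all
  then obtain c where c: "\<And>p. p \<in> node_indices d \<Longrightarrow> eval (form c) (node d (fst p) (snd p)) = b p"
    by (auto simp: eval_form)
  \<comment> \<open>The factor y preserves the hyperflex; x and z fill up the degree. None of the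
    three vanishes at a node.\<close>
  define h where "h = Poly_Mapping.single (exponent3 1 1 1) 1 * form c"
  have eval_h: "eval h v = v $ 1 * v $ 2 * v $ 3 * eval (form c) v" for v :: "'a::real_field ^ 3"
    by (simp add: h_def eval_mult eval_single monom_val_3)
  have "total_degree (exponent3 1 1 1) = 3" by (simp add: total_degree_3)
  then have "homogeneous (3 + (d - 3)) h"
    unfolding h_def by (intro homogeneous_mult homogeneous_single hom)
  moreover have "eval h (node d j k) = \<beta> j k" if jk: "(j, k) \<in> node_indices d" for j k
  proof -
    have "node d j k $ i \<noteq> 0" for i using jk by (intro node_nonzero) (auto simp: node_indices_def)
    then show ?thesis using c[OF jk] by (simp add: eval_h b_def)
  qed
  ultimately show ?thesis using that[of h] d by (simp add: eval_h)
qed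


section \<open>Counting branches\<close>

text \<open>A finite partition into closed sets has open members, so a component cannot leave the
  member that it meets.\<close>

lemma connected_components_of_closed_partition:
  assumes "finite \<C>" and Union: "\<Union>\<C> = topspace X"
    and conn: "\<And>C. C \<in> \<C> \<Longrightarrow> connectedin X C" and closed: "\<And>C. C \<in> \<C> \<Longrightarrow> closedin X C"
    and nonempty: "{} \<notin> \<C>" and disjoint: "pairwise disjnt \<C>"
  shows "connected_components_of X = \<C>"
proof -
  have open_C: "openin X C" if C: "C \<in> \<C>" for C
  proof -
    have "closedin X (\<Union>(\<C> - {C}))" using assms(1) closed by (intro closedin_Union) auto
    moreover have "topspace X - \<Union>(\<C> - {C}) = C"
      using disjoint C unfolding Union[symmetric] pairwise_def disjnt_def by blast
    ultimately show ?thesis by (metis openin_diff openin_topspace)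
  qed
  have eq: "K = C" if K: "K \<in> connected_components_of X" and C: "C \<in> \<C>" and meet: "\<not> disjnt K C" for K C
  proof
    show "K \<subseteq> C"
      using connectedin_clopen_cases[OF connectedin_connected_components_of[OF K] closed[OF C] open_C[OF C]] meet by blast
    show "C \<subseteq> K" using connected_components_of_maximal[OF K conn[OF C]] meet by blast
  qed
  show ?thesis
  proof (intro equalityI subsetI)
    fix K assume K: "K \<in> connected_components_of X"
    then obtain x where "x \<in> K" using nonempty_connected_components_of by blast
    moreover have "x \<in> \<Union>\<C>" using connected_components_of_subset[OF K] Union \<open>x \<in> K\<close> by blast
    ultimately show "K \<in> \<C>" using eq[OF K] by (metis UnionE disjnt_iff)
  next
    fix C assume C: "C \<in> \<C>"
    then obtain x where x: "x \<in> C" using nonempty by (metis ex_in_conv)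
    have "x \<in> topspace X" unfolding Union[symmetric] using C x by (rule UnionI)
    then obtain K where K: "K \<in> connected_components_of X" "x \<in> K"
      unfolding Union_connected_components_of[symmetric] by (rule UnionE)
    have "K = C" using x K(2) by (intro eq[OF K(1) C]) (auto simp: disjnt_iff)
    then show "C \<in> connected_components_of X" using K(1) by simp
  qed
qed

section \<open>Compact and connected sets in the real projective plane\<close>

abbreviation proj_point :: "real ^ 3 \<Rightarrow> (real ^ 3) set" where
  "proj_point v \<equiv> vec.span {v}"

lemma proj_point_eq_iff:
  assumes "v \<noteq> 0" "w \<noteq> 0"
  shows "proj_point v = proj_point w \<longleftrightarrow> (\<exists>c. c \<noteq> 0 \<and> v = c *\<^sub>R w)"
proof
  assume "proj_point v = proj_point w"
  then have "v \<in> proj_point w" using vec.span_base[of v "{v}"] by simp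
  then obtain c where "v = c *s w" by (auto simp: vec.span_singleton)
  then show "\<exists>c. c \<noteq> 0 \<and> v = c *\<^sub>R w" using assms by (auto simp: scalar_mult_eq_scaleR)
next
  assume "\<exists>c. c \<noteq> 0 \<and> v = c *\<^sub>R w"
  then obtain c where c: "c \<noteq> 0" "v = c *s w" by (auto simp: scalar_mult_eq_scaleR)
  then have "w = (1 / c) *s v" by simp
  then have "w \<in> proj_point v" unfolding vec.span_singleton by blast
  moreover have "v \<in> proj_point w" using c unfolding vec.span_singleton by blast
  ultimately show "proj_point v = proj_point w"
    by (intro equalityI vec.span_minimal vec.subspace_span) auto
qed

text \<open>Closedness in the quotient is tested on the preimage, the double cone over W without its
  apex. \<open>conic hull\<close> allows only nonnegative factors, hence the second hull over -
  W.\<close>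

lemma closedin_RP2_compact_image:
  assumes W: "compact W" "0 \<notin> W"
  shows "closedin RP2 (proj_point ` W)"
proof -
  let ?C = "conic hull W \<union> conic hull (uminus ` W)"
  have "closed (conic hull W)" "closed (conic hull (uminus ` W))"
    using W by (intro closed_conic_hull disjI2 conjI compact_negations; force)+
  then have "closed ?C" by (rule closed_Un)
  moreover have "{v \<in> - {0}. proj_point v \<in> proj_point ` W} = - {0} \<inter> ?C"
  proof (intro equalityI subsetI)
    fix v assume "v \<in> {v \<in> - {0}. proj_point v \<in> proj_point ` W}"
    then obtain w where w: "v \<noteq> 0" "w \<in> W" "proj_point v = proj_point w" by auto
    then obtain c where c: "c \<noteq> 0" "v = c *\<^sub>R w" using proj_point_eq_iff[of v w] W(2) by auto
    have "v \<in> ?C"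
    proof (cases "c > 0")
      case True
      then have "v \<in> conic hull W" using w c unfolding conic_hull_explicit by (auto intro!: exI[of _ c])
      then show ?thesis ..
    next
      case False
      then have "v \<in> conic hull (uminus ` W)" using w c unfolding conic_hull_explicit
        by (intro CollectI exI[of _ "- c"] exI[of _ "- w"]) auto
      then show ?thesis ..
    qed
    then show "v \<in> - {0} \<inter> ?C" using w by simp
  next
    fix v assume v: "v \<in> - {0} \<inter> ?C"
    have "\<exists>c w. w \<in> W \<and> v = c *\<^sub>R w"
    proof (cases "v \<in> conic hull W")
      case True
      then show ?thesis unfolding conic_hull_explicit by blast
    next
      case False
      then have "v \<in> conic hull (uminus ` W)" using v by blast
      then obtain c w where "w \<in> W" "v = c *\<^sub>R (- w)" unfolding conic_hull_explicit by blast
      then show ?thesis by (intro exI[of _ "- c"] exI[of _ w]) simp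
    qed
    then obtain c w where w: "w \<in> W" "v = c *\<^sub>R w" by blast
    then have "c \<noteq> 0" using v by auto
    then have "proj_point v = proj_point w" using w v W(2) proj_point_eq_iff[of v w] by auto
    then show "v \<in> {v \<in> - {0}. proj_point v \<in> proj_point ` W}" using v w by auto
  qed
  ultimately have "closedin (top_of_set (- {0})) {v \<in> - {0}. proj_point v \<in> proj_point ` W}"
    by (simp add: closedin_closed_Int)
  moreover have "proj_point ` W \<subseteq> topspace RP2" using W(2) by (auto simp: topspace_RP2 proj_plane_def)
  ultimately show ?thesis
    using quotient_map_closedin[of "top_of_set (- {0})" RP2 proj_point] quotient_map_RP2 by auto
qed

lemma connectedin_RP2_image:
  assumes W: "connected W" "0 \<notin> W"
  shows "connectedin RP2 (proj_point ` W)"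
proof (rule connectedin_continuous_map_image)
  show "continuous_map (top_of_set (- {0})) RP2 proj_point"
    using quotient_map_RP2 by (rule quotient_imp_continuous_map)
  show "connectedin (top_of_set (- {0})) W" using W by (auto simp: connectedin_subtopology)
qed

lemma continuous_on_vec3:
  fixes f :: "'t::topological_space \<Rightarrow> 'a::topological_space ^ 3"
  assumes "continuous_on S (\<lambda>x. f x $ 1)" "continuous_on S (\<lambda>x. f x $ 2)" "continuous_on S (\<lambda>x. f x $ 3)"
  shows "continuous_on S f"
proof -
  have "continuous_on S (\<lambda>x. f x $ i)" for i using assms exhaust_3[of i] by auto
  then have "continuous_on S (\<lambda>x. \<chi> i. f x $ i)" by (rule continuous_on_vec_lambda)
  then show ?thesis by simp
qed

text \<open>Parameters \<open>(\<theta>, r)\<close> of a closed family of arcs: in the applications the end points \<open>0\<close>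
  and \<open>2 * pi\<close> give the same projective points.\<close>

definition arc_box :: "real \<Rightarrow> real \<Rightarrow> (real \<times> real) set" where
  "arc_box \<alpha> \<rho> = {0..2 * pi} \<times> {\<alpha>..\<rho>}"

lemma compact_arc_box [simp]: "compact (arc_box \<alpha> \<rho>)"
  unfolding arc_box_def by (intro compact_Times compact_Icc)

text \<open>Strict monotonicity in r and the sign change at the ends make the zero set a graph over
  the interval of angles.\<close>

lemma graph_zero_set:
  assumes cont: "continuous_on (arc_box \<alpha> \<rho>) \<psi>" and le: "\<alpha> \<le> \<rho>"
    and incr: "\<And>\<theta> r r'. \<theta> \<in> {0..2 * pi} \<Longrightarrow> \<alpha> \<le> r \<Longrightarrow> r < r' \<Longrightarrow> r' \<le> \<rho> \<Longrightarrow> \<psi> (\<theta>, r) < (\<psi> (\<theta>, r') :: real)"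
    and ends: "\<And>\<theta>. \<theta> \<in> {0..2 * pi} \<Longrightarrow> \<psi> (\<theta>, \<alpha>) < 0 \<and> 0 < \<psi> (\<theta>, \<rho>)"
  defines "Z \<equiv> {p \<in> arc_box \<alpha> \<rho>. \<psi> p = 0}"
  shows "compact Z" "connected Z" "Z \<noteq> {}"
proof -
  have "closed Z" unfolding Z_def
    using cont by (intro continuous_closed_preimage_constant) (auto intro: compact_imp_closed)
  then have "compact (arc_box \<alpha> \<rho> \<inter> Z)" by (intro compact_Int_closed) auto
  then show Z: "compact Z" by (simp add: Z_def Int_absorb1 Collect_conj_eq)
  have inj: "inj_on fst Z"
  proof (rule inj_onI)
    fix p q assume pq: "p \<in> Z" "q \<in> Z" "fst p = fst q"
    obtain \<theta> r r' where *: "p = (\<theta>, r)" "q = (\<theta>, r')" using pq(3) by (metis prod.collapse)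
    have "\<not> r < r'" "\<not> r' < r"
      using pq incr[of \<theta> r r'] incr[of \<theta> r' r] by (auto simp: * Z_def arc_box_def)
    then show "p = q" using * by simp
  qed
  have onto: "fst ` Z = {0..2 * pi}"
  proof
    show "fst ` Z \<subseteq> {0..2 * pi}" by (auto simp: Z_def arc_box_def)
    show "{0..2 * pi} \<subseteq> fst ` Z"
    proof
      fix \<theta> assume \<theta>: "\<theta> \<in> {0..2 * pi}"
      have "continuous_on {\<alpha>..\<rho>} (\<lambda>r. \<psi> (\<theta>, r))"
        using \<theta> by (intro continuous_on_compose2[OF cont] continuous_intros) (auto simp: arc_box_def)
      then obtain r where "r \<in> {\<alpha>..\<rho>}" "\<psi> (\<theta>, r) = 0"
        using IVT'[of "\<lambda>r. \<psi> (\<theta>, r)" \<alpha> 0 \<rho>] ends[OF \<theta>] le by (auto simp: less_imp_le)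
      then show "\<theta> \<in> fst ` Z" using \<theta> by (intro image_eqI[of _ _ "(\<theta>, r)"]) (auto simp: Z_def arc_box_def)
    qed
  qed
  \<comment> \<open>A continuous bijection from a compact set is a homeomorphism; this replaces the
    continuous dependence of the solution r on \<theta>.\<close>
  obtain g where g: "homeomorphism Z {0..2 * pi} fst g"
    using homeomorphism_compact[OF Z continuous_on_fst[OF continuous_on_id] onto inj] by blast
  then have "g ` {0..2 * pi} = Z" "continuous_on {0..2 * pi} g" by (auto simp: homeomorphism_def)
  then show "connected Z" using connected_continuous_image[of "{0..2 * pi}" g] connected_Icc by metis
  show "Z \<noteq> {}" using onto by auto
qed

text \<open>The images of the zero sets form a finite closed partition of the curve into connected
  sets. Injectivity of \<open>f i\<close> is not asked for: opposite parameters on the circle, or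
  all angles at the centre of a polar box, give the same projective point.\<close>

lemma card_branches:
  fixes f :: "'i \<Rightarrow> real \<times> real \<Rightarrow> real ^ 3"
  assumes F: "homogeneous d F" and fin: "finite I" and J: "J \<subseteq> I"
    and cont: "\<And>i. i \<in> I \<Longrightarrow> continuous_on (B i) (f i)"
    and nonzero: "\<And>i p. i \<in> I \<Longrightarrow> p \<in> B i \<Longrightarrow> f i p \<noteq> 0"
    and disjoint: "\<And>i i' p p'. i \<in> I \<Longrightarrow> i' \<in> I \<Longrightarrow> i \<noteq> i' \<Longrightarrow> p \<in> B i \<Longrightarrow> p' \<in> B i' \<Longrightarrow>
        proj_point (f i p) \<noteq> proj_point (f i' p')"
    and cover: "\<And>v. v \<noteq> 0 \<Longrightarrow> eval F v = 0 \<Longrightarrow> \<exists>i\<in>I. \<exists>p\<in>B i. proj_point v = proj_point (f i p)"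
    and zeros: "\<And>i. i \<in> J \<Longrightarrow> compact {p \<in> B i. eval F (f i p) = 0} \<and>
        connected {p \<in> B i. eval F (f i p) = 0} \<and> {p \<in> B i. eval F (f i p) = 0} \<noteq> {}"
    and empty: "\<And>i p. i \<in> I - J \<Longrightarrow> p \<in> B i \<Longrightarrow> eval F (f i p) \<noteq> 0"
  shows "card (branches F) = card J"
proof -
  define Z where "Z i = {p \<in> B i. eval F (f i p) = 0}" for i
  define K where "K i = proj_point ` (f i ` Z i)" for i
  have scale: "eval F (c *\<^sub>R v) = c ^ d * eval F v" for c and v :: "real ^ 3"
    using eval_scale[OF F, of c v] by (simp add: scaleR_vec_def)
  have locus: "proj_point v \<in> zero_locus F \<longleftrightarrow> eval F v = 0" if "v \<noteq> 0" for v
  proof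
    assume "proj_point v \<in> zero_locus F"
    then show "eval F v = 0" using vec.span_base[of v "{v}"] by (auto simp: zero_locus_def)
  next
    assume 0: "eval F v = 0"
    have "eval F u = 0" if u: "u \<in> proj_point v" for u
    proof -
      obtain c where "u = c *s v" using u unfolding vec.span_singleton by blast
      then have "u = c *\<^sub>R v" by (simp add: scalar_mult_eq_scaleR)
      then show ?thesis by (simp add: scale 0)
    qed
    then show "proj_point v \<in> zero_locus F"
      using that by (auto simp: zero_locus_def proj_plane_def)
  qed
  have KZ: "0 \<notin> f i ` Z i" if "i \<in> J" for i using nonzero that J by (auto simp: Z_def)
  have K_sub: "K i \<subseteq> zero_locus F" if "i \<in> J" for i
    using locus nonzero that J by (auto simp: K_def Z_def)
  have compact_fZ: "compact (f i ` Z i)" and connected_fZ: "connected (f i ` Z i)" if i: "i \<in> J" for i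
  proof -
    have "continuous_on (Z i) (f i)" using cont[of i] i J by (auto simp: Z_def intro: continuous_on_subset)
    then show "compact (f i ` Z i)" "connected (f i ` Z i)"
      using zeros[OF i] by (auto simp: Z_def intro: compact_continuous_image connected_continuous_image)
  qed
  have ne: "K i \<noteq> {}" if "i \<in> J" for i using zeros[OF that] by (auto simp: K_def Z_def)
  have dis: "disjnt (K i) (K i')" if "i \<in> J" "i' \<in> J" "i \<noteq> i'" for i i'
  proof (rule ccontr)
    assume "\<not> disjnt (K i) (K i')"
    then obtain p p' where "p \<in> Z i" "p' \<in> Z i'" "proj_point (f i p) = proj_point (f i' p')"
      by (auto simp: K_def disjnt_iff simp del: split_paired_All)
    then show False using disjoint[of i i' p p'] that J by (auto simp: Z_def)
  qed
  have inj: "inj_on K J"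
  proof (rule inj_onI, rule ccontr)
    fix i i' assume "i \<in> J" "i' \<in> J" "K i = K i'" "i \<noteq> i'"
    then show False using dis[of i i'] ne[of i] by (simp add: disjnt_def)
  qed
  have top: "topspace (subtopology RP2 (zero_locus F)) = zero_locus F"
    by (auto simp: topspace_RP2 zero_locus_def)
  have "connected_components_of (subtopology RP2 (zero_locus F)) = K ` J"
  proof (rule connected_components_of_closed_partition)
    show "finite (K ` J)" using fin J finite_subset by blast
    show "\<Union>(K ` J) = topspace (subtopology RP2 (zero_locus F))"
      unfolding top
    proof
      show "\<Union>(K ` J) \<subseteq> zero_locus F" using K_sub by blast
      show "zero_locus F \<subseteq> \<Union>(K ` J)"
      proof
        fix P assume P: "P \<in> (zero_locus F :: (real ^ 3) set set)"
        then obtain v where v: "v \<noteq> 0" "P = proj_point v" by (auto simp: zero_locus_def proj_plane_def)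
        then have "eval F v = 0" using P locus by blast
        then obtain i p where ip: "i \<in> I" "p \<in> B i" "proj_point v = proj_point (f i p)"
          using cover[OF v(1)] by blast
        then have "eval F (f i p) = 0" using P v locus nonzero by metis
        moreover from this have "i \<in> J" using empty ip by blast
        ultimately show "P \<in> \<Union>(K ` J)" using ip v by (auto simp: K_def Z_def)
      qed
    qed
    show "connectedin (subtopology RP2 (zero_locus F)) C" if "C \<in> K ` J" for C
      using that K_sub connectedin_RP2_image connected_fZ KZ by (auto simp: connectedin_subtopology K_def)
    show "closedin (subtopology RP2 (zero_locus F)) C" if C: "C \<in> K ` J" for C
    proof -
      obtain i where i: "i \<in> J" "C = K i" using C by blast
      then have "closedin RP2 C" using closedin_RP2_compact_image[OF compact_fZ KZ] by (simp add: K_def)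
      then show ?thesis using K_sub[OF i(1)] i(2) by (metis closedin_subset_topspace)
    qed
    show "{} \<notin> K ` J" using ne by auto
    show "pairwise disjnt (K ` J)" using dis by (auto simp: pairwise_def)
  qed
  then show ?thesis by (simp add: branches_def card_image[OF inj])
qed

text \<open>On the compact set where g is not positive, s attains a minimum, which is positive; half
  of it serves as \<rho>. In the applications s measures the distance from the core of a
  box.\<close>

lemma positive_near_core:
  fixes g s :: "'a::t2_space \<Rightarrow> real"
  assumes K: "compact K" and g: "continuous_on K g" and s: "continuous_on K s"
    and pos: "\<And>x. x \<in> K \<Longrightarrow> s x \<le> 0 \<Longrightarrow> g x > 0"
  shows "\<exists>\<rho>>0. \<forall>x\<in>K. s x \<le> \<rho> \<longrightarrow> g x > 0"
proof (cases "{x \<in> K. g x \<le> 0} = {}")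
  case True
  then show ?thesis by (intro exI[of _ 1]) force
next
  case False
  have "closed {x \<in> K. g x \<le> 0}"
    using continuous_closed_preimage[OF g compact_imp_closed[OF K] closed_atMost[of 0]]
    by (simp add: vimage_def Collect_conj_eq Int_commute)
  then have "compact (K \<inter> {x \<in> K. g x \<le> 0})" using K by (rule compact_Int_closed[rotated])
  then have "compact {x \<in> K. g x \<le> 0}" by (simp add: Int_absorb1 Collect_conj_eq)
  moreover have "continuous_on {x \<in> K. g x \<le> 0} s" using s by (rule continuous_on_subset) auto
  ultimately have "\<exists>x\<in>{x \<in> K. g x \<le> 0}. \<forall>y\<in>{x \<in> K. g x \<le> 0}. s x \<le> s y"
    using False by (intro continuous_attains_inf)
  then obtain x0 where x0: "x0 \<in> K" "g x0 \<le> 0" "\<And>x. x \<in> K \<Longrightarrow> g x \<le> 0 \<Longrightarrow> s x0 \<le> s x"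
    by blast
  have "s x0 > 0" using pos[of x0] x0 by force
  then show ?thesis using x0 by (intro exI[of _ "s x0 / 2"]) force
qed

lemma eventually_positive_perturbation:
  fixes g0 g1 :: "'a::topological_space \<Rightarrow> real"
  assumes K: "compact K" and g: "continuous_on K g0" "continuous_on K g1" and pos: "\<And>x. x \<in> K \<Longrightarrow> g0 x > 0"
  shows "\<forall>\<^sub>F \<epsilon> in at_right 0. \<forall>x\<in>K. g0 x + \<epsilon> * g1 x > 0"
proof (cases "K = {}")
  case False
  obtain x0 where x0: "x0 \<in> K" "\<And>x. x \<in> K \<Longrightarrow> g0 x0 \<le> g0 x"
    using continuous_attains_inf[OF K False g(1)] by blast
  obtain x1 where x1: "\<And>x. x \<in> K \<Longrightarrow> \<bar>g1 x\<bar> \<le> \<bar>g1 x1\<bar>"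
    using continuous_attains_sup[OF K False continuous_on_rabs[OF g(2)]] by blast
  \<comment> \<open>The summand 1 keeps the quotient meaningful if g1 vanishes on K.\<close>
  let ?m = "g0 x0 / (\<bar>g1 x1\<bar> + 1)"
  have m: "?m > 0" using pos[OF x0(1)] by simp
  have "\<forall>\<^sub>F \<epsilon> in at_right 0. \<epsilon> < ?m" using m eventually_at_right_field by blast
  moreover have "\<forall>\<^sub>F \<epsilon> in at_right (0 :: real). \<epsilon> > 0" by (rule eventually_at_right_less)
  ultimately show ?thesis
  proof eventually_elim
    case (elim \<epsilon>)
    show ?case
    proof
      fix x assume x: "x \<in> K"
      have "\<epsilon> * (\<bar>g1 x1\<bar> + 1) < g0 x0" using elim by (simp add: field_simps)
      moreover have "- (\<epsilon> * g1 x) \<le> \<epsilon> * (\<bar>g1 x1\<bar> + 1)"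
        using x1[OF x] elim by (subst minus_mult_right, intro mult_left_mono) auto
      ultimately show "g0 x + \<epsilon> * g1 x > 0" using x0(2)[OF x] by simp
    qed
  qed
qed simp


section \<open>Perturbation near a node\<close>

text \<open>Polar coordinates in the root coordinates: scaling by real factors near 1 keeps the
  \<open>conj_factor\<close> of \<open>node_root\<close>, so that the two lines through the node
  stay conjugate along the arcs.\<close>

definition node_scale :: "real \<times> real \<Rightarrow> real ^ 3" where
  "node_scale p = vector [1 + snd p * cos (fst p), 1 + snd p * sin (fst p), 1]"

definition node_arc :: "nat \<Rightarrow> nat \<Rightarrow> nat \<Rightarrow> real \<times> real \<Rightarrow> real ^ 3" where
  "node_arc d j k p = (\<chi> i. node d j k $ i * node_scale p $ i ^ d)"

lemma node_scale_nth [simp]: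
  "node_scale p $ 1 = 1 + snd p * cos (fst p)" "node_scale p $ 2 = 1 + snd p * sin (fst p)" "node_scale p $ 3 = 1"
  by (simp_all add: node_scale_def)

lemma continuous_on_node_scale: "continuous_on S node_scale"
  by (rule continuous_on_vec3) (simp_all, (intro continuous_intros)+)

lemma continuous_on_node_arc: "continuous_on S (node_arc d j k)"
  unfolding node_arc_def
  by (intro continuous_on_vec_lambda continuous_intros continuous_on_node_scale)

lemma node_arc_core: "node_arc d j k (\<theta>, 0) = node d j k"
proof -
  have "node_scale (\<theta>, 0) $ i = 1" for i using exhaust_3[of i] by auto
  then show ?thesis by (simp add: node_arc_def vec_eq_iff)
qed

definition node_arc_root :: "nat \<Rightarrow> nat \<Rightarrow> nat \<Rightarrow> real \<times> real \<Rightarrow> complex ^ 3" where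
  "node_arc_root d j k p = (\<chi> i. node_root d j k $ i * of_real (node_scale p $ i))"

lemma complexify_node_arc: "d > 0 \<Longrightarrow> complexify (node_arc d j k p) = power_map d (node_arc_root d j k p)"
  by (simp add: vec_eq_iff node_arc_def node_arc_root_def power_mult_distrib node_root_power)

text \<open>Along an arc the line through the node is linear in r; this is the squared modulus of
  its slope.\<close>

definition node_width :: "nat \<Rightarrow> nat \<Rightarrow> nat \<Rightarrow> real \<Rightarrow> real" where
  "node_width d j k \<theta> = (cmod (node_root d j k $ 1 * of_real (cos \<theta>) + node_root d j k $ 2 * of_real (sin \<theta>)))\<^sup>2"

definition node_cofactor :: "nat \<Rightarrow> nat \<Rightarrow> nat \<Rightarrow> real \<times> real \<Rightarrow> complex" where
  "node_cofactor d j k p = unity_root d (j + k) * cofactor d j k (node_arc_root d j k p)"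

text \<open>A zero would also solve the conjugate equation. The conjugation factors of the first two
  coordinates differ, so the equations are independent and cos = sin = 0.\<close>

lemma node_width_pos:
  assumes "0 < j" "j < d" "0 < k" "k < d" "j \<noteq> k"
  shows "node_width d j k \<theta> > 0"
proof -
  have d: "d > 0" using assms by simp
  let ?u = "node_root d j k" and ?c = "of_real (cos \<theta>) :: complex" and ?s = "of_real (sin \<theta>) :: complex"
  have "?u $ 1 * ?c + ?u $ 2 * ?s \<noteq> 0"
  proof
    assume 0: "?u $ 1 * ?c + ?u $ 2 * ?s = 0"
    then have "cnj (?u $ 1 * ?c + ?u $ 2 * ?s) = 0" by simp
    then have "conj_factor d j k $ 1 * (?u $ 1 * ?c) + conj_factor d j k $ 2 * (?u $ 2 * ?s) = 0"
      by (simp add: cnj_node_root[OF d] mult.assoc)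
    moreover have "?u $ 2 * ?s = - (?u $ 1 * ?c)" using 0 by (simp add: eq_neg_iff_add_eq_0 add.commute)
    ultimately have "(conj_factor d j k $ 1 - conj_factor d j k $ 2) * (?u $ 1 * ?c) = 0"
      by (simp add: left_diff_distrib)
    moreover have "conj_factor d j k $ 1 \<noteq> conj_factor d j k $ 2"
      using assms d by (simp add: conj_factor_nth unity_root_eq_iff)
    ultimately have c0: "cos \<theta> = 0" using node_root_nonzero[OF assms, of 1] by simp
    then have "sin \<theta> = 0" using 0 node_root_nonzero[OF assms, of 2] by simp
    then show False using c0 sin_cos_squared_add[of \<theta>] by simp
  qed
  then show ?thesis by (simp add: node_width_def)
qed

text \<open>In the root coordinates, the two branches at a node are complex conjugate, so that their
  product is a squared modulus.\<close>

lemma eval_node_arc: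
  assumes jk: "0 < j" "j < d"
  shows "of_real (eval (harnack_form d) (node_arc d j k (\<theta>, r))) =
    of_real (r\<^sup>2 * node_width d j k \<theta>) * node_cofactor d j k (\<theta>, r)"
proof -
  have d: "d > 0" using jk by simp
  let ?Y = "node_arc_root d j k (\<theta>, r)" and ?L = "line_val (1, 1) (node_arc_root d j k (\<theta>, r))"
  have cnjY: "cnj (?Y $ i) = conj_factor d j k $ i * ?Y $ i" for i
    by (simp add: node_arc_root_def cnj_node_root[OF d])
  have L2: "line_val (unity_root d j, unity_root d k) ?Y = unity_root d (j + k) * cnj ?L"
  proof -
    have u: "cnj (unity_root d j) * unity_root d j = 1" "cnj (unity_root d k) * unity_root d k = 1"
      by (rule cnj_unity_root_mult[OF d])+
    have "unity_root d (j + k) * cnj ?L =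
        (cnj (unity_root d j) * unity_root d j) * (cnj (unity_root d k) * unity_root d k) * ?Y $ 3
        - (cnj (unity_root d k) * unity_root d k) * unity_root d j * ?Y $ 1
        - (cnj (unity_root d j) * unity_root d j) * unity_root d k * ?Y $ 2"
      by (simp add: line_val_def cnjY conj_factor_nth unity_root_add right_diff_distrib ac_simps)
    then show ?thesis unfolding u by (simp add: line_val_def)
  qed
  have "?L = - (of_real r * (node_root d j k $ 1 * of_real (cos \<theta>) + node_root d j k $ 2 * of_real (sin \<theta>)))"
    using node_on_lines(1)[of d j k] by (simp add: line_val_def node_arc_root_def algebra_simps)
  then have "(cmod ?L)\<^sup>2 = r\<^sup>2 * node_width d j k \<theta>"
    by (simp add: norm_mult power_mult_distrib node_width_def)
  then have L: "?L * cnj ?L = of_real (r\<^sup>2 * node_width d j k \<theta>)"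
    by (simp add: complex_norm_square[symmetric] flip: of_real_power)
  have "of_real (eval (harnack_form d) (node_arc d j k (\<theta>, r))) = eval (harnack_form d) (power_map d ?Y)"
    by (simp only: eval_complexify[symmetric] complexify_node_arc[OF d])
  also have "\<dots> = (?L * cnj ?L) * (unity_root d (j + k) * cofactor d j k ?Y)"
    unfolding harnack_form_factors[OF jk, of _ k] L2 by (simp add: ac_simps)
  finally show ?thesis unfolding L node_cofactor_def .
qed

text \<open>The sign of the form near its solitary zero \<open>node d j k\<close>.\<close>

definition node_sign :: "nat \<Rightarrow> nat \<Rightarrow> nat \<Rightarrow> real" where
  "node_sign d j k = Re (unity_root d (j + k) * cofactor d j k (node_root d j k))"

section \<open>Sign and derivatives along the arcs at a node\<close>

lemma continuous_on_cofactor [continuous_intros]: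
  "continuous_on S f \<Longrightarrow> continuous_on S (\<lambda>x. cofactor d j k (f x))"
  unfolding cofactor_def line_val_def by (intro continuous_intros)

lemma continuous_on_cofactor_deriv [continuous_intros]:
  "continuous_on S f \<Longrightarrow> continuous_on S e \<Longrightarrow> continuous_on S (\<lambda>x. cofactor_deriv d j k (e x) (f x))"
  unfolding cofactor_deriv_def line_val_def by (intro continuous_intros)

lemma continuous_on_node_arc_root [continuous_intros]: "continuous_on S (node_arc_root d j k)"
  unfolding node_arc_root_def
  by (intro continuous_on_vec_lambda continuous_intros continuous_on_node_scale)

lemma continuous_on_node_cofactor: "continuous_on S (node_cofactor d j k)"
  unfolding node_cofactor_def by (intro continuous_intros)

lemma node_arc_root_core: "node_arc_root d j k (\<theta>, 0) = node_root d j k"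
proof -
  have "node_scale (\<theta>, 0) $ i = 1" for i using exhaust_3[of i] by auto
  then show ?thesis by (simp add: node_arc_root_def vec_eq_iff)
qed

lemma Re_node_cofactor_core: "Re (node_cofactor d j k (\<theta>, 0)) = node_sign d j k"
  by (simp add: node_cofactor_def node_arc_root_core node_sign_def)

text \<open>The cofactor is nonzero as a complex number, so it remains to see that it is real at r =
  0. For r > 0 it is a quotient of real numbers by \<open>eval_node_arc\<close>; at r = 0 this
  equation is void, and a limit is taken.\<close>

lemma node_sign_nonzero:
  assumes jk: "0 < j" "j < d" "0 < k" "k < d" "j \<noteq> k"
  shows "node_sign d j k \<noteq> 0"
proof -
  let ?t = "\<lambda>r. node_cofactor d j k (0, r)"
  have "Im (?t r) = 0" if "r > 0" for r
  proof -
    let ?c = "r\<^sup>2 * node_width d j k 0"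
    have "?c \<noteq> 0" using that node_width_pos[OF jk, of 0] by simp
    moreover have "Im (of_real ?c * ?t r) = 0"
      by (simp only: eval_node_arc[OF jk(1,2), symmetric] Im_complex_of_real)
    ultimately show ?thesis by simp
  qed
  then have "\<forall>\<^sub>F r in at_right 0. Im (?t r) = 0" by (intro eventually_at_right_less[THEN eventually_mono]) auto
  moreover have "continuous_on UNIV ?t"
    by (intro continuous_on_compose2[OF continuous_on_node_cofactor[of UNIV]] continuous_intros) auto
  then have "((\<lambda>r. Im (?t r)) \<longlongrightarrow> Im (?t 0)) (at_right 0)"
    by (intro tendsto_intros) (auto simp: continuous_on_def intro: tendsto_within_subset)
  ultimately have "Im (?t 0) = 0"
    using tendsto_unique[OF _ tendsto_eventually, of "at_right 0" "\<lambda>r. Im (?t r)" 0 "Im (?t 0)"] by auto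
  moreover have "?t 0 \<noteq> 0"
    using cofactor_node_root[OF jk] by (simp add: node_cofactor_def node_arc_root_core)
  ultimately show ?thesis unfolding Re_node_cofactor_core[of d j k 0, symmetric] by (auto simp: complex_eq_iff)
qed

lemma has_real_derivative_Re:
  assumes "(f has_field_derivative D) (at (of_real r))"
  shows "((\<lambda>r. Re (c * f (of_real r))) has_real_derivative Re (c * D)) (at r)"
proof -
  have "((\<lambda>z. c * f z) has_field_derivative c * D) (at (of_real r))" by (intro DERIV_cmult assms)
  then have "((\<lambda>r. c * f (of_real r)) has_vector_derivative c * D) (at r)"
    by (rule has_vector_derivative_real_field)
  then have "((\<lambda>r. Re (c * f (of_real r))) has_vector_derivative Re (c * D)) (at r)"
    by (rule bounded_linear.has_vector_derivative[OF bounded_linear_Re])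
  then show ?thesis by (simp add: has_real_derivative_iff_has_vector_derivative)
qed

text \<open>The root coordinates are affine in r, so this is a directional derivative of
  \<open>cofactor\<close>. Continuity in both parameters is what the compactness argument for the
  oval needs.\<close>

lemma node_cofactor_deriv:
  obtains T' where "continuous_on UNIV T'"
    "\<And>\<theta> r. ((\<lambda>r. Re (node_cofactor d j k (\<theta>, r))) has_real_derivative T' (\<theta>, r)) (at r)"
proof -
  define e :: "real \<Rightarrow> complex ^ 3" where
    "e \<theta> = vector [node_root d j k $ 1 * of_real (cos \<theta>), node_root d j k $ 2 * of_real (sin \<theta>), 0]" for \<theta>
  have e_cont: "continuous_on UNIV (\<lambda>p :: real \<times> real. e (fst p))"
    unfolding e_def by (rule continuous_on_vec3) (simp_all, (intro continuous_intros)+)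
  have root: "node_arc_root d j k (\<theta>, r) = (\<chi> i. node_root d j k $ i + of_real r * e \<theta> $ i)" for \<theta> r
    by (rule vec3_eqI) (simp_all add: node_arc_root_def e_def algebra_simps)
  define T' where "T' p = Re (unity_root d (j + k) * cofactor_deriv d j k (e (fst p)) (node_arc_root d j k p))" for p
  show ?thesis
  proof
    show "continuous_on UNIV T'" unfolding T'_def by (intro continuous_intros e_cont)
    show "((\<lambda>r. Re (node_cofactor d j k (\<theta>, r))) has_real_derivative T' (\<theta>, r)) (at r)" for \<theta> r
      unfolding node_cofactor_def T'_def root fst_conv
      by (rule has_real_derivative_Re[OF cofactor_DERIV[of d j k "node_root d j k" "e \<theta>" "of_real r"]])
  qed
qed

lemma eval_node_arc_deriv:
  obtains H' where "continuous_on UNIV H'"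
    "\<And>\<theta> r. ((\<lambda>r. eval h (node_arc d j k (\<theta>, r))) has_real_derivative H' (\<theta>, r)) (at r)"
proof -
  define e :: "real \<times> real \<Rightarrow> real ^ 3" where "e p = vector [cos (fst p), sin (fst p), 0]" for p
  have e_cont: "continuous_on UNIV e"
    unfolding e_def by (rule continuous_on_vec3) (simp_all, (intro continuous_intros)+)
  define g where "g p = (\<chi> i. node d j k $ i * (of_nat d * node_scale p $ i ^ (d - 1) * e p $ i))" for p
  define H' where "H' p = (\<Sum>i\<in>UNIV. eval (partial i h) (node_arc d j k p) * g p $ i)" for p
  show ?thesis
  proof
    show "continuous_on UNIV H'" unfolding H'_def g_def vec_lambda_beta
      by (intro continuous_intros continuous_on_node_arc continuous_on_node_scale e_cont)
    fix \<theta> r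
    have s: "((\<lambda>r. node_scale (\<theta>, r) $ i) has_real_derivative e (\<theta>, r) $ i) (at r)" for i
    proof -
      have "((\<lambda>r. node_scale (\<theta>, r) $ 1) has_real_derivative e (\<theta>, r) $ 1) (at r)"
        "((\<lambda>r. node_scale (\<theta>, r) $ 2) has_real_derivative e (\<theta>, r) $ 2) (at r)"
        "((\<lambda>r. node_scale (\<theta>, r) $ 3) has_real_derivative e (\<theta>, r) $ 3) (at r)"
        by (auto simp: e_def intro!: derivative_eq_intros)
      then show ?thesis using exhaust_3[of i] by auto
    qed
    have "((\<lambda>r. node_arc d j k (\<theta>, r) $ i) has_real_derivative g (\<theta>, r) $ i) (at r)" for i
      unfolding node_arc_def g_def vec_lambda_beta
      using DERIV_cmult[OF DERIV_power[OF s, of i d], of "node d j k $ i"] by (simp add: ac_simps)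
    from eval_DERIV[OF this, of h]
    show "((\<lambda>r. eval h (node_arc d j k (\<theta>, r))) has_real_derivative H' (\<theta>, r)) (at r)"
      by (simp add: H'_def)
  qed
qed

lemma node_arc_nonzero:
  assumes "0 < j" "j < d" "0 < k" "k < d" "j \<noteq> k"
  shows "node_arc d j k p \<noteq> 0"
proof -
  have "node_arc d j k p $ 3 \<noteq> 0" using node_nonzero[OF assms, of 3] by (simp add: node_arc_def)
  then show ?thesis by auto
qed

text \<open>The perturbed curve is the level set - R / h = \<epsilon>. With opposite signs of h and
  R this quotient grows like r^2 from 0, strictly along every ray, so each angle carries exactly one
  zero.\<close>

lemma node_oval:
  assumes jk: "0 < j" "j < d" "0 < k" "k < d" "j \<noteq> k"
    and sign: "eval h (node d j k) * node_sign d j k < 0"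
  obtains \<rho>\<^sub>0 where "\<rho>\<^sub>0 > 0" "\<And>\<rho>. 0 < \<rho> \<Longrightarrow> \<rho> \<le> \<rho>\<^sub>0 \<Longrightarrow> \<forall>\<^sub>F \<epsilon> in at_right 0.
    let Z = {p \<in> arc_box 0 \<rho>. eval (perturbed (harnack_form d) h \<epsilon>) (node_arc d j k p) = 0}
    in compact Z \<and> connected Z \<and> Z \<noteq> {}"
proof -
  let ?R = "\<lambda>p. eval (harnack_form d) (node_arc d j k p)" and ?q = "node_width d j k"
  define T where "T p = Re (node_cofactor d j k p)" for p
  define H where "H p = eval h (node_arc d j k p)" for p
  let ?b = "eval h (node d j k)"
  obtain T' where T': "continuous_on UNIV T'" "\<And>\<theta> r. ((\<lambda>r. T (\<theta>, r)) has_real_derivative T' (\<theta>, r)) (at r)"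
    using node_cofactor_deriv[of d j k] unfolding T_def by blast
  obtain H' where H': "continuous_on UNIV H'" "\<And>\<theta> r. ((\<lambda>r. H (\<theta>, r)) has_real_derivative H' (\<theta>, r)) (at r)"
    using eval_node_arc_deriv[of h d j k] unfolding H_def by blast
  have contT: "continuous_on S T" for S unfolding T_def by (intro continuous_intros continuous_on_node_cofactor)
  have contH: "continuous_on S H" for S unfolding H_def by (intro continuous_intros continuous_on_node_arc)
  have contR: "continuous_on S ?R" for S by (intro continuous_intros continuous_on_node_arc)
  note contT' = continuous_on_subset[OF T'(1) subset_UNIV] and contH' = continuous_on_subset[OF H'(1) subset_UNIV]
  have R: "?R (\<theta>, r) = r\<^sup>2 * ?q \<theta> * T (\<theta>, r)" for \<theta> r
  proof -
    have "Re (of_real (?R (\<theta>, r))) = Re (of_real (r\<^sup>2 * ?q \<theta>) * node_cofactor d j k (\<theta>, r))"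
      by (simp only: eval_node_arc[OF jk(1,2)])
    then show ?thesis by (simp add: T_def)
  qed
  \<comment> \<open>The numerator of the r-derivative of R / h, divided by r times the width.
    Without the factor r it stays away from 0 at the centre, where it equals 2 T H.\<close>
  define M where "M p = (2 * T p + snd p * T' p) * H p - snd p * T p * H' p" for p
  have core: "T (\<theta>, 0) = node_sign d j k" "H (\<theta>, 0) = ?b" for \<theta>
    by (simp_all add: T_def H_def Re_node_cofactor_core node_arc_core)
  have b0: "?b \<noteq> 0" using sign by auto
  have contM: "continuous_on (arc_box 0 1) (\<lambda>p. - M p)"
    unfolding M_def by (intro continuous_intros contT contH contT' contH')
  have posM: "- M p > 0" if "p \<in> arc_box 0 1" "snd p \<le> 0" for p
    using that sign by (cases p) (auto simp: arc_box_def M_def core mult.commute)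
  obtain \<rho>1 where \<rho>1: "\<rho>1 > 0" "\<And>p. p \<in> arc_box 0 1 \<Longrightarrow> snd p \<le> \<rho>1 \<Longrightarrow> - M p > 0"
    using positive_near_core[OF compact_arc_box contM continuous_on_snd[OF continuous_on_id] posM] by blast
  have contHb: "continuous_on (arc_box 0 1) (\<lambda>p. H p * ?b)" by (intro continuous_intros contH)
  have posH: "H p * ?b > 0" if "p \<in> arc_box 0 1" "snd p \<le> 0" for p
    using that b0 by (cases p) (auto simp: arc_box_def core zero_less_mult_iff linorder_neq_iff)
  obtain \<rho>2 where \<rho>2: "\<rho>2 > 0" "\<And>p. p \<in> arc_box 0 1 \<Longrightarrow> snd p \<le> \<rho>2 \<Longrightarrow> H p * ?b > 0"
    using positive_near_core[OF compact_arc_box contHb continuous_on_snd[OF continuous_on_id] posH] by blast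
  define \<rho>\<^sub>0 where "\<rho>\<^sub>0 = Min {1, \<rho>1, \<rho>2}"
  show ?thesis
  proof
    show "\<rho>\<^sub>0 > 0" using \<rho>1 \<rho>2 by (simp add: \<rho>\<^sub>0_def)
    fix \<rho> assume \<rho>: "0 < \<rho>" "\<rho> \<le> \<rho>\<^sub>0"
    have box: "H (\<theta>, r) \<noteq> 0" "M (\<theta>, r) < 0" if "\<theta> \<in> {0..2 * pi}" "0 \<le> r" "r \<le> \<rho>" for \<theta> r
      using \<rho>1(2)[of "(\<theta>, r)"] \<rho>2(2)[of "(\<theta>, r)"] that \<rho> by (auto simp: arc_box_def \<rho>\<^sub>0_def)
    define G where "G p = - (?R p / H p)" for p
    have contG: "continuous_on (arc_box 0 \<rho>) G"
      unfolding G_def by (intro continuous_intros contR contH) (auto simp: arc_box_def box)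
    have incr: "G (\<theta>, r) < G (\<theta>, r')" if \<theta>: "\<theta> \<in> {0..2 * pi}" and r: "0 \<le> r" "r < r'" "r' \<le> \<rho>" for \<theta> r r'
    \<comment> \<open>The derivative vanishes at r = 0, so positivity is available only on the open
      interval.\<close>
    proof (rule DERIV_pos_imp_increasing_open[OF r(2)])
      show "continuous_on {r..r'} (\<lambda>r. G (\<theta>, r))"
        using \<theta> r by (intro continuous_on_compose2[OF contG] continuous_intros) (auto simp: arc_box_def)
      fix x assume x: "r < x" "x < r'"
      have H0: "H (\<theta>, x) \<noteq> 0" and M0: "M (\<theta>, x) < 0" using box[of \<theta> x] \<theta> x r by auto
      have "((\<lambda>r. G (\<theta>, r)) has_real_derivative
          - (((2 * x * ?q \<theta> * T (\<theta>, x) + x\<^sup>2 * ?q \<theta> * T' (\<theta>, x)) * H (\<theta>, x) - x\<^sup>2 * ?q \<theta> * T (\<theta>, x) * H' (\<theta>, x)) / (H (\<theta>, x) * H (\<theta>, x)))) (at x)"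
        unfolding G_def R using H0
        by (auto intro!: derivative_eq_intros T'(2) H'(2) simp: power2_eq_square algebra_simps)
      moreover have "(2 * x * ?q \<theta> * T (\<theta>, x) + x\<^sup>2 * ?q \<theta> * T' (\<theta>, x)) * H (\<theta>, x) - x\<^sup>2 * ?q \<theta> * T (\<theta>, x) * H' (\<theta>, x)
          = x * ?q \<theta> * M (\<theta>, x)"
        by (simp add: M_def power2_eq_square algebra_simps)
      moreover have "x * ?q \<theta> * M (\<theta>, x) < 0"
        using x r M0 node_width_pos[OF jk, of \<theta>] by (simp add: mult_pos_neg)
      moreover have "H (\<theta>, x) * H (\<theta>, x) > 0" using H0 by (auto simp: zero_less_mult_iff linorder_neq_iff)
      ultimately show "\<exists>y. ((\<lambda>r. G (\<theta>, r)) has_real_derivative y) (at x) \<and> 0 < y"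
        by (metis divide_neg_pos neg_0_less_iff_less)
    qed
    have G0: "G (\<theta>, 0) = 0" for \<theta> by (simp add: G_def R)
    have Gpos: "G (\<theta>, \<rho>) > 0" if "\<theta> \<in> {0..2 * pi}" for \<theta> using incr[OF that, of 0 \<rho>] \<rho> by (simp add: G0)
    have "continuous_on {0..2 * pi} (\<lambda>\<theta>. G (\<theta>, \<rho>))"
      using \<rho> by (intro continuous_on_compose2[OF contG] continuous_intros) (auto simp: arc_box_def)
    then have "\<forall>\<^sub>F \<epsilon> in at_right 0. \<forall>\<theta>\<in>{0..2 * pi}. G (\<theta>, \<rho>) + \<epsilon> * (- 1) > 0"
      using Gpos by (intro eventually_positive_perturbation compact_Icc continuous_intros) auto
    moreover have "\<forall>\<^sub>F \<epsilon> in at_right (0 :: real). \<epsilon> > 0" by (rule eventually_at_right_less)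
    ultimately show "\<forall>\<^sub>F \<epsilon> in at_right 0.
      let Z = {p \<in> arc_box 0 \<rho>. eval (perturbed (harnack_form d) h \<epsilon>) (node_arc d j k p) = 0}
      in compact Z \<and> connected Z \<and> Z \<noteq> {}"
    proof eventually_elim
      case (elim \<epsilon>)
      have "eval (perturbed (harnack_form d) h \<epsilon>) (node_arc d j k p) = 0 \<longleftrightarrow> G p - \<epsilon> = 0" if p: "p \<in> arc_box 0 \<rho>" for p
      proof -
        have "H p \<noteq> 0" using p box[of "fst p" "snd p"] by (cases p) (auto simp: arc_box_def)
        then show ?thesis by (auto simp: eval_perturbed G_def H_def[symmetric] field_simps)
      qed
      then have Z: "{p \<in> arc_box 0 \<rho>. eval (perturbed (harnack_form d) h \<epsilon>) (node_arc d j k p) = 0} =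
          {p \<in> arc_box 0 \<rho>. G p - \<epsilon> = 0}" by auto
      have "compact {p \<in> arc_box 0 \<rho>. G p - \<epsilon> = 0}" "connected {p \<in> arc_box 0 \<rho>. G p - \<epsilon> = 0}"
        "{p \<in> arc_box 0 \<rho>. G p - \<epsilon> = 0} \<noteq> {}"
        by (rule graph_zero_set; use \<rho> elim incr in \<open>auto simp: G0 intro!: continuous_intros contG\<close>)+
      then show ?case unfolding Z Let_def by blast
    qed
  qed
qed

text \<open>With equal signs, multiplying F by h gives a nonnegative term plus \<epsilon> h^2 > 0;
  here \<epsilon> need not be small.\<close>

lemma node_no_zero:
  assumes jk: "0 < j" "j < d" "0 < k" "k < d" "j \<noteq> k"
    and sign: "eval h (node d j k) * node_sign d j k > 0"
  obtains \<rho>\<^sub>0 where "\<rho>\<^sub>0 > 0" "\<And>\<rho> \<epsilon> p. \<rho> \<le> \<rho>\<^sub>0 \<Longrightarrow> \<epsilon> > 0 \<Longrightarrow> p \<in> arc_box 0 \<rho> \<Longrightarrow>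
    eval (perturbed (harnack_form d) h \<epsilon>) (node_arc d j k p) \<noteq> 0"
proof -
  let ?g = "\<lambda>p. eval h (node_arc d j k p) * Re (node_cofactor d j k p)"
  have cont: "continuous_on (arc_box 0 1) ?g"
    by (intro continuous_intros continuous_on_node_arc continuous_on_node_cofactor)
  have pos: "?g p > 0" if "p \<in> arc_box 0 1" "snd p \<le> 0" for p
    using that sign by (cases p) (auto simp: arc_box_def node_arc_core Re_node_cofactor_core)
  obtain \<rho>1 where \<rho>1: "\<rho>1 > 0" "\<And>p. p \<in> arc_box 0 1 \<Longrightarrow> snd p \<le> \<rho>1 \<Longrightarrow> ?g p > 0"
    using positive_near_core[OF compact_arc_box cont continuous_on_snd[OF continuous_on_id] pos] by blast
  show ?thesis
  proof
    show "min 1 \<rho>1 > 0" using \<rho>1 by simp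
    fix \<rho> \<epsilon> :: real and p assume *: "\<rho> \<le> min 1 \<rho>1" "\<epsilon> > 0" "p \<in> arc_box 0 \<rho>"
    obtain \<theta> r where p: "p = (\<theta>, r)" by (cases p)
    let ?H = "eval h (node_arc d j k p)" and ?T = "Re (node_cofactor d j k p)"
    have pos': "?H * ?T > 0" using \<rho>1(2)[of p] * by (auto simp: p arc_box_def)
    have "eval (harnack_form d) (node_arc d j k p) = r\<^sup>2 * node_width d j k \<theta> * ?T"
    proof -
      have "Re (of_real (eval (harnack_form d) (node_arc d j k p))) = Re (of_real (r\<^sup>2 * node_width d j k \<theta>) * node_cofactor d j k p)"
        unfolding p by (simp only: eval_node_arc[OF jk(1,2)])
      then show ?thesis by simp
    qed
    then have "?H * eval (perturbed (harnack_form d) h \<epsilon>) (node_arc d j k p) =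
        r\<^sup>2 * node_width d j k \<theta> * (?H * ?T) + \<epsilon> * (?H * ?H)"
      by (simp add: eval_perturbed algebra_simps)
    also have "\<dots> > 0"
    proof (rule add_nonneg_pos)
      have "0 \<le> r\<^sup>2 * node_width d j k \<theta>" using node_width_pos[OF jk, of \<theta>] by simp
      then show "0 \<le> r\<^sup>2 * node_width d j k \<theta> * (?H * ?T)" using less_imp_le[OF pos'] by (rule mult_nonneg_nonneg)
      have "?H \<noteq> 0" using pos' by auto
      then show "0 < \<epsilon> * (?H * ?H)" using *(2) by (auto simp: zero_less_mult_iff linorder_neq_iff)
    qed
    finally show "eval (perturbed (harnack_form d) h \<epsilon>) (node_arc d j k p) \<noteq> 0" by auto
  qed
qed

section \<open>The arcs at a node fill a neighbourhood\<close>

lemma polar_coordinates: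
  fixes x y :: real
  obtains \<theta> where "0 \<le> \<theta>" "\<theta> \<le> 2 * pi" "x = sqrt (x\<^sup>2 + y\<^sup>2) * cos \<theta>" "y = sqrt (x\<^sup>2 + y\<^sup>2) * sin \<theta>"
proof (cases "x\<^sup>2 + y\<^sup>2 = 0")
  case True
  then have "x = 0" "y = 0" by (simp_all add: sum_power2_eq_zero_iff)
  then show ?thesis using that[of 0] by simp
next
  case False
  let ?r = "sqrt (x\<^sup>2 + y\<^sup>2)"
  have r: "?r \<noteq> 0" "?r\<^sup>2 = x\<^sup>2 + y\<^sup>2" using False by auto
  have "(x / ?r)\<^sup>2 + (y / ?r)\<^sup>2 = 1"
    using False unfolding power_divide r(2) by (simp flip: add_divide_distrib)
  then obtain \<theta> where "0 \<le> \<theta>" "\<theta> \<le> 2 * pi" "x / ?r = cos \<theta>" "y / ?r = sin \<theta>"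
    using sincos_total_2pi_le by blast
  then show ?thesis using r(1) by (intro that[of \<theta>]) (auto simp: field_simps)
qed

text \<open>Coordinate ratios relative to the node are close to 1; their real d-th roots are the
  scale factors, and polar coordinates of the deviations from 1 give the parameters.\<close>

lemma node_neighbourhood:
  assumes jk: "0 < j" "j < d" "0 < k" "k < d" "j \<noteq> k" and c: "c \<noteq> 0" and \<rho>: "\<rho> > 0"
  shows "\<forall>\<^sub>F v in nhds (c *\<^sub>R node d j k). \<exists>p\<in>arc_box 0 \<rho>. proj_point v = proj_point (node_arc d j k p)"
proof -
  let ?n = "node d j k" and ?l = "c *\<^sub>R node d j k"
  have d: "d > 0" using jk by simp
  note n0 = node_nonzero[OF jk]
  \<comment> \<open>Normalized by the third coordinate, since the third entry of
    \<open>node_scale\<close> is 1.\<close>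
  define s where "s i v = v $ i * ?n $ 3 / (v $ 3 * ?n $ i)" for i and v :: "real ^ 3"
  have s_lim: "((\<lambda>v. s i v) \<longlongrightarrow> 1) (nhds ?l)" for i
  proof -
    have "((\<lambda>v. s i v) \<longlongrightarrow> s i ?l) (nhds ?l)"
      unfolding s_def using c n0 by (intro tendsto_intros) (auto simp: filterlim_ident)
    moreover have "s i ?l = 1" using c n0 by (simp add: s_def)
    ultimately show ?thesis by simp
  qed
  define x where "x i v = root d (s i v) - 1" for i v
  have x_lim: "((\<lambda>v. x i v) \<longlongrightarrow> 0) (nhds ?l)" for i
    unfolding x_def using tendsto_diff[OF tendsto_real_root[OF s_lim[of i], of d] tendsto_const[of 1]] d by simp
  have "((\<lambda>v. sqrt ((x 1 v)\<^sup>2 + (x 2 v)\<^sup>2)) \<longlongrightarrow> sqrt (0\<^sup>2 + 0\<^sup>2)) (nhds ?l)"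
    by (intro tendsto_intros x_lim)
  then have "\<forall>\<^sub>F v in nhds ?l. sqrt ((x 1 v)\<^sup>2 + (x 2 v)\<^sup>2) < \<rho>"
    using \<rho> by (intro order_tendstoD(2)) auto
  moreover have "\<forall>\<^sub>F v in nhds ?l. s i v > 0" for i using s_lim[of i] by (rule order_tendstoD(1)) simp
  moreover have "\<forall>\<^sub>F v in nhds ?l. v $ 3 \<noteq> 0"
  proof -
    have "((\<lambda>v. v $ 3) \<longlongrightarrow> ?l $ 3) (nhds ?l)" by (intro tendsto_intros) (simp add: filterlim_ident)
    from tendsto_imp_eventually_ne[OF this, of 0] show ?thesis using c n0[of 3] by simp
  qed
  ultimately have "\<forall>\<^sub>F v in nhds ?l. sqrt ((x 1 v)\<^sup>2 + (x 2 v)\<^sup>2) < \<rho> \<and> s 1 v > 0 \<and> s 2 v > 0 \<and> v $ 3 \<noteq> 0"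
    by (intro eventually_conj) auto
  then show ?thesis
  proof (rule eventually_mono)
    fix v assume v: "sqrt ((x 1 v)\<^sup>2 + (x 2 v)\<^sup>2) < \<rho> \<and> s 1 v > 0 \<and> s 2 v > 0 \<and> v $ 3 \<noteq> 0"
    let ?r = "sqrt ((x 1 v)\<^sup>2 + (x 2 v)\<^sup>2)"
    obtain \<theta> where \<theta>: "0 \<le> \<theta>" "\<theta> \<le> 2 * pi" "x 1 v = ?r * cos \<theta>" "x 2 v = ?r * sin \<theta>"
      by (rule polar_coordinates)
    have pow: "(1 + x i v) ^ d = s i v" if "s i v > 0" for i
      using that d by (simp add: x_def real_root_pow_pos2)
    have "node_arc d j k (\<theta>, ?r) = (?n $ 3 / v $ 3) *\<^sub>R v"
    proof (rule vec3_eqI)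
      show "node_arc d j k (\<theta>, ?r) $ 1 = ((?n $ 3 / v $ 3) *\<^sub>R v) $ 1"
        using v pow[of 1] n0[of 1] \<theta>(3)[symmetric] by (simp add: node_arc_def s_def)
      show "node_arc d j k (\<theta>, ?r) $ 2 = ((?n $ 3 / v $ 3) *\<^sub>R v) $ 2"
        using v pow[of 2] n0[of 2] \<theta>(4)[symmetric] by (simp add: node_arc_def s_def)
      show "node_arc d j k (\<theta>, ?r) $ 3 = ((?n $ 3 / v $ 3) *\<^sub>R v) $ 3"
        using v by (simp add: node_arc_def)
    qed
    then have "proj_point (node_arc d j k (\<theta>, ?r)) = proj_point v"
      using v n0[of 3] node_arc_nonzero[OF jk] by (subst proj_point_eq_iff) (auto intro!: exI[of _ "?n $ 3 / v $ 3"])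
    moreover have "(\<theta>, ?r) \<in> arc_box 0 \<rho>" using v \<theta> by (simp add: arc_box_def)
    ultimately show "\<exists>p\<in>arc_box 0 \<rho>. proj_point v = proj_point (node_arc d j k p)" by metis
  qed
qed


section \<open>Perturbation near the circle\<close>

definition circle_root_deriv :: "real \<Rightarrow> real ^ 3" where
  "circle_root_deriv \<theta> = vector [- sin \<theta>, cos \<theta>, cos \<theta> - sin \<theta>]"

definition circle_deriv :: "nat \<Rightarrow> real \<Rightarrow> real ^ 3" where
  "circle_deriv d \<theta> = (\<chi> i. of_nat d * circle_root \<theta> $ i ^ (d - 1) * circle_root_deriv \<theta> $ i)"

definition circle_normal :: "nat \<Rightarrow> real \<Rightarrow> real ^ 3" where
  "circle_normal d \<theta> = (\<chi> i. eval (partial i (harnack_form d)) (circle d \<theta>))"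

text \<open>Moving along the gradient makes the derivative of R in the second parameter equal to the
  squared norm of the gradient on the circle.\<close>

definition circle_arc :: "nat \<Rightarrow> real \<times> real \<Rightarrow> real ^ 3" where
  "circle_arc d p = circle d (fst p) + snd p *\<^sub>R circle_normal d (fst p)"

lemma circle_root_deriv_nth [simp]:
  "circle_root_deriv \<theta> $ 1 = - sin \<theta>" "circle_root_deriv \<theta> $ 2 = cos \<theta>" "circle_root_deriv \<theta> $ 3 = cos \<theta> - sin \<theta>"
  by (simp_all add: circle_root_deriv_def)

lemma circle_root_DERIV: "((\<lambda>\<theta>. circle_root \<theta> $ i) has_real_derivative circle_root_deriv \<theta> $ i) (at \<theta>)"
proof -
  have "((\<lambda>\<theta>. circle_root \<theta> $ 1) has_real_derivative circle_root_deriv \<theta> $ 1) (at \<theta>)"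
    "((\<lambda>\<theta>. circle_root \<theta> $ 2) has_real_derivative circle_root_deriv \<theta> $ 2) (at \<theta>)"
    "((\<lambda>\<theta>. circle_root \<theta> $ 3) has_real_derivative circle_root_deriv \<theta> $ 3) (at \<theta>)"
    by (auto intro!: derivative_eq_intros)
  then show ?thesis using exhaust_3[of i] by auto
qed

lemma circle_DERIV: "((\<lambda>\<theta>. circle d \<theta> $ i) has_real_derivative circle_deriv d \<theta> $ i) (at \<theta>)"
  unfolding circle_def circle_deriv_def power_map_nth vec_lambda_beta
  using DERIV_power[OF circle_root_DERIV, of i d \<theta>] by (simp add: ac_simps)

lemma continuous_on_circle [continuous_intros]:
  assumes "continuous_on S f" shows "continuous_on S (\<lambda>x. circle d (f x))"
proof -
  have "continuous_on UNIV (circle d)"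
  proof (rule continuous_on_vec3)
    have "continuous_on UNIV (\<lambda>\<theta>. circle d \<theta> $ i)" for i
      using circle_DERIV[of d i] by (intro continuous_at_imp_continuous_on ballI) (blast intro: DERIV_isCont)
    then show "continuous_on UNIV (\<lambda>\<theta>. circle d \<theta> $ 1)" "continuous_on UNIV (\<lambda>\<theta>. circle d \<theta> $ 2)"
      "continuous_on UNIV (\<lambda>\<theta>. circle d \<theta> $ 3)" by blast+
  qed
  then show ?thesis using assms by (rule continuous_on_compose2) auto
qed

lemma continuous_on_circle_normal [continuous_intros]:
  "continuous_on S f \<Longrightarrow> continuous_on S (\<lambda>x. circle_normal d (f x))"
  unfolding circle_normal_def by (intro continuous_on_vec_lambda continuous_intros)

lemma continuous_on_circle_arc: "continuous_on S (circle_arc d)"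
  unfolding circle_arc_def by (intro continuous_intros)

section \<open>Orthogonal frame along the circle\<close>

lemma inner_vec3: "(v :: real ^ 3) \<bullet> w = (\<Sum>i\<in>UNIV. v $ i * w $ i)"
  by (simp add: inner_vec_def)

text \<open>R vanishes along the ray through a point of the circle and along the circle itself; both
  identities are differentiated.\<close>

lemma circle_normal_orthogonal:
  assumes d: "d > 0"
  shows "circle_normal d \<theta> \<bullet> circle d \<theta> = 0" "circle_normal d \<theta> \<bullet> circle_deriv d \<theta> = 0"
proof -
  let ?R = "harnack_form d"
  have D: "((\<lambda>t. (\<chi> i. (1 + t) * circle d \<theta> $ i) $ i) has_real_derivative circle d \<theta> $ i) (at 0)" for i
    by (auto intro!: derivative_eq_intros)
  have "((\<lambda>t. eval ?R (\<chi> i. (1 + t) * circle d \<theta> $ i)) has_real_derivative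
      (\<Sum>i\<in>UNIV. eval (partial i ?R) (\<chi> i. (1 + 0) * circle d \<theta> $ i) * circle d \<theta> $ i)) (at 0)"
    by (rule eval_DERIV[OF D])
  then have "((\<lambda>t. 0) has_real_derivative
      (\<Sum>i\<in>UNIV. eval (partial i ?R) (\<chi> i. (1 + 0) * circle d \<theta> $ i) * circle d \<theta> $ i)) (at 0)"
    by (simp only: eval_scale[OF homogeneous_harnack_form[OF d]] circle_zero[OF d] mult_zero_right)
  from DERIV_unique[OF this DERIV_const] show "circle_normal d \<theta> \<bullet> circle d \<theta> = 0" by (simp add: inner_vec3 circle_normal_def)
  have "((\<lambda>t. eval ?R (circle d t)) has_real_derivative
      (\<Sum>i\<in>UNIV. eval (partial i ?R) (circle d \<theta>) * circle_deriv d \<theta> $ i)) (at \<theta>)"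
    by (rule eval_DERIV[OF circle_DERIV])
  then have "((\<lambda>t. 0) has_real_derivative
      (\<Sum>i\<in>UNIV. eval (partial i ?R) (circle d \<theta>) * circle_deriv d \<theta> $ i)) (at \<theta>)"
    by (simp only: circle_zero[OF d])
  from DERIV_unique[OF this DERIV_const] show "circle_normal d \<theta> \<bullet> circle_deriv d \<theta> = 0" by (simp add: inner_vec3 circle_normal_def)
qed

text \<open>Singular points are nodes, and the circle passes through none of them.\<close>

lemma circle_normal_nonzero:
  assumes d: "d > 0"
  shows "circle_normal d \<theta> \<noteq> 0"
proof
  assume "circle_normal d \<theta> = 0"
  then have 0: "eval (partial i (harnack_form d)) (circle d \<theta>) = 0" for i
    by (simp add: circle_normal_def vec_eq_iff)
  have "complexify (circle d \<theta>) \<noteq> 0" using circle_nonzero[of d \<theta>] by (simp add: vec_eq_iff)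
  moreover have "eval (harnack_form d) (complexify (circle d \<theta>)) = 0"
    using circle_zero[OF d] by (simp add: eval_complexify)
  moreover have "eval (partial i (harnack_form d)) (complexify (circle d \<theta>)) = 0" for i
    by (simp add: eval_complexify 0)
  ultimately obtain j k c where jk: "(j, k) \<in> node_indices d"
    and eq: "complexify (circle d \<theta>) = (\<chi> i. c * of_real (node d j k $ i))"
    using singular_point_node[OF d] by metis
  have ci: "of_real (circle d \<theta> $ i) = c * of_real (node d j k $ i)" for i
    using eq by (metis complexify_nth vec_lambda_beta)
  define e where "e = circle d \<theta> $ 1 / node d j k $ 1"
  have "node d j k $ 1 \<noteq> 0" using jk by (intro node_nonzero) (auto simp: node_indices_def)
  then have "c = of_real e" using ci[of 1] by (simp add: e_def field_simps)
  then have "of_real (circle d \<theta> $ i) = (of_real (e * node d j k $ i) :: complex)" for i using ci[of i] by simp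
  then have "circle d \<theta> $ i = e * node d j k $ i" for i by (simp only: of_real_eq_iff)
  then have "circle d \<theta> = e *\<^sub>R node d j k" by (simp add: vec_eq_iff)
  then show False using circle_not_node[OF jk] by blast
qed

text \<open>The circle is immersed in the projective plane: its derivative is not parallel to its
  position. A zero coordinate yields no condition on the root, but at most one of cos, sin, cos +
  sin vanishes, and two coordinates suffice.\<close>

lemma circle_tangent_nonzero:
  assumes d: "d > 0"
  shows "(circle d \<theta> \<bullet> circle d \<theta>) *\<^sub>R circle_deriv d \<theta> - (circle d \<theta> \<bullet> circle_deriv d \<theta>) *\<^sub>R circle d \<theta> \<noteq> 0"
proof
  let ?c = "circle d \<theta>" and ?x = "cos \<theta>" and ?y = "sin \<theta>"
  assume "(?c \<bullet> ?c) *\<^sub>R circle_deriv d \<theta> - (?c \<bullet> circle_deriv d \<theta>) *\<^sub>R ?c = 0"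
  then have eq: "(?c \<bullet> ?c) *\<^sub>R circle_deriv d \<theta> = (?c \<bullet> circle_deriv d \<theta>) *\<^sub>R ?c" by simp
  have cc: "?c \<bullet> ?c \<noteq> 0" using circle_nonzero[of d \<theta>] by simp
  define \<mu> where "\<mu> = (?c \<bullet> circle_deriv d \<theta>) / (?c \<bullet> ?c)"
  have "circle_deriv d \<theta> $ i = \<mu> * ?c $ i" for i
  proof -
    have "(?c \<bullet> ?c) * circle_deriv d \<theta> $ i = (?c \<bullet> circle_deriv d \<theta>) * ?c $ i"
      using arg_cong[OF eq, of "\<lambda>v. v $ i"] by simp
    then show ?thesis using cc by (simp add: \<mu>_def field_simps)
  qed
  then have "real d * circle_root_deriv \<theta> $ i * circle_root \<theta> $ i ^ (d - 1) =
      \<mu> * circle_root \<theta> $ i * circle_root \<theta> $ i ^ (d - 1)" for i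
    using d by (simp add: circle_deriv_def circle_def power_eq_if[of _ d] ac_simps)
  then have \<mu>: "real d * circle_root_deriv \<theta> $ i = \<mu> * circle_root \<theta> $ i" if "circle_root \<theta> $ i \<noteq> 0" for i
    using that[THEN power_not_zero, of "d - 1"] mult_right_cancel by blast
  have unit: "?x\<^sup>2 + ?y\<^sup>2 = 1" by simp
  consider "?x = 0" | "?y = 0" | "?x \<noteq> 0" "?y \<noteq> 0" by blast
  then show False
  proof cases
    case 1
    then have y: "?y \<noteq> 0" using unit by auto
    then have "\<mu> = 0" using \<mu>[of 2] 1 by simp
    then show False using \<mu>[of 3] 1 y d by simp
  next
    case 2
    then have x: "?x \<noteq> 0" using unit by auto
    then have "\<mu> = 0" using \<mu>[of 1] 2 by simp
    then show False using \<mu>[of 3] 2 x d by simp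
  next
    case 3
    then have "- real d * ?y = \<mu> * ?x" "real d * ?x = \<mu> * ?y" using \<mu>[of 1] \<mu>[of 2] by simp_all
    then have "- real d * ?y * ?y = real d * ?x * ?x" by (simp add: mult.assoc mult.left_commute)
    then have "real d * (?x * ?x + ?y * ?y) = 0" unfolding distrib_left mult.assoc by linarith
    moreover have "?x * ?x + ?y * ?y = 1" using unit unfolding power2_eq_square .
    ultimately show False using d by simp
  qed
qed

text \<open>Otherwise the remainder would be a fourth nonzero vector orthogonal to c, n and w in
  dimension 3.\<close>

lemma orthogonal_decomposition:
  fixes c n w q :: "real ^ 3"
  assumes orth: "c \<bullet> n = 0" "c \<bullet> w = 0" "n \<bullet> w = 0" and nz: "c \<noteq> 0" "n \<noteq> 0" "w \<noteq> 0" and q: "q \<bullet> w = 0"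
  shows "q = ((q \<bullet> c) / (c \<bullet> c)) *\<^sub>R c + ((q \<bullet> n) / (n \<bullet> n)) *\<^sub>R n"
proof (rule ccontr)
  define e where "e = q - ((q \<bullet> c) / (c \<bullet> c)) *\<^sub>R c - ((q \<bullet> n) / (n \<bullet> n)) *\<^sub>R n"
  assume "\<not> ?thesis"
  then have e0: "e \<noteq> 0" by (auto simp: e_def algebra_simps)
  have eo: "e \<bullet> c = 0" "e \<bullet> n = 0" "e \<bullet> w = 0"
    using orth nz q by (simp_all add: e_def inner_diff_left inner_commute[of n c])
  have "pairwise orthogonal {c, n, w, e}"
    using orth eo by (auto simp: pairwise_def orthogonal_def inner_commute)
  then have "independent {c, n, w, e}" using nz e0 by (intro pairwise_orthogonal_independent) auto
  then have "card {c, n, w, e} \<le> DIM(real ^ 3)" by (rule independent_card_le)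
  moreover have "c \<noteq> n" "c \<noteq> w" "c \<noteq> e" "n \<noteq> w" "n \<noteq> e" "w \<noteq> e"
    using orth eo nz e0 by (metis inner_eq_zero_iff)+
  ultimately show False by simp
qed

lemma circle_arc_nonzero:
  assumes "d > 0" shows "circle_arc d p \<noteq> 0"
proof
  assume "circle_arc d p = 0"
  then have "circle_arc d p \<bullet> circle d (fst p) = 0" by simp
  then show False using circle_normal_orthogonal(1)[OF assms] circle_nonzero[of d "fst p"]
    by (simp add: circle_arc_def inner_add_left)
qed

lemma circle_periodic:
  obtains \<theta>' where "0 \<le> \<theta>'" "\<theta>' \<le> 2 * pi" "circle d \<theta> = circle d \<theta>'"
proof -
  obtain t where "0 \<le> t" "t \<le> 2 * pi" "cos \<theta> = cos t" "sin \<theta> = sin t"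
    using sincos_total_2pi_le[of "cos \<theta>" "sin \<theta>"] by auto
  then show ?thesis using that[of t] by (simp add: circle_def circle_root_def)
qed

text \<open>The point of the circle whose direction is closest to that of \<open>v\<close> is a critical point of the
  angle, so that \<open>v\<close> lies in the plane spanned by this point and its normal.\<close>

lemma circle_closest_point:
  fixes v :: "real ^ 3"
  assumes d: "d > 0" and v: "v \<bullet> circle d \<theta>\<^sub>0 \<noteq> 0"
  obtains \<theta> \<tau> where "0 \<le> \<theta>" "\<theta> \<le> 2 * pi" "proj_point v = proj_point (circle_arc d (\<theta>, \<tau>))"
    "\<tau>\<^sup>2 * ((circle_normal d \<theta> \<bullet> circle_normal d \<theta>) / (circle d \<theta> \<bullet> circle d \<theta>)) \<le>
      (v \<bullet> v) * (circle d \<theta>\<^sub>0 \<bullet> circle d \<theta>\<^sub>0) / (v \<bullet> circle d \<theta>\<^sub>0)\<^sup>2 - 1"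
proof -
  let ?c = "circle d" and ?n = "circle_normal d"
  \<comment> \<open>Up to the factor \<open>v \<bullet> v\<close>, the squared cosine of the angle
    between v and the point of the circle.\<close>
  define m where "m \<theta> = (v \<bullet> ?c \<theta>)\<^sup>2 / (?c \<theta> \<bullet> ?c \<theta>)" for \<theta>
  have cc: "?c \<theta> \<bullet> ?c \<theta> > 0" for \<theta> using circle_nonzero[of d \<theta>] by simp
  have "continuous_on {0..2 * pi} m"
    unfolding m_def using circle_nonzero[of d] by (intro continuous_intros) simp
  then obtain \<theta> where \<theta>: "\<theta> \<in> {0..2 * pi}" "\<And>t. t \<in> {0..2 * pi} \<Longrightarrow> m t \<le> m \<theta>"
    using continuous_attains_sup[of "{0..2 * pi}" m] by fastforce
  \<comment> \<open>Periodicity makes the maximum global, so it is a critical point even if attained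
    at 0 or \<open>2 * pi\<close>.\<close>
  have max: "m t \<le> m \<theta>" for t
  proof -
    obtain t' where "0 \<le> t'" "t' \<le> 2 * pi" "?c t = ?c t'" by (rule circle_periodic)
    then show ?thesis using \<theta>(2)[of t'] by (simp add: m_def)
  qed
  let ?A = "v \<bullet> ?c \<theta>" and ?B = "?c \<theta> \<bullet> ?c \<theta>" and ?A' = "v \<bullet> circle_deriv d \<theta>" and ?C = "?c \<theta> \<bullet> circle_deriv d \<theta>"
  have A: "((\<lambda>t. v \<bullet> ?c t) has_real_derivative ?A') (at \<theta>)"
    unfolding inner_vec3 by (intro DERIV_sum DERIV_cmult circle_DERIV)
  have B: "((\<lambda>t. ?c t \<bullet> ?c t) has_real_derivative 2 * ?C) (at \<theta>)"
  proof -
    have "((\<lambda>t. ?c t $ i * ?c t $ i) has_real_derivative 2 * (?c \<theta> $ i * circle_deriv d \<theta> $ i)) (at \<theta>)" for i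
      using DERIV_mult[OF circle_DERIV[of d i \<theta>] circle_DERIV[of d i \<theta>]] by (simp add: algebra_simps)
    then have "((\<lambda>t. \<Sum>i\<in>UNIV. ?c t $ i * ?c t $ i) has_real_derivative (\<Sum>i\<in>UNIV. 2 * (?c \<theta> $ i * circle_deriv d \<theta> $ i))) (at \<theta>)"
      by (intro DERIV_sum)
    then show ?thesis by (simp add: inner_vec3 sum_distrib_left)
  qed
  have "(m has_real_derivative ((2 * ?A * ?A' * ?B - ?A\<^sup>2 * (2 * ?C)) / (?B * ?B))) (at \<theta>)"
    unfolding m_def[abs_def] using cc[of \<theta>]
    by (intro DERIV_cong[OF DERIV_divide[OF DERIV_power[OF A] B]]) (auto simp: algebra_simps)
  then have "(2 * ?A * ?A' * ?B - ?A\<^sup>2 * (2 * ?C)) / (?B * ?B) = 0"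
    by (rule DERIV_local_max[of _ _ _ 1]) (use max in auto)
  then have "2 * ?A * (?A' * ?B - ?A * ?C) = 0" using cc[of \<theta>] by (simp add: power2_eq_square algebra_simps)
  moreover have "m \<theta>\<^sub>0 > 0" using v cc[of \<theta>\<^sub>0] by (simp add: m_def)
  then have m0: "m \<theta> > 0" using max[of \<theta>\<^sub>0] by simp
  then have A0: "?A \<noteq> 0" by (auto simp: m_def)
  ultimately have crit: "?A' * ?B - ?A * ?C = 0" by simp
  \<comment> \<open>A multiple of the component of the derivative orthogonal to the position;
    criticality of m says that v is orthogonal to it.\<close>
  define w where "w = ?B *\<^sub>R circle_deriv d \<theta> - ?C *\<^sub>R ?c \<theta>"
  have "v = (?A / ?B) *\<^sub>R ?c \<theta> + ((v \<bullet> ?n \<theta>) / (?n \<theta> \<bullet> ?n \<theta>)) *\<^sub>R ?n \<theta>"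
  proof (rule orthogonal_decomposition[of _ _ w])
    show "?c \<theta> \<bullet> ?n \<theta> = 0" using circle_normal_orthogonal(1)[OF d, of \<theta>] by (simp add: inner_commute)
    show "?n \<theta> \<bullet> w = 0" using circle_normal_orthogonal[OF d, of \<theta>] by (simp add: w_def inner_diff_right)
    show "?c \<theta> \<bullet> w = 0" by (simp add: w_def inner_diff_right)
    show "v \<bullet> w = 0" using crit by (simp add: w_def inner_diff_right mult.commute)
    show "w \<noteq> 0" unfolding w_def by (rule circle_tangent_nonzero[OF d])
  qed (simp_all add: circle_nonzero circle_normal_nonzero[OF d])
  moreover define \<beta> where "\<beta> = (v \<bullet> ?n \<theta>) / (?n \<theta> \<bullet> ?n \<theta>)"
  ultimately have v_eq: "v = (?A / ?B) *\<^sub>R ?c \<theta> + \<beta> *\<^sub>R ?n \<theta>" by simp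
  define \<alpha> where "\<alpha> = ?A / ?B"
  have \<alpha>0: "\<alpha> \<noteq> 0" using A0 cc[of \<theta>] by (simp add: \<alpha>_def)
  define \<tau> where "\<tau> = \<beta> / \<alpha>"
  have v_arc: "v = \<alpha> *\<^sub>R circle_arc d (\<theta>, \<tau>)"
    using \<alpha>0 by (subst v_eq) (simp add: circle_arc_def \<tau>_def \<alpha>_def[symmetric] scaleR_add_right)
  have nc: "?n \<theta> \<bullet> ?c \<theta> = 0" "?c \<theta> \<bullet> ?n \<theta> = 0"
    using circle_normal_orthogonal(1)[OF d, of \<theta>] by (simp_all add: inner_commute)
  have vv: "v \<bullet> v = \<alpha>\<^sup>2 * (?B + \<tau>\<^sup>2 * (?n \<theta> \<bullet> ?n \<theta>))"
    by (subst (1 2) v_arc) (simp add: circle_arc_def inner_add_left inner_add_right nc power2_eq_square algebra_simps)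
  have m\<theta>: "m \<theta> = \<alpha>\<^sup>2 * ?B" using cc[of \<theta>] by (simp add: m_def \<alpha>_def power2_eq_square)
  \<comment> \<open>This is the squared tangent of the angle between v and the point at \<theta>,
    smallest where the cosine is largest.\<close>
  have "\<tau>\<^sup>2 * ((?n \<theta> \<bullet> ?n \<theta>) / ?B) = (v \<bullet> v) / m \<theta> - 1"
    unfolding vv m\<theta> using \<alpha>0 cc[of \<theta>] by (simp add: field_simps)
  also have "\<dots> \<le> (v \<bullet> v) / m \<theta>\<^sub>0 - 1"
    using max[of \<theta>\<^sub>0] \<open>m \<theta>\<^sub>0 > 0\<close> by (intro diff_right_mono divide_left_mono) (auto intro: mult_pos_pos m0)
  also have "(v \<bullet> v) / m \<theta>\<^sub>0 = (v \<bullet> v) * (?c \<theta>\<^sub>0 \<bullet> ?c \<theta>\<^sub>0) / (v \<bullet> ?c \<theta>\<^sub>0)\<^sup>2" by (simp add: m_def)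
  finally have bound: "\<tau>\<^sup>2 * ((?n \<theta> \<bullet> ?n \<theta>) / ?B) \<le> (v \<bullet> v) * (?c \<theta>\<^sub>0 \<bullet> ?c \<theta>\<^sub>0) / (v \<bullet> ?c \<theta>\<^sub>0)\<^sup>2 - 1" .
  have "v \<noteq> 0" using v by auto
  then have "proj_point v = proj_point (circle_arc d (\<theta>, \<tau>))"
    using v_arc \<alpha>0 circle_arc_nonzero[OF d] by (subst proj_point_eq_iff) auto
  then show ?thesis using that[of \<theta> \<tau>] \<theta>(1) bound by auto
qed

text \<open>The angle between v and the given point of the circle tends to 0, and it bounds \<tau>
  through \<open>circle_closest_point\<close>; the minimum of the ratio of squared norms over the
  circle makes this uniform in \<theta>.\<close>

lemma circle_neighbourhood:
  assumes d: "d > 0" and c: "c \<noteq> 0" and \<rho>: "\<rho> > 0"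
  shows "\<forall>\<^sub>F v in nhds (c *\<^sub>R circle d \<theta>\<^sub>0). \<exists>p\<in>arc_box (- \<rho>) \<rho>. proj_point v = proj_point (circle_arc d p)"
proof -
  let ?c = "circle d" and ?n = "circle_normal d" and ?l = "c *\<^sub>R circle d \<theta>\<^sub>0"
  let ?\<kappa> = "\<lambda>\<theta>. (?n \<theta> \<bullet> ?n \<theta>) / (?c \<theta> \<bullet> ?c \<theta>)"
  have "continuous_on {0..2 * pi} ?\<kappa>" using circle_nonzero[of d] by (intro continuous_intros) simp
  then obtain \<theta>1 where \<theta>1: "\<And>\<theta>. \<theta> \<in> {0..2 * pi} \<Longrightarrow> ?\<kappa> \<theta>1 \<le> ?\<kappa> \<theta>"
    using continuous_attains_inf[of "{0..2 * pi}" ?\<kappa>] by fastforce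
  have \<kappa>: "?\<kappa> \<theta>1 > 0" using circle_nonzero[of d] circle_normal_nonzero[OF d] by simp
  have cc: "?c \<theta>\<^sub>0 \<bullet> ?c \<theta>\<^sub>0 \<noteq> 0" using circle_nonzero[of d] by simp
  have id: "((\<lambda>v. v) \<longlongrightarrow> ?l) (nhds ?l)" by (simp add: filterlim_ident)
  have lc: "?l \<bullet> ?c \<theta>\<^sub>0 \<noteq> 0" using cc c by simp
  have "((\<lambda>v. v \<bullet> ?c \<theta>\<^sub>0) \<longlongrightarrow> ?l \<bullet> ?c \<theta>\<^sub>0) (nhds ?l)" by (intro tendsto_intros id)
  then have nonorthogonal: "\<forall>\<^sub>F v in nhds ?l. v \<bullet> ?c \<theta>\<^sub>0 \<noteq> 0" using lc by (rule tendsto_imp_eventually_ne)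
  have "((\<lambda>v. (v \<bullet> v) * (?c \<theta>\<^sub>0 \<bullet> ?c \<theta>\<^sub>0) / (v \<bullet> ?c \<theta>\<^sub>0)\<^sup>2 - 1) \<longlongrightarrow>
      (?l \<bullet> ?l) * (?c \<theta>\<^sub>0 \<bullet> ?c \<theta>\<^sub>0) / (?l \<bullet> ?c \<theta>\<^sub>0)\<^sup>2 - 1) (nhds ?l)"
    using lc by (intro tendsto_intros id) simp
  moreover have "(?l \<bullet> ?l) * (?c \<theta>\<^sub>0 \<bullet> ?c \<theta>\<^sub>0) / (?l \<bullet> ?c \<theta>\<^sub>0)\<^sup>2 - 1 < ?\<kappa> \<theta>1 * \<rho>\<^sup>2"
  proof -
    have "(?l \<bullet> ?l) * (?c \<theta>\<^sub>0 \<bullet> ?c \<theta>\<^sub>0) / (?l \<bullet> ?c \<theta>\<^sub>0)\<^sup>2 - 1 = 0"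
      using cc c by (simp add: power2_eq_square)
    also have "\<dots> < ?\<kappa> \<theta>1 * \<rho>\<^sup>2" using \<rho> by (intro mult_pos_pos[OF \<kappa>]) simp
    finally show ?thesis .
  qed
  ultimately have "\<forall>\<^sub>F v in nhds ?l. (v \<bullet> v) * (?c \<theta>\<^sub>0 \<bullet> ?c \<theta>\<^sub>0) / (v \<bullet> ?c \<theta>\<^sub>0)\<^sup>2 - 1 < ?\<kappa> \<theta>1 * \<rho>\<^sup>2"
    by (rule order_tendstoD(2))
  with nonorthogonal show ?thesis
  proof eventually_elim
    case (elim v)
    obtain \<theta> \<tau> where \<theta>: "0 \<le> \<theta>" "\<theta> \<le> 2 * pi" "proj_point v = proj_point (circle_arc d (\<theta>, \<tau>))"
      and bound: "\<tau>\<^sup>2 * ?\<kappa> \<theta> \<le> (v \<bullet> v) * (?c \<theta>\<^sub>0 \<bullet> ?c \<theta>\<^sub>0) / (v \<bullet> ?c \<theta>\<^sub>0)\<^sup>2 - 1"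
      using circle_closest_point[OF d elim(1)] by blast
    have "\<tau>\<^sup>2 * ?\<kappa> \<theta>1 \<le> \<tau>\<^sup>2 * ?\<kappa> \<theta>" using \<theta>1[of \<theta>] \<theta> by (intro mult_left_mono) auto
    then have "\<tau>\<^sup>2 * ?\<kappa> \<theta>1 \<le> \<rho>\<^sup>2 * ?\<kappa> \<theta>1" using bound elim(2) by (simp add: mult.commute)
    then have "\<tau>\<^sup>2 \<le> \<rho>\<^sup>2" using \<kappa> by (simp only: mult_le_cancel_right_pos)
    then have "\<bar>\<tau>\<bar> \<le> \<rho>" using \<rho> by (simp add: abs_le_square_iff[symmetric])
    then have "(\<theta>, \<tau>) \<in> arc_box (- \<rho>) \<rho>" using \<theta> by (auto simp: arc_box_def)
    then show ?case using \<theta>(3) by blast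
  qed
qed

text \<open>R has positive derivative across the circle and opposite signs at the two ends of every
  arc. Both survive a small perturbation by compactness, and the zero set stays a graph.\<close>

lemma circle_component:
  assumes d: "d > 0"
  obtains \<rho>\<^sub>0 where "\<rho>\<^sub>0 > 0" "\<And>\<rho>. 0 < \<rho> \<Longrightarrow> \<rho> \<le> \<rho>\<^sub>0 \<Longrightarrow> \<forall>\<^sub>F \<epsilon> in at_right 0.
    let Z = {p \<in> arc_box (- \<rho>) \<rho>. eval (perturbed (harnack_form d) h \<epsilon>) (circle_arc d p) = 0}
    in compact Z \<and> connected Z \<and> Z \<noteq> {}"
proof -
  let ?R = "harnack_form d"
  define D where "D G p = (\<Sum>i\<in>UNIV. eval (partial i G) (circle_arc d p) * circle_normal d (fst p) $ i)" for G p
  have deriv: "((\<lambda>\<tau>. eval G (circle_arc d (\<theta>, \<tau>))) has_real_derivative D G (\<theta>, \<tau>)) (at \<tau>)" for G \<theta> \<tau>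
  proof -
    have "((\<lambda>\<tau>. circle_arc d (\<theta>, \<tau>) $ i) has_real_derivative circle_normal d \<theta> $ i) (at \<tau>)" for i
      unfolding circle_arc_def by (auto intro!: derivative_eq_intros)
    from eval_DERIV[OF this] show ?thesis by (simp add: D_def)
  qed
  have contD: "continuous_on S (D G)" for S G
    unfolding D_def by (intro continuous_intros continuous_on_circle_arc)
  have cont: "continuous_on S (\<lambda>p. eval G (circle_arc d p))" for S G
    by (intro continuous_intros continuous_on_circle_arc)
  have posD: "D ?R p > 0" if "p \<in> arc_box (- 1) 1" "\<bar>snd p\<bar> \<le> 0" for p
  proof -
    have "D ?R p = circle_normal d (fst p) \<bullet> circle_normal d (fst p)"
      using that by (simp add: D_def circle_arc_def inner_vec3 circle_normal_def)
    then show ?thesis using circle_normal_nonzero[OF d] by simp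
  qed
  have "continuous_on (arc_box (- 1) 1) (\<lambda>p. \<bar>snd p\<bar>)" by (intro continuous_intros)
  from positive_near_core[OF compact_arc_box contD this posD]
  obtain \<rho>1 where \<rho>1: "\<rho>1 > 0" "\<And>p. p \<in> arc_box (- 1) 1 \<Longrightarrow> \<bar>snd p\<bar> \<le> \<rho>1 \<Longrightarrow> D ?R p > 0"
    by blast
  show ?thesis
  proof
    show "min 1 \<rho>1 > 0" using \<rho>1 by simp
    fix \<rho> assume \<rho>: "0 < \<rho>" "\<rho> \<le> min 1 \<rho>1"
    have D0: "D ?R p > 0" if "p \<in> arc_box (- \<rho>) \<rho>" for p
      using that \<rho> by (intro \<rho>1(2)) (auto simp: arc_box_def)
    have incr: "eval G (circle_arc d (\<theta>, r)) < eval G (circle_arc d (\<theta>, r'))"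
      if "\<And>p. p \<in> arc_box (- \<rho>) \<rho> \<Longrightarrow> D G p > 0" "\<theta> \<in> {0..2 * pi}" "- \<rho> \<le> r" "r < r'" "r' \<le> \<rho>" for G \<theta> r r'
      by (rule DERIV_pos_imp_increasing[OF that(4)])
        (use that in \<open>auto simp: arc_box_def intro!: exI[of _ "D G (\<theta>, _)"] deriv\<close>)
    have core: "eval ?R (circle_arc d (\<theta>, 0)) = 0" for \<theta> by (simp add: circle_arc_def circle_zero[OF d])
    have ends: "eval ?R (circle_arc d (\<theta>, \<rho>)) > 0" "- eval ?R (circle_arc d (\<theta>, - \<rho>)) > 0" if "\<theta> \<in> {0..2 * pi}" for \<theta>
      using incr[OF D0 that, of 0 \<rho>] incr[OF D0 that, of "- \<rho>" 0] \<rho> by (simp_all add: core)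
    have slice: "continuous_on {0..2 * pi} (\<lambda>\<theta>. eval G (circle_arc d (\<theta>, r)))" for G r
      by (intro continuous_on_compose2[OF cont[of UNIV]] continuous_intros) auto
    have "\<forall>\<^sub>F \<epsilon> in at_right 0. \<forall>p\<in>arc_box (- \<rho>) \<rho>. D ?R p + \<epsilon> * D h p > 0"
      using D0 by (intro eventually_positive_perturbation contD compact_arc_box)
    moreover have "\<forall>\<^sub>F \<epsilon> in at_right 0. \<forall>\<theta>\<in>{0..2 * pi}. eval ?R (circle_arc d (\<theta>, \<rho>)) + \<epsilon> * eval h (circle_arc d (\<theta>, \<rho>)) > 0"
      using ends by (intro eventually_positive_perturbation compact_Icc slice)
    moreover have "\<forall>\<^sub>F \<epsilon> in at_right 0. \<forall>\<theta>\<in>{0..2 * pi}. - eval ?R (circle_arc d (\<theta>, - \<rho>)) + \<epsilon> * - eval h (circle_arc d (\<theta>, - \<rho>)) > 0"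
      using ends by (intro eventually_positive_perturbation compact_Icc continuous_intros slice)
    ultimately show "\<forall>\<^sub>F \<epsilon> in at_right 0.
      let Z = {p \<in> arc_box (- \<rho>) \<rho>. eval (perturbed (harnack_form d) h \<epsilon>) (circle_arc d p) = 0}
      in compact Z \<and> connected Z \<and> Z \<noteq> {}"
    proof eventually_elim
      case (elim \<epsilon>)
      let ?F = "perturbed ?R h \<epsilon>"
      have "D ?F p = D ?R p + \<epsilon> * D h p" for p
        by (simp add: D_def eval_partial_perturbed sum.distrib sum_distrib_left algebra_simps)
      then have DF: "D ?F p > 0" if "p \<in> arc_box (- \<rho>) \<rho>" for p using elim(1) that by simp
      have e: "eval ?F (circle_arc d (\<theta>, - \<rho>)) < 0 \<and> 0 < eval ?F (circle_arc d (\<theta>, \<rho>))" if "\<theta> \<in> {0..2 * pi}" for \<theta>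
        using elim(2,3) that by (fastforce simp: eval_perturbed)
      show ?case unfolding Let_def
        using graph_zero_set[of "- \<rho>" \<rho> "\<lambda>p. eval ?F (circle_arc d p)", OF cont _ incr[OF DF] e] \<rho> by auto
    qed
  qed
qed


section \<open>Assembly of the branches\<close>

text \<open>At y = 0 the d^2 factors no longer depend on b, so the product of d factors occurs as a
  d-th power.\<close>

lemma harnack_form_hyperflex:
  fixes x z :: complex
  assumes d: "d > 0"
  shows "eval (harnack_form d) (vector [x, 0, z]) = (z - x) ^ d"
proof -
  obtain a b where ab: "a ^ d = x" "b ^ d = z" using complex_nth_root[OF d] by metis
  have "eval (harnack_form d) (vector [a ^ d, 0, b ^ d]) = (\<Prod>\<zeta>\<in>unity_roots d. b - \<zeta> * a) ^ d"
    unfolding harnack_form_line_2[OF d] by (simp add: prod_power_distrib)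
  then show ?thesis by (simp add: prod_unity_roots[OF d] ab)
qed

text \<open>\<open>None\<close> stands for the circle and \<open>Some (j, k)\<close> for a solitary node.\<close>

definition core_arc :: "nat \<Rightarrow> (nat \<times> nat) option \<Rightarrow> real \<times> real \<Rightarrow> real ^ 3" where
  "core_arc d i = (case i of None \<Rightarrow> circle_arc d | Some (j, k) \<Rightarrow> node_arc d j k)"

text \<open>The circle has two sides, so its second parameter takes both signs; the radius around a
  node is nonnegative.\<close>

definition core_box :: "(nat \<times> nat) option \<Rightarrow> real \<Rightarrow> (real \<times> real) set" where
  "core_box i \<rho> = (case i of None \<Rightarrow> arc_box (- \<rho>) \<rho> | Some _ \<Rightarrow> arc_box 0 \<rho>)"

definition cores :: "nat \<Rightarrow> (nat \<times> nat) option set" where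
  "cores d = insert None (Some ` node_indices d)"

lemma coresE:
  assumes "i \<in> cores d"
  obtains "i = None" | j k where "i = Some (j, k)" "(j, k) \<in> node_indices d"
  using assms by (auto simp: cores_def)

lemma node_indicesD:
  assumes "(j, k) \<in> node_indices d"
  shows "0 < j" "j < d" "0 < k" "k < d" "j \<noteq> k"
  using assms by (auto simp: node_indices_def)

lemma compact_core_box [simp]: "compact (core_box i \<rho>)"
  by (simp add: core_box_def split: option.split)

lemma core_box_mono: "\<rho> \<le> \<rho>' \<Longrightarrow> core_box i \<rho> \<subseteq> core_box i \<rho>'"
  by (auto simp: core_box_def arc_box_def split: option.split)

lemma core_box_bound: "p \<in> core_box i \<rho> \<Longrightarrow> \<bar>snd p\<bar> \<le> \<rho>"
  by (auto simp: core_box_def arc_box_def split: option.splits)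

lemma continuous_on_core_arc: "continuous_on S (core_arc d i)"
  by (simp add: core_arc_def continuous_on_circle_arc continuous_on_node_arc split: option.split)

lemma core_arc_nonzero: "d > 0 \<Longrightarrow> i \<in> cores d \<Longrightarrow> core_arc d i p \<noteq> 0"
  by (elim coresE) (simp_all add: core_arc_def circle_arc_nonzero node_arc_nonzero[OF node_indicesD])

lemma core_points_distinct:
  assumes d: "d > 0" and i: "i \<in> cores d" "i' \<in> cores d" "i \<noteq> i'"
  shows "core_arc d i (\<theta>, 0) \<noteq> c *\<^sub>R core_arc d i' (\<theta>', 0)"
proof
  assume eq: "core_arc d i (\<theta>, 0) = c *\<^sub>R core_arc d i' (\<theta>', 0)"
  then have c0: "c \<noteq> 0" using core_arc_nonzero[OF d i(1), of "(\<theta>, 0)"] by auto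
  have C: "core_arc d None (\<theta>, 0) = circle d \<theta>" for \<theta> by (simp add: core_arc_def circle_arc_def)
  have N: "core_arc d (Some (j, k)) (\<theta>, 0) = node d j k" for j k \<theta> by (simp add: core_arc_def node_arc_core)
  show False
  proof (cases rule: coresE[OF i(1)])
    case 1
    then obtain j k where jk: "i' = Some (j, k)" "(j, k) \<in> node_indices d" using i by (auto elim: coresE)
    then show False using eq circle_not_node[OF jk(2), of \<theta> c] by (simp add: 1 C N)
  next
    case (2 j k)
    show False
    proof (cases rule: coresE[OF i(2)])
      case 1
      then have "circle d \<theta>' = (1 / c) *\<^sub>R node d j k" using eq c0 2 by (simp add: C N)
      then show False using circle_not_node[OF 2(2)] by blast
    next
      case (2 j' k')
      then show False using eq node_distinct[of j' k' d j k c] \<open>i = Some (j, k)\<close> \<open>(j, k) \<in> node_indices d\<close> i(3)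
        by (simp add: N)
    qed
  qed
qed

text \<open>The Gram determinant of two vectors vanishes exactly if they are proportional. It is
  positive on pairs of core points, and compactness spreads this to narrow boxes.\<close>

lemma eventually_cores_disjoint:
  assumes d: "d > 0" and i: "i \<in> cores d" "i' \<in> cores d" "i \<noteq> i'"
  shows "\<forall>\<^sub>F \<rho> in at_right 0. \<forall>p\<in>core_box i \<rho>. \<forall>p'\<in>core_box i' \<rho>.
    proj_point (core_arc d i p) \<noteq> proj_point (core_arc d i' p')"
proof -
  let ?f = "core_arc d i" and ?f' = "core_arc d i'"
  let ?K = "core_box i 1 \<times> core_box i' 1"
  define g where "g x = (norm (?f (fst x)) * norm (?f' (snd x)))\<^sup>2 - (?f (fst x) \<bullet> ?f' (snd x))\<^sup>2" for x
  have "continuous_on ?K g"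
    unfolding g_def
    by (intro continuous_intros continuous_on_compose2[OF continuous_on_core_arc[of UNIV]]) auto
  moreover have "continuous_on ?K (\<lambda>x. max \<bar>snd (fst x)\<bar> \<bar>snd (snd x)\<bar>)" by (intro continuous_intros)
  moreover have "g x > 0" if "x \<in> ?K" "max \<bar>snd (fst x)\<bar> \<bar>snd (snd x)\<bar> \<le> 0" for x
  proof (rule ccontr)
    obtain \<theta> r \<theta>' r' where x: "x = ((\<theta>, r), (\<theta>', r'))" by (metis prod.exhaust)
    then have r: "r = 0" "r' = 0" using that by auto
    let ?a = "?f (\<theta>, 0)" and ?b = "?f' (\<theta>', 0)"
    assume "\<not> g x > 0"
    then have "(norm ?a * norm ?b)\<^sup>2 \<le> (?a \<bullet> ?b)\<^sup>2" by (simp add: g_def x r)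
    then have "norm ?a * norm ?b \<le> \<bar>?a \<bullet> ?b\<bar>" by (simp add: abs_le_square_iff[symmetric])
    then have "\<bar>?a \<bullet> ?b\<bar> = norm ?a * norm ?b" using Cauchy_Schwarz_ineq2[of ?a ?b] by simp
    then have par: "norm ?a *\<^sub>R ?b = norm ?b *\<^sub>R ?a \<or> norm ?a *\<^sub>R ?b = - norm ?b *\<^sub>R ?a"
      by (simp add: norm_cauchy_schwarz_abs_eq)
    have b0: "norm ?b \<noteq> 0" using core_arc_nonzero[OF d i(2)] by simp
    from par have "?a = (norm ?a / norm ?b) *\<^sub>R ?b \<or> ?a = (- norm ?a / norm ?b) *\<^sub>R ?b"
    proof
      assume e: "norm ?a *\<^sub>R ?b = norm ?b *\<^sub>R ?a"
      have "(norm ?a / norm ?b) *\<^sub>R ?b = (1 / norm ?b) *\<^sub>R (norm ?a *\<^sub>R ?b)" by simp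
      then show ?thesis unfolding e using b0 by simp
    next
      assume e: "norm ?a *\<^sub>R ?b = - norm ?b *\<^sub>R ?a"
      have "(- norm ?a / norm ?b) *\<^sub>R ?b = - (1 / norm ?b) *\<^sub>R (norm ?a *\<^sub>R ?b)" by simp
      then show ?thesis unfolding e using b0 by simp
    qed
    then show False using core_points_distinct[OF d i] by blast
  qed
  ultimately have "\<exists>\<rho>>0. \<forall>x\<in>?K. max \<bar>snd (fst x)\<bar> \<bar>snd (snd x)\<bar> \<le> \<rho> \<longrightarrow> g x > 0"
    by (intro positive_near_core compact_Times) auto
  then obtain \<rho>1 where \<rho>1: "\<rho>1 > 0" "\<And>x. x \<in> ?K \<Longrightarrow> max \<bar>snd (fst x)\<bar> \<bar>snd (snd x)\<bar> \<le> \<rho>1 \<Longrightarrow> g x > 0" by blast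
  have "min 1 \<rho>1 > 0" using \<rho>1(1) by simp
  then have "\<forall>\<^sub>F \<rho> in at_right 0. \<rho> < min 1 \<rho>1" unfolding eventually_at_right_field by blast
  then show ?thesis
  proof (rule eventually_mono, intro ballI notI)
    fix \<rho> p p' assume \<rho>: "\<rho> < min 1 \<rho>1" and p: "p \<in> core_box i \<rho>" "p' \<in> core_box i' \<rho>"
      and eq: "proj_point (?f p) = proj_point (?f' p')"
    have "(p, p') \<in> ?K" using p \<rho> core_box_mono[of \<rho> 1] by auto
    then have "g (p, p') > 0" using \<rho>1(2)[of "(p, p')"] core_box_bound[OF p(1)] core_box_bound[OF p(2)] \<rho> by auto
    moreover obtain c where c: "?f p = c *\<^sub>R ?f' p'"
      using eq proj_point_eq_iff[OF core_arc_nonzero[OF d i(1)] core_arc_nonzero[OF d i(2)]] by blast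
    have "g (p, p') = 0"
      unfolding g_def fst_conv snd_conv c power_mult_distrib power2_norm_eq_inner inner_scaleR_left inner_scaleR_right
      by (simp only: power2_eq_square ac_simps diff_self)
    ultimately show False by simp
  qed
qed

lemma eventually_at_right_0_le:
  fixes \<rho>\<^sub>0 :: real
  assumes "\<rho>\<^sub>0 > 0" "\<And>\<rho>. 0 < \<rho> \<Longrightarrow> \<rho> \<le> \<rho>\<^sub>0 \<Longrightarrow> P \<rho>"
  shows "\<forall>\<^sub>F \<rho> in at_right 0. P \<rho>"
  unfolding eventually_at_right_field using assms by (intro exI[of _ \<rho>\<^sub>0]) auto

text \<open>The bound on \<epsilon> may depend on \<rho>, which explains the order of the two
  limits.\<close>

lemma eventually_zeros_near_core:
  assumes d: "d > 0" and i: "i \<in> cores d" and J: "None \<in> J"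
    and sign: "\<And>j k. Some (j, k) \<in> cores d \<Longrightarrow>
      (if Some (j, k) \<in> J then eval h (node d j k) * node_sign d j k < 0 else eval h (node d j k) * node_sign d j k > 0)"
  shows "\<forall>\<^sub>F \<rho> in at_right 0. \<forall>\<^sub>F \<epsilon> in at_right 0.
    let Z = {p \<in> core_box i \<rho>. eval (perturbed (harnack_form d) h \<epsilon>) (core_arc d i p) = 0}
    in if i \<in> J then compact Z \<and> connected Z \<and> Z \<noteq> {} else Z = {}"
proof (cases rule: coresE[OF i])
  case 1
  obtain \<rho>\<^sub>0 where \<rho>\<^sub>0: "\<rho>\<^sub>0 > 0" "\<And>\<rho>. 0 < \<rho> \<Longrightarrow> \<rho> \<le> \<rho>\<^sub>0 \<Longrightarrow> \<forall>\<^sub>F \<epsilon> in at_right 0.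
    let Z = {p \<in> arc_box (- \<rho>) \<rho>. eval (perturbed (harnack_form d) h \<epsilon>) (circle_arc d p) = 0}
    in compact Z \<and> connected Z \<and> Z \<noteq> {}"
    using circle_component[OF d, of h] by blast
  show ?thesis by (rule eventually_at_right_0_le[OF \<rho>\<^sub>0(1)]) (use J \<rho>\<^sub>0(2) in \<open>simp only: 1 core_box_def core_arc_def option.case if_True\<close>)
next
  case (2 j k)
  note jk = node_indicesD[OF 2(2)]
  show ?thesis
  proof (cases "i \<in> J")
    case True
    then have "eval h (node d j k) * node_sign d j k < 0" using sign[of j k] 2 i by simp
    from node_oval[OF jk this]
    obtain \<rho>\<^sub>0 where \<rho>\<^sub>0: "\<rho>\<^sub>0 > 0" "\<And>\<rho>. 0 < \<rho> \<Longrightarrow> \<rho> \<le> \<rho>\<^sub>0 \<Longrightarrow> \<forall>\<^sub>F \<epsilon> in at_right 0.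
      let Z = {p \<in> arc_box 0 \<rho>. eval (perturbed (harnack_form d) h \<epsilon>) (node_arc d j k p) = 0}
      in compact Z \<and> connected Z \<and> Z \<noteq> {}" by blast
    show ?thesis by (rule eventually_at_right_0_le[OF \<rho>\<^sub>0(1)])
      (use True \<rho>\<^sub>0(2) in \<open>simp only: 2 core_box_def core_arc_def option.case prod.case if_True\<close>)
  next
    case False
    then have "eval h (node d j k) * node_sign d j k > 0" using sign[of j k] 2 i by simp
    from node_no_zero[OF jk this]
    obtain \<rho>\<^sub>0 where \<rho>\<^sub>0: "\<rho>\<^sub>0 > 0" "\<And>\<rho> \<epsilon> p. \<rho> \<le> \<rho>\<^sub>0 \<Longrightarrow> \<epsilon> > 0 \<Longrightarrow> p \<in> arc_box 0 \<rho> \<Longrightarrow>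
      eval (perturbed (harnack_form d) h \<epsilon>) (node_arc d j k p) \<noteq> 0" by blast
    show ?thesis
    proof (rule eventually_at_right_0_le[OF \<rho>\<^sub>0(1)])
      fix \<rho> :: real assume "0 < \<rho>" "\<rho> \<le> \<rho>\<^sub>0"
      then show "\<forall>\<^sub>F \<epsilon> in at_right 0.
        let Z = {p \<in> core_box i \<rho>. eval (perturbed (harnack_form d) h \<epsilon>) (core_arc d i p) = 0}
        in if i \<in> J then compact Z \<and> connected Z \<and> Z \<noteq> {} else Z = {}"
        using False \<rho>\<^sub>0(2) unfolding Let_def 2 core_box_def core_arc_def
        by (intro eventually_at_right_less[THEN eventually_mono]) auto
    qed
  qed
qed

text \<open>Normalized zeros outside the boxes would accumulate, as \<epsilon> -> 0, at a real zero
  of R. This is a point of the circle or a node, and the boxes cover a neighbourhood of it.\<close>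

lemma eventually_covered:
  assumes d: "d > 0" and h: "homogeneous d h" and \<rho>: "\<rho> > 0"
  shows "\<forall>\<^sub>F \<epsilon> in at_right 0. \<forall>v. v \<noteq> 0 \<longrightarrow> eval (perturbed (harnack_form d) h \<epsilon>) v = 0 \<longrightarrow>
    (\<exists>i\<in>cores d. \<exists>p\<in>core_box i \<rho>. proj_point v = proj_point (core_arc d i p))"
proof (rule ccontr)
  let ?F = "\<lambda>\<epsilon>. perturbed (harnack_form d) h \<epsilon>"
  define covered where "covered v \<longleftrightarrow> (\<exists>i\<in>cores d. \<exists>p\<in>core_box i \<rho>. proj_point v = proj_point (core_arc d i p))" for v
  note hom = homogeneous_perturbed[OF homogeneous_harnack_form[OF d] h]
  assume "\<not> ?thesis"
  then obtain \<epsilon> where \<epsilon>: "\<And>n. 0 < \<epsilon> n" "\<And>n. \<not> (\<forall>v. v \<noteq> 0 \<longrightarrow> eval (?F (\<epsilon> n)) v = 0 \<longrightarrow> covered v)" "\<epsilon> \<longlonglongrightarrow> 0"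
    unfolding covered_def by (rule not_eventually_at_right_0) blast
  have "\<exists>v :: real ^ 3. norm v = 1 \<and> eval (?F (\<epsilon> n)) v = 0 \<and> \<not> covered v" for n
  proof -
    obtain v where v: "v \<noteq> 0" "eval (?F (\<epsilon> n)) v = 0" "\<not> covered v" using \<epsilon>(2)[of n] by blast
    let ?w = "(1 / norm v) *\<^sub>R v"
    have "proj_point ?w = proj_point v" using v(1) by (subst proj_point_eq_iff) (auto intro!: exI[of _ "1 / norm v"])
    then have "\<not> covered ?w" using v(3) by (simp add: covered_def)
    moreover have "?w = (\<chi> i. 1 / norm v * v $ i)" by (simp add: vec_eq_iff)
    then have "eval (?F (\<epsilon> n)) ?w = 0" by (simp only: eval_scale[OF hom] v(2) mult_zero_right)
    moreover have "norm ?w = 1" using v(1) by simp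
    ultimately show ?thesis by blast
  qed
  then obtain w :: "nat \<Rightarrow> real ^ 3" where w: "\<And>n. norm (w n) = 1" "\<And>n. eval (?F (\<epsilon> n)) (w n) = 0" "\<And>n. \<not> covered (w n)"
    by metis
  have "seq_compact (sphere (0 :: real ^ 3) 1)" by (simp add: compact_imp_seq_compact)
  then obtain l r where l: "l \<in> sphere 0 1" "strict_mono r" "(w \<circ> r) \<longlonglongrightarrow> l"
    using w(1) by (auto simp: seq_compact_def dest!: spec[of _ w])
  have l0: "l \<noteq> 0" using l(1) by auto
  have er: "(\<lambda>n. \<epsilon> (r n)) \<longlonglongrightarrow> 0" using LIMSEQ_subseq_LIMSEQ[OF \<epsilon>(3) l(2)] by (simp add: o_def)
  have wr: "(\<lambda>n. w (r n)) \<longlonglongrightarrow> l" using l(3) by (simp add: o_def)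
  have "(\<lambda>n. eval (harnack_form d) (w (r n)) + of_real (\<epsilon> (r n)) * eval h (w (r n))) \<longlonglongrightarrow> eval (harnack_form d) l + of_real 0 * eval h l"
    by (intro tendsto_intros er wr)
  moreover have "eval (harnack_form d) (w (r n)) + of_real (\<epsilon> (r n)) * eval h (w (r n)) = 0" for n
    using w(2)[of "r n"] by (simp add: eval_perturbed)
  ultimately have "eval (harnack_form d) l = 0" by (simp add: LIMSEQ_const_iff)
  then have "\<forall>\<^sub>F v in nhds l. covered v"
  proof (rule real_zero_cases[OF d l0])
    fix \<theta> c assume "c \<noteq> 0" "l = c *\<^sub>R circle d \<theta>"
    then have "\<forall>\<^sub>F v in nhds l. \<exists>p\<in>arc_box (- \<rho>) \<rho>. proj_point v = proj_point (circle_arc d p)"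
      using circle_neighbourhood[OF d _ \<rho>] by blast
    then show ?thesis
      by (rule eventually_mono) (auto simp: covered_def cores_def core_box_def core_arc_def)
  next
    fix j k c assume jk: "(j, k) \<in> node_indices d" and c: "c \<noteq> 0" "l = c *\<^sub>R node d j k"
    then have "\<forall>\<^sub>F v in nhds l. \<exists>p\<in>arc_box 0 \<rho>. proj_point v = proj_point (node_arc d j k p)"
      using node_neighbourhood[OF node_indicesD[OF jk] _ \<rho>] by blast
    then show ?thesis
    proof (rule eventually_mono)
      fix v assume "\<exists>p\<in>arc_box 0 \<rho>. proj_point v = proj_point (node_arc d j k p)"
      then show "covered v" unfolding covered_def
        using jk by (intro bexI[of _ "Some (j, k)"]) (auto simp: cores_def core_box_def core_arc_def)
    qed
  qed
  then have "\<forall>\<^sub>F n in sequentially. covered (w (r n))" using wr by (rule eventually_compose_filterlim)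
  then show False using w(3) by simp
qed

theorem theorem4p3:
  fixes d g s :: nat
  assumes "d \<ge> 3"
    and "g = (d - 1) * (d - 2) div 2"
    and "1 \<le> s" and "s \<le> g + 1"
  shows "\<exists>F. real_plane_curve d F \<and> has_genus F g \<and> card (branches F) = s \<and>
    totally_real_series (line_series F)"
proof -
  have d: "d > 0" using assms(1) by simp
  let ?R = "harnack_form d" and ?N = "node_indices d"
  have "s - 1 \<le> g" using assms(4) by linarith
  then have "s - 1 \<le> card ?N" unfolding assms(2) card_node_indices .
  \<comment> \<open>The nodes that become ovals; the circle supplies the remaining branch.\<close>
  then obtain S where S: "S \<subseteq> ?N" "card S = s - 1" by (meson obtain_subset_with_card_n)
  define J where "J = insert None (Some ` S)"
  have J: "J \<subseteq> cores d" "None \<in> J" using S by (auto simp: J_def cores_def)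
  have finS: "finite S" using S(1) finite_node_indices finite_subset by blast
  then have cardJ: "card J = s" using S(2) assms(3) by (simp add: J_def card_image)
  \<comment> \<open>Ovals require h and \<open>node_sign\<close> to have opposite signs, vanishing
    nodes equal signs.\<close>
  obtain h where h: "homogeneous d h" "\<And>v :: complex ^ 3. v $ 2 = 0 \<Longrightarrow> eval h v = 0"
    "\<And>j k. (j, k) \<in> ?N \<Longrightarrow> eval h (node d j k) = (if (j, k) \<in> S then - node_sign d j k else node_sign d j k)"
    by (rule node_interpolation[where \<beta> = "\<lambda>j k. if (j, k) \<in> S then - node_sign d j k else node_sign d j k", OF assms(1) that])
  have h_node: "eval h (node d j k) \<noteq> 0" if "(j, k) \<in> ?N" for j k
    using node_sign_nonzero[OF node_indicesD[OF that]] h(3)[OF that] by simp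
  have sign: "if Some (j, k) \<in> J then eval h (node d j k) * node_sign d j k < 0 else eval h (node d j k) * node_sign d j k > 0"
    if "Some (j, k) \<in> cores d" for j k
  proof -
    have jk: "(j, k) \<in> ?N" using that by (auto simp: cores_def)
    have "node_sign d j k * node_sign d j k > 0"
      using node_sign_nonzero[OF node_indicesD[OF jk]] by (auto simp: zero_less_mult_iff linorder_neq_iff)
    then show ?thesis using h(3)[OF jk] by (auto simp: J_def)
  qed
  have fin: "finite (cores d)" by (simp add: cores_def)
  \<comment> \<open>First \<rho> is fixed so that the boxes are disjoint and the local analysis
    applies; only then is \<epsilon> chosen.\<close>
  define good where "good \<epsilon> \<rho> i \<longleftrightarrow> (let Z = {p \<in> core_box i \<rho>. eval (perturbed ?R h \<epsilon>) (core_arc d i p) = 0}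
    in if i \<in> J then compact Z \<and> connected Z \<and> Z \<noteq> {} else Z = {})" for \<epsilon> \<rho> i
  have "\<forall>\<^sub>F \<rho> in at_right 0. \<forall>i\<in>cores d. \<forall>\<^sub>F \<epsilon> in at_right 0. good \<epsilon> \<rho> i"
    unfolding good_def using eventually_zeros_near_core[OF d _ J(2) sign] fin
    by (intro eventually_ball_finite ballI) blast+
  moreover have "\<forall>\<^sub>F \<rho> in at_right 0. \<forall>i\<in>cores d. \<forall>i'\<in>cores d - {i}. \<forall>p\<in>core_box i \<rho>. \<forall>p'\<in>core_box i' \<rho>.
      proj_point (core_arc d i p) \<noteq> proj_point (core_arc d i' p')"
    using fin by (intro eventually_ball_finite ballI eventually_cores_disjoint[OF d]) auto
  moreover have "\<forall>\<^sub>F \<rho> in at_right (0 :: real). \<rho> > 0" by (rule eventually_at_right_less)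
  ultimately have "\<forall>\<^sub>F \<rho> in at_right 0. \<rho> > 0 \<and> (\<forall>i\<in>cores d. \<forall>\<^sub>F \<epsilon> in at_right 0. good \<epsilon> \<rho> i) \<and>
      (\<forall>i\<in>cores d. \<forall>i'\<in>cores d - {i}. \<forall>p\<in>core_box i \<rho>. \<forall>p'\<in>core_box i' \<rho>.
        proj_point (core_arc d i p) \<noteq> proj_point (core_arc d i' p'))"
    by eventually_elim blast
  from eventually_happens'[OF trivial_limit_at_right_real this]
  obtain \<rho> where \<rho>: "\<rho> > 0" "\<forall>i\<in>cores d. \<forall>\<^sub>F \<epsilon> in at_right 0. good \<epsilon> \<rho> i"
    and disjoint: "\<forall>i\<in>cores d. \<forall>i'\<in>cores d - {i}. \<forall>p\<in>core_box i \<rho>. \<forall>p'\<in>core_box i' \<rho>.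
        proj_point (core_arc d i p) \<noteq> proj_point (core_arc d i' p')"
    by (elim exE conjE)
  have "\<forall>\<^sub>F \<epsilon> in at_right 0. \<forall>i\<in>cores d. good \<epsilon> \<rho> i" using \<rho>(2) fin by (intro eventually_ball_finite)
  moreover note eventually_covered[OF d h(1) \<rho>(1)]
  moreover have "\<forall>\<^sub>F \<epsilon> in at_right 0. smooth (perturbed ?R h \<epsilon>)" by (rule smooth_perturbation[OF d h(1) h_node])
  ultimately have "\<forall>\<^sub>F \<epsilon> in at_right 0. (\<forall>i\<in>cores d. good \<epsilon> \<rho> i) \<and> smooth (perturbed ?R h \<epsilon>) \<and>
      (\<forall>v. v \<noteq> 0 \<longrightarrow> eval (perturbed ?R h \<epsilon>) v = 0 \<longrightarrow>
        (\<exists>i\<in>cores d. \<exists>p\<in>core_box i \<rho>. proj_point v = proj_point (core_arc d i p)))"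
    by eventually_elim blast
  from eventually_happens'[OF trivial_limit_at_right_real this]
  obtain \<epsilon> where good: "\<forall>i\<in>cores d. good \<epsilon> \<rho> i" and smooth: "smooth (perturbed ?R h \<epsilon>)"
    and cover: "\<forall>v. v \<noteq> 0 \<longrightarrow> eval (perturbed ?R h \<epsilon>) v = 0 \<longrightarrow>
        (\<exists>i\<in>cores d. \<exists>p\<in>core_box i \<rho>. proj_point v = proj_point (core_arc d i p))"
    by (elim exE conjE)
  define F where "F = perturbed ?R h \<epsilon>"
  have hom: "homogeneous d F" unfolding F_def by (rule homogeneous_perturbed[OF homogeneous_harnack_form[OF d] h(1)])
  have flex: "eval F (vector [x, 0, z]) = (z - x) ^ d" for x z :: complex
    using h(2)[of "vector [x, 0, z]"] by (simp add: F_def eval_perturbed harnack_form_hyperflex[OF d])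
  have irr: "irreducible F" using irreducible_hyperflex[OF hom _ d flex] smooth by (simp add: F_def)
  have branches: "card (branches F) = s"
    unfolding cardJ[symmetric]
  proof (rule card_branches[OF hom fin J(1), of "\<lambda>i. core_box i \<rho>" "core_arc d"])
    fix i assume i: "i \<in> J"
    show "compact {p \<in> core_box i \<rho>. eval F (core_arc d i p) = 0} \<and>
        connected {p \<in> core_box i \<rho>. eval F (core_arc d i p) = 0} \<and> {p \<in> core_box i \<rho>. eval F (core_arc d i p) = 0} \<noteq> {}"
      using bspec[OF good subsetD[OF J(1)], OF i] unfolding good_def F_def Let_def if_P[OF i] .
  next
    fix i p assume i: "i \<in> cores d - J" "p \<in> core_box i \<rho>"
    then have "good \<epsilon> \<rho> i" "i \<notin> J" using good by auto
    then show "eval F (core_arc d i p) \<noteq> 0" using i(2) by (cases p) (auto simp: good_def F_def)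
  qed (use disjoint cover in \<open>auto simp: F_def core_arc_nonzero[OF d] intro: continuous_on_core_arc\<close>)
  \<comment> \<open>An empty space has no components, so s \<ge> 1 already provides a real
    point.\<close>
  have "(zero_locus F :: (real ^ 3) set set) \<noteq> {}"
    using branches assms(3) by (auto simp: branches_def connected_components_of_empty_space)
  then have "real_plane_curve d F" using hom irr smooth by (simp add: real_plane_curve_def F_def)
  moreover have "has_genus F g"
    using has_genus_form[OF hom] irr d unfolding assms(2) by (auto simp: irreducible_def)
  ultimately show ?thesis
    using branches totally_real_hyperflex[OF hom d flex] by (intro exI[of _ F] conjI)
qed

end
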